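(* Consider set-points $p_k^\star,q_k^\star\in\mathbb{R}$, $v_k^\star\in\mathbb{R}_{>0}$ ($k\in\mathcal{N}$) and steady-state angles $\theta^\star_{jk}$ that are consistent (as defined in the context), a stability margin $c\in\mathbb{R}_{>0}$, and control gains $\alpha,\eta\in\mathbb{R}_{>0}$. Suppose there exists $\bar\theta^\star\in[0,\frac{\pi}{2}]$ such that $|\theta^\star_{jk}|\le\bar\theta^\star$ for all $(j,k)\in\mathcal{N}\times\mathcal{N}$, and that for all $k\in\mathcal{N}$ $$\sum_{j:(j,k)\in\mathcal{E}}\|Y_{jk}\|\left|1-\frac{v_j^\star}{v_k^\star}\cos(\theta^\star_{jk})\right|+\alpha<\frac{1+\cos(\bar\theta^\star)}{2}\,\frac{v_{\min}^{\star2}}{v_{\max}^{\star2}}\,\lambda_2(L)-c,$$ $$\eta<\frac{c}{\rho\|\mathcal{Y}\|\,(c+5\|\mathcal{K}-\mathcal{L}\|)},$$ where $v^\star_{\min}:=\min_{k}v_k^\star$, $v^\star_{\max}:=\max_k v_k^\star$, and $\lambda_2(L)$ is the second smallest eigenvalue of the graph Laplacian $L$. Then the dynamics $$\frac{d}{dt}v=\eta\big(\mathcal{K}v-\mathcal{R}_\kappa\mathcal{B}\,i+\alpha\Phi(v)v\big),\qquad \frac{d}{dt}i=L_T^{-1}\big(-Z_Ti+\mathcal{B}^{\mathsf T}v\big)$$ with state $x=(v,i)\in\mathbb{R}^{n}$, $n=2N+2M$, are almost globally asymptotically stable with respect to the set $$\mathcal{T}=\{(v,i)\in\mathbb{R}^n\mid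 v\in\mathcal{S}\cap\mathcal{A},\ i=i^s(v)\},$$ and the origin of $\mathbb{R}^n$ is an exponentially unstable equilibrium.
   Context: Network: $\mathcal{G}$ is a simple undirected graph with nodes $\mathcal{N}=\{1,\dots,N\}$ (inverters) and $M$ edges $\mathcal{E}$ (transmission lines); for fixed $k$, sums over $(j,k)\in\mathcal{E}$ run over the neighbors $j$ of $k$. Line $l$ has resistance $r_l>0$ and inductance $\ell_l>0$; $\omega_0\ge0$ is the nominal frequency. Standing assumption: $\ell_l/r_l=\rho>0$ is the same for all lines. The edge weight of line $l$ is $\|Y_l\|=1/\sqrt{r_l^2+\omega_0^2\ell_l^2}$; $r_{jk},\ell_{jk},\|Y_{jk}\|$ denote the quantities of the line joining $j$ and $k$. Matrices: $R(\theta)=\begin{bmatrix}\cos\theta&-\sin\theta\\ \sin\theta&\cos\theta\end{bmatrix}$, $J=R(\pi/2)$; $B\in\{-1,0,1\}^{N\times M}$ is the oriented incidence matrix, $\mathcal{B}=B\otimes I_2$; $R_T=\mathrm{diag}(\{r_l\})\otimes I_2$, $L_T=\mathrm{diag}(\{\ell_l\})\otimes I_2$, $\mathcal{J}_M=I_M\otimes J$, $Z_T=R_T+\omega_0\mathcal{J}_ML_T$; $\mathcal{Y}=\mathcal{B}Z_T^{-1}\mathcal{B}^{\mathsf T}$; $\kappa=\tan^{-1}(\rho\omega_0)$, $\mathcal{R}_\kappa=I_N\otimes R(\kappa)$; $L=B\,\mathrm{diag}(\{\|Y_l\|\}_{l=1}^M)B^{\mathsf T}$, $\mathcal{L}=L\otimes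 I_2$. Matrix norms are induced 2-norms. $i^s(v)=Z_T^{-1}\mathcal{B}^{\mathsf T}v$. Angles and consistency: steady-state angles are given by $\theta^\star_{k1}$, $k\in\mathcal{N}$, with $\theta^\star_{11}=0$, and $\theta^\star_{jk}:=\theta^\star_{j1}-\theta^\star_{k1}$. The set-points and angles are consistent if, with $\theta^\star_{jk}\in(-\pi,\pi]$ and the branch powers $$p^\star_{jk}=\|Y_{jk}\|^2\big(v_k^{\star2}r_{jk}-v_k^\star v_j^\star(r_{jk}\cos\theta^\star_{jk}+\omega_0\ell_{jk}\sin\theta^\star_{jk})\big),$$ $$q^\star_{jk}=\|Y_{jk}\|^2\big(v_k^{\star2}\omega_0\ell_{jk}-v_k^\star v_j^\star(\omega_0\ell_{jk}\cos\theta^\star_{jk}-r_{jk}\sin\theta^\star_{jk})\big)$$ for $(j,k)\in\mathcal{E}$, one has $p_k^\star=\sum_{(j,k)\in\mathcal{E}}p^\star_{jk}$ and $q_k^\star=\sum_{(j,k)\in\mathcal{E}}q_{jk}^\star$ for all $k\in\mathcal{N}$. Controller: $\mathcal{K}=\mathrm{diag}(\{K_k\}_{k=1}^N)$ (block diagonal) with $K_k=\frac{1}{v_k^{\star2}}R(\kappa)\begin{bmatrix}p_k^\star&q_k^\star\\-q_k^\star&p_k^\star\end{bmatrix}$; for $v=(v_1,\dots,v_N)$, $v_k\in\mathbb{R}^2$, $\Phi(v)=\mathrm{diag}(\{\Phi_k(v_k)\}_{k=1}^N)$ with $\Phi_k(v_k)=\frac{v_k^{\star2}-\|v_k\|^2}{v_k^{\star2}}I_2$.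 Sets: $\mathcal{S}=\{v\in\mathbb{R}^{2N}\mid \frac{v_k}{v_k^\star}=R(\theta^\star_{k1})\frac{v_1}{v_1^\star}\ \forall k\in\mathcal{N}\setminus\{1\}\}$, $\mathcal{A}=\{v\in\mathbb{R}^{2N}\mid\|v_k\|=v_k^\star\ \forall k\in\mathcal{N}\}$. Stability: let $\varphi_f(t,x_0)$ be the solution at time $t$ of $\frac{d}{dt}x=f(x)$, $x(0)=x_0$, and $\|x\|_{\mathcal{C}}=\min_{z\in\mathcal{C}}\|z-x\|$. The system is almost globally asymptotically stable with respect to a compact set $\mathcal{C}$ if (i) $\lim_{t\to\infty}\|\varphi_f(t,x_0)\|_{\mathcal{C}}=0$ for all $x_0$ outside a set of zero Lebesgue measure, and (ii) for every $\varepsilon>0$ there is $\delta>0$ such that $\|x_0\|_{\mathcal{C}}<\delta$ implies $\|\varphi_f(t,x_0)\|_{\mathcal{C}}<\varepsilon$ for all $t\ge0$. An equilibrium is exponentially unstable if the Jacobian of the vector field at it has at least one eigenvalue with positive real part. *)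

theory Defs
  imports "HOL-Analysis.Analysis" "HOL-Library.Multiset"
begin

definition solves :: "('a::real_normed_vector \<Rightarrow> 'a) \<Rightarrow> 'a \<Rightarrow> (real \<Rightarrow> 'a) \<Rightarrow> bool" where
  "solves f x0 x \<longleftrightarrow>
     x 0 = x0 \<and> (\<forall>t\<ge>0. (x has_vector_derivative f (x t)) (at t within {0..}))"

text \<open>Meaningful where a forward solution exists and is unique, see \<open>well_posed\<close> below.\<close>

definition flow :: "('a::real_normed_vector \<Rightarrow> 'a) \<Rightarrow> real \<Rightarrow> 'a \<Rightarrow> 'a" where
  "flow f t x0 = (THE y. \<exists>x. solves f x0 x \<and> x t = y)"

definition well_posed :: "('a::real_normed_vector \<Rightarrow> 'a) \<Rightarrow> bool" where
  "well_posed f \<longleftrightarrow>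
     (\<forall>x0. (\<exists>x. solves f x0 x) \<and>
           (\<forall>x y. solves f x0 x \<longrightarrow> solves f x0 y \<longrightarrow> (\<forall>t\<ge>0. x t = y t)))"

text \<open>For a nonempty compact set, \<^const>\<open>infdist\<close> is the attained minimal distance.\<close>

definition almost_globally_asymptotically_stable ::
    "('a::euclidean_space \<Rightarrow> 'a) \<Rightarrow> 'a set \<Rightarrow> bool" where
  "almost_globally_asymptotically_stable f C \<longleftrightarrow>
     well_posed f \<and> compact C \<and> C \<noteq> {} \<and>
     (\<exists>Z\<in>null_sets lebesgue. \<forall>x0. x0 \<notin> Z \<longrightarrow>
        ((\<lambda>t. infdist (flow f t x0) C) \<longlongrightarrow> 0) at_top) \<and>
     (\<forall>\<epsilon>>0. \<exists>\<delta>>0. \<forall>x0. infdist x0 C < \<delta> \<longrightarrow> (\<forall>t\<ge>0. infdist (flow f t x0) C < \<epsilon>))"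

definition eigenvalue :: "'a::field^'n^'n \<Rightarrow> 'a \<Rightarrow> bool" where
  "eigenvalue A \<mu> \<longleftrightarrow> (\<exists>w. w \<noteq> 0 \<and> A *v w = \<mu> *s w)"

definition exponentially_unstable_equilibrium :: "(real^'s \<Rightarrow> real^'s) \<Rightarrow> real^'s \<Rightarrow> bool" where
  "exponentially_unstable_equilibrium f x \<longleftrightarrow>
     f x = 0 \<and> f differentiable (at x) \<and>
     (\<exists>\<mu>::complex. eigenvalue (map_matrix complex_of_real (jacobian f (at x))) \<mu> \<and> Re \<mu> > 0)"

definition mat_norm :: "real^'a^'b \<Rightarrow> real" where
  "mat_norm A = onorm ((*v) A)"

text \<open>Eigenvalues of a real symmetric matrix in increasing order, each repeated according to its
  multiplicity (geometric, which for symmetric matrices equals the algebraic one).\<close>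

definition eigenvalue_list :: "real^'n^'n \<Rightarrow> real list" where
  "eigenvalue_list A =
     sorted_list_of_multiset
       (\<Sum>\<mu> | eigenvalue A \<mu>. replicate_mset (dim {w. A *v w = \<mu> *s w}) \<mu>)"

definition lambda2 :: "real^'n^'n \<Rightarrow> real" where
  "lambda2 A = eigenvalue_list A ! 1"

definition rot :: "real \<Rightarrow> real^2^2" where
  "rot \<theta> = vector [vector [cos \<theta>, - sin \<theta>], vector [sin \<theta>, cos \<theta>]]"

definition J :: "real^2^2" where
  "J = rot (pi / 2)"

definition diag :: "('n \<Rightarrow> real) \<Rightarrow> real^'n^'n" where
  "diag d = (\<chi> i j. if i = j then d i else 0)"

definition blockdiag :: "('n::finite \<Rightarrow> real^'b::finite^'b) \<Rightarrow> real^('n \<times> 'b)^('n \<times> 'b)" where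
  "blockdiag D = (\<chi> s t. if fst s = fst t then D (fst s) $ snd s $ snd t else 0)"

definition kron :: "real^'m::finite^'n::finite \<Rightarrow> real^'b::finite^'a::finite \<Rightarrow> real^('m \<times> 'b)^('n \<times> 'a)" where
  "kron A C = (\<chi> s t. A $ fst s $ fst t * C $ snd s $ snd t)"

definition block :: "real^('n::finite \<times> 2) \<Rightarrow> 'n \<Rightarrow> real^2" where
  "block v k = (\<chi> a. v $ (k, a))"

text \<open>The nodes are the elements of \<open>'n\<close> and the lines those of \<open>'m\<close>;
  \<open>src\<close> and \<open>dst\<close> fix an arbitrary orientation of each line, and
  \<open>freq\<close> is the nominal angular frequency.\<close>

record ('n, 'm) network =
  src :: "'m \<Rightarrow> 'n"
  dst :: "'m \<Rightarrow> 'n"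
  res :: "'m \<Rightarrow> real"
  ind :: "'m \<Rightarrow> real"
  freq :: real

definition ends :: "('n, 'm) network \<Rightarrow> 'm \<Rightarrow> 'n set" where
  "ends G l = {src G l, dst G l}"

definition power_network :: "('n, 'm) network \<Rightarrow> real \<Rightarrow> bool" where
  "power_network G \<rho> \<longleftrightarrow>
     (\<forall>l. src G l \<noteq> dst G l) \<and> inj (ends G) \<and>
     (\<forall>l. res G l > 0 \<and> ind G l > 0) \<and> freq G \<ge> 0 \<and>
     \<rho> > 0 \<and> (\<forall>l. ind G l / res G l = \<rho>)"

definition nbrs :: "('n, 'm) network \<Rightarrow> 'n \<Rightarrow> 'n set" where
  "nbrs G k = {j. \<exists>l. ends G l = {j, k}}"

definition line :: "('n, 'm) network \<Rightarrow> 'n \<Rightarrow> 'n \<Rightarrow> 'm" where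
  "line G j k = (THE l. ends G l = {j, k})"

definition weight :: "('n, 'm) network \<Rightarrow> 'm \<Rightarrow> real" where
  "weight G l = 1 / sqrt ((res G l)\<^sup>2 + (freq G)\<^sup>2 * (ind G l)\<^sup>2)"

definition incidence :: "('n::finite, 'm::finite) network \<Rightarrow> real^'m^'n" where
  "incidence G = (\<chi> k l. if k = src G l then 1 else if k = dst G l then - 1 else 0)"

definition calB :: "('n::finite, 'm::finite) network \<Rightarrow> real^('m \<times> 2)^('n \<times> 2)" where
  "calB G = kron (incidence G) (mat 1)"

definition R_T :: "('n, 'm::finite) network \<Rightarrow> real^('m \<times> 2)^('m \<times> 2)" where
  "R_T G = kron (diag (res G)) (mat 1)"

definition L_T :: "('n, 'm::finite) network \<Rightarrow> real^('m \<times> 2)^('m \<times> 2)" where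
  "L_T G = kron (diag (ind G)) (mat 1)"

definition Z_T :: "('n, 'm::finite) network \<Rightarrow> real^('m \<times> 2)^('m \<times> 2)" where
  "Z_T G = R_T G + freq G *\<^sub>R (kron (mat 1) J ** L_T G)"

definition calY :: "('n::finite, 'm::finite) network \<Rightarrow> real^('n \<times> 2)^('n \<times> 2)" where
  "calY G = calB G ** matrix_inv (Z_T G) ** transpose (calB G)"

definition laplacian :: "('n::finite, 'm::finite) network \<Rightarrow> real^'n^'n" where
  "laplacian G = incidence G ** diag (weight G) ** transpose (incidence G)"

definition calL :: "('n::finite, 'm::finite) network \<Rightarrow> real^('n \<times> 2)^('n \<times> 2)" where
  "calL G = kron (laplacian G) (mat 1)"

definition kappa :: "('n, 'm) network \<Rightarrow> real \<Rightarrow> real" where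
  "kappa G \<rho> = arctan (\<rho> * freq G)"

definition calR :: "('n::finite, 'm) network \<Rightarrow> real \<Rightarrow> real^('n \<times> 2)^('n \<times> 2)" where
  "calR G \<rho> = kron (mat 1) (rot (kappa G \<rho>))"

definition steady_current ::
    "('n::finite, 'm::finite) network \<Rightarrow> real^('n \<times> 2) \<Rightarrow> real^('m \<times> 2)" where
  "steady_current G v = matrix_inv (Z_T G) *v (transpose (calB G) *v v)"

text \<open>A vector \<open>\<theta>\<close> of angles assigns to node \<open>k\<close> its angle relative to the reference node.\<close>

definition rel_angle :: "('n \<Rightarrow> real) \<Rightarrow> 'n \<Rightarrow> 'n \<Rightarrow> real" where
  "rel_angle \<theta> j k = \<theta> j - \<theta> k"

definition branch_p ::
    "('n, 'm) network \<Rightarrow> ('n \<Rightarrow> real) \<Rightarrow> ('n \<Rightarrow> real) \<Rightarrow> 'n \<Rightarrow> 'n \<Rightarrow> real" where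
  "branch_p G vs \<theta> j k = (let l = line G j k; r = res G l; x = freq G * ind G l in
     (weight G l)\<^sup>2 *
       ((vs k)\<^sup>2 * r - vs k * vs j * (r * cos (rel_angle \<theta> j k) + x * sin (rel_angle \<theta> j k))))"

definition branch_q ::
    "('n, 'm) network \<Rightarrow> ('n \<Rightarrow> real) \<Rightarrow> ('n \<Rightarrow> real) \<Rightarrow> 'n \<Rightarrow> 'n \<Rightarrow> real" where
  "branch_q G vs \<theta> j k = (let l = line G j k; r = res G l; x = freq G * ind G l in
     (weight G l)\<^sup>2 *
       ((vs k)\<^sup>2 * x - vs k * vs j * (x * cos (rel_angle \<theta> j k) - r * sin (rel_angle \<theta> j k))))"

definition consistent ::
    "('n, 'm) network \<Rightarrow> ('n \<Rightarrow> real) \<Rightarrow> ('n \<Rightarrow> real) \<Rightarrow> ('n \<Rightarrow> real) \<Rightarrow> ('n \<Rightarrow> real) \<Rightarrow> bool" where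
  "consistent G ps qs vs \<theta> \<longleftrightarrow>
     (\<forall>k. \<forall>j\<in>nbrs G k. rel_angle \<theta> j k \<in> {- pi<..pi}) \<and>
     (\<forall>k. ps k = (\<Sum>j\<in>nbrs G k. branch_p G vs \<theta> j k) \<and>
          qs k = (\<Sum>j\<in>nbrs G k. branch_q G vs \<theta> j k))"

definition calK ::
    "('n::finite, 'm) network \<Rightarrow> real \<Rightarrow> ('n \<Rightarrow> real) \<Rightarrow> ('n \<Rightarrow> real) \<Rightarrow> ('n \<Rightarrow> real) \<Rightarrow>
     real^('n \<times> 2)^('n \<times> 2)" where
  "calK G \<rho> ps qs vs = blockdiag (\<lambda>k. (1 / (vs k)\<^sup>2) *\<^sub>R
     (rot (kappa G \<rho>) ** vector [vector [ps k, qs k], vector [- qs k, ps k]]))"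

definition Phi :: "('n::finite \<Rightarrow> real) \<Rightarrow> real^('n \<times> 2) \<Rightarrow> real^('n \<times> 2)^('n \<times> 2)" where
  "Phi vs v = blockdiag (\<lambda>k. (((vs k)\<^sup>2 - (norm (block v k))\<^sup>2) / (vs k)\<^sup>2) *\<^sub>R mat 1)"

definition pair_state ::
    "real^('n::finite \<times> 2) \<Rightarrow> real^('m::finite \<times> 2) \<Rightarrow> real^('n \<times> 2 + 'm \<times> 2)" where
  "pair_state v i = (\<chi> s. case s of Inl a \<Rightarrow> v $ a | Inr b \<Rightarrow> i $ b)"

definition voltage :: "real^('n::finite \<times> 2 + 'm::finite \<times> 2) \<Rightarrow> real^('n \<times> 2)" where
  "voltage x = (\<chi> a. x $ Inl a)"

definition current :: "real^('n::finite \<times> 2 + 'm::finite \<times> 2) \<Rightarrow> real^('m \<times> 2)" where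
  "current x = (\<chi> b. x $ Inr b)"

definition closed_loop ::
    "('n::finite, 'm::finite) network \<Rightarrow> real \<Rightarrow> ('n \<Rightarrow> real) \<Rightarrow> ('n \<Rightarrow> real) \<Rightarrow> ('n \<Rightarrow> real) \<Rightarrow>
     real \<Rightarrow> real \<Rightarrow> real^('n \<times> 2 + 'm \<times> 2) \<Rightarrow> real^('n \<times> 2 + 'm \<times> 2)" where
  "closed_loop G \<rho> ps qs vs \<alpha> \<eta> x = (let v = voltage x; i = current x in
     pair_state
       (\<eta> *\<^sub>R (calK G \<rho> ps qs vs *v v - (calR G \<rho> ** calB G) *v i + \<alpha> *\<^sub>R (Phi vs v *v v)))
       (matrix_inv (L_T G) *v (- (Z_T G *v i) + transpose (calB G) *v v)))"

definition setS ::
    "'n::finite \<Rightarrow> ('n \<Rightarrow> real) \<Rightarrow> ('n \<Rightarrow> real) \<Rightarrow> (real^('n \<times> 2)) set" where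
  "setS ref vs \<theta> = {v. \<forall>k. k \<noteq> ref \<longrightarrow>
     (1 / vs k) *\<^sub>R block v k = rot (rel_angle \<theta> k ref) *v ((1 / vs ref) *\<^sub>R block v ref)}"

definition setA :: "('n::finite \<Rightarrow> real) \<Rightarrow> (real^('n \<times> 2)) set" where
  "setA vs = {v. \<forall>k. norm (block v k) = vs k}"

definition setT ::
    "('n::finite, 'm::finite) network \<Rightarrow> 'n \<Rightarrow> ('n \<Rightarrow> real) \<Rightarrow> ('n \<Rightarrow> real) \<Rightarrow>
     (real^('n \<times> 2 + 'm \<times> 2)) set" where
  "setT G ref vs \<theta> = {pair_state v i |v i. v \<in> setS ref vs \<theta> \<inter> setA vs \<and> i = steady_current G v}"

end

theory Submission
  imports Defs "HOL-Computational_Algebra.Fundamental_Theorem_Algebra"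
begin

text \<open>
  Identify each \<open>\<real>\<^sup>2\<close> block with \<open>\<complex>\<close>. Let \<open>s\<close> be the vector of set-points \<open>v\<^sub>k\<^sup>\<star> exp (i \<theta>\<^sub>k)\<close>, \<open>P\<close> the
  projection off its complex span, \<open>e = i - i\<^sup>s(v)\<close> and \<open>b = \<R>\<^sub>\<kappa> \<B> e\<close>. Consistency says that \<open>\<K> - \<L>\<close>
  vanishes on the span of \<open>s\<close>, and the stability margin makes it decay on the complement. The function
  \<open>\<parallel>P v\<parallel>\<^sup>2 / 2 + a \<Sum> (v\<^sub>k\<^sup>\<star>\<^sup>2 - \<parallel>v\<^sub>k\<parallel>\<^sup>2)\<^sup>2 / (4 v\<^sub>k\<^sup>\<star>\<^sup>2) + d \<parallel>b\<parallel>\<^sup>2 / 2 + \<delta> \<parallel>e\<parallel>\<^sup>2 / 2\<close> with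
  \<open>a = \<alpha> c / \<parallel>\<K> - \<L>\<parallel>\<^sup>2\<close>, \<open>d = 1 / (\<parallel>\<K> - \<L>\<parallel> \<parallel>\<Y>\<parallel>)\<close> and small \<open>\<delta>\<close> then decreases strictly off the
  target set and the origin; the bound on \<open>\<eta>\<close> is what makes the cross terms harmless.

  The same estimate for the linearised field shows that minus the Hessian of this function at the origin
  is an indefinite form that grows along differences of solutions near the origin. Hence no two
  points whose orbits stay near the origin differ by a multiple of \<open>(s, i\<^sup>s(s))\<close>: their set has disjoint
  translates, so it is null, and its preimages under the flow, whose inverse is locally Lipschitz, are null
  too. No stable manifold theorem is needed. The same form forces an eigenvalue with positive real part.
\<close>

section \<open>Solutions of differential equations\<close>

text \<open>The uniform ratio \<rho> does two jobs. All line impedances share the argument \<kappa>,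
  so rotating by \<kappa> turns the complex admittance matrix into the real Laplacian. And in the
  variable e every line obeys the same scalar law, decay at rate 1/\<rho> plus rotation, driven by
  the voltage rate; its nodal image b obeys it too, driven through \<open>calL\<close>, whose norm
  is at most that of \<open>calY\<close>. Hence the term in b, from which the bound on \<eta>
  arises. Since b is blind to currents circulating in cycles, a small multiple of |e|^2 is added.

  The obstacle is the equilibrium at the origin: energy decay alone yields convergence to the target
  or to the origin. The estimate uses one property of the restoring force \<phi>: its inner product
  with P v is at most |P v|^2. The true force and its linear part v both have it, so one inequality
  gives decay of the energy and, with reversed sign, growth of the quadratic form.\<close>

lemma exp_growth_lower:
  fixes g g' :: "real \<Rightarrow> real"
  assumes "0 \<le> T"
    and der: "\<And>t. 0 \<le> t \<Longrightarrow> t \<le> T \<Longrightarrow> (g has_vector_derivative g' t) (at t within {0..})"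
    and ge: "\<And>t. 0 \<le> t \<Longrightarrow> t \<le> T \<Longrightarrow> g' t \<ge> k * g t"
  shows "g T \<ge> exp (k * T) * g 0"
proof -
  \<comment> \<open>Integrating factor; k may have either sign.\<close>
  define h where "h = (\<lambda>t. exp (- k * t) * g t)"
  have hd: "(h has_vector_derivative exp (- k * t) * (g' t - k * g t)) (at t within {0..})"
    if "0 \<le> t" "t \<le> T" for t
    unfolding h_def using der[OF that]
    by (auto intro!: derivative_eq_intros simp: has_real_derivative_iff_has_vector_derivative[symmetric]
        algebra_simps)
  have "h 0 \<le> h T"
  \<comment> \<open>The derivative at 0 is one-sided, so monotonicity is derived on the open
    interval and continuity covers the endpoints.\<close>
  proof (rule DERIV_nonneg_imp_increasing_open[OF \<open>0 \<le> T\<close>])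
    fix t assume t: "0 < t" "t < T"
    have "(h has_vector_derivative exp (- k * t) * (g' t - k * g t)) (at t)"
      using hd[of t] t at_within_interior[of t "{0..}"] by auto
    moreover have "exp (- k * t) * (g' t - k * g t) \<ge> 0"
      using ge[of t] t by simp
    ultimately show "\<exists>y. DERIV h t :> y \<and> y \<ge> 0"
      by (auto simp: has_real_derivative_iff_has_vector_derivative)
  next
    show "continuous_on {0..T} h"
      unfolding continuous_on_eq_continuous_within
      by (meson hd has_vector_derivative_continuous continuous_within_subset atLeastAtMost_iff
          atLeast_iff subsetI)
  qed
  then have "exp (k * T) * g 0 \<le> exp (k * T) * (exp (- k * T) * g T)"
    by (simp add: h_def)
  also have "\<dots> = g T"
    by (simp add: mult.assoc[symmetric] exp_add[symmetric])
  finally show ?thesis .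
qed

lemma solves_derivative:
  "solves f x0 x \<Longrightarrow> 0 \<le> t \<Longrightarrow> (x has_vector_derivative f (x t)) (at t within {0..})"
  by (simp add: solves_def)

lemma solves_continuous: "solves f x0 x \<Longrightarrow> continuous_on {0..} x"
  unfolding continuous_on_eq_continuous_within
  using solves_derivative has_vector_derivative_continuous by fastforce

text \<open>Q may be indefinite. It is used with the inner product and its negative, which bounds
  distances from both sides, and with the form that expands near the origin.\<close>

lemma bilinear_growth:
  fixes x y :: "real \<Rightarrow> 'a::real_normed_vector"
  assumes bil: "bounded_bilinear Q" and sym: "\<And>u v. Q u v = Q v u"
    and "0 \<le> T" and x: "solves f x0 x" and y: "solves f y0 y"
    and ge: "\<And>t. 0 \<le> t \<Longrightarrow> t \<le> T \<Longrightarrow>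
        Q (x t - y t) (f (x t) - f (y t)) \<ge> k * (Q (x t - y t) (x t - y t) :: real)"
  shows "Q (x T - y T) (x T - y T) \<ge> exp (2 * k * T) * Q (x0 - y0) (x0 - y0)"
proof -
  have "((\<lambda>t. Q (x t - y t) (x t - y t)) has_vector_derivative
      2 * Q (x t - y t) (f (x t) - f (y t))) (at t within {0..})" if "0 \<le> t" for t
  proof -
    have *: "((\<lambda>t. x t - y t) has_vector_derivative f (x t) - f (y t)) (at t within {0..})"
      using solves_derivative[OF x that] solves_derivative[OF y that] by (rule has_vector_derivative_diff)
    from bounded_bilinear.has_vector_derivative[OF bil * *]
    show ?thesis by (simp add: sym)
  qed
  from exp_growth_lower[OF \<open>0 \<le> T\<close> this, of "2 * k"] ge x y
  show ?thesis by (auto simp: solves_def)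
qed

text \<open>Gronwall in both directions from one Lipschitz bound: \<open>bilinear_growth\<close> is
  applied to minus the inner product with rate L and to the inner product with rate -L. The second
  estimate is what makes the inverse of the flow locally Lipschitz.\<close>

lemma solution_distance:
  fixes x y :: "real \<Rightarrow> 'a::real_inner"
  assumes L: "L-lipschitz_on S f" and "0 \<le> T" and x: "solves f x0 x" and y: "solves f y0 y"
    and in_S: "\<And>t. 0 \<le> t \<Longrightarrow> t \<le> T \<Longrightarrow> x t \<in> S \<and> y t \<in> S"
  shows "norm (x T - y T) \<le> exp (L * T) * norm (x0 - y0)"
    and "norm (x0 - y0) \<le> exp (L * T) * norm (x T - y T)"
proof -
  have bd: "\<bar>(x t - y t) \<bullet> (f (x t) - f (y t))\<bar> \<le> L * ((x t - y t) \<bullet> (x t - y t))"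
    if "0 \<le> t" "t \<le> T" for t
  proof -
    have "\<bar>(x t - y t) \<bullet> (f (x t) - f (y t))\<bar> \<le> norm (x t - y t) * norm (f (x t) - f (y t))"
      by (rule Cauchy_Schwarz_ineq2)
    also have "\<dots> \<le> norm (x t - y t) * (L * norm (x t - y t))"
      using lipschitz_onD[OF L] in_S[OF that] by (intro mult_left_mono) (auto simp: dist_norm)
    finally show ?thesis by (simp add: dot_square_norm power2_eq_square ac_simps)
  qed
  have le_if_sq_le: "norm u \<le> exp (L * T) * norm v"
    if "u \<bullet> u \<le> exp (2 * L * T) * (v \<bullet> v)" for u v :: 'a
  proof (rule power2_le_imp_le)
    show "(norm u)\<^sup>2 \<le> (exp (L * T) * norm v)\<^sup>2"
      using that by (simp add: dot_square_norm power_mult_distrib exp_double[symmetric] ac_simps)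
  qed simp
  have neg: "bounded_bilinear (\<lambda>u v :: 'a. - (u \<bullet> v))"
    by (simp add: bounded_bilinear.comp1[OF bounded_bilinear_inner
          bounded_linear_minus[OF bounded_linear_ident]] flip: inner_minus_left)
  have "- ((x T - y T) \<bullet> (x T - y T)) \<ge> exp (2 * L * T) * - ((x0 - y0) \<bullet> (x0 - y0))"
    by (rule bilinear_growth[OF neg _ \<open>0 \<le> T\<close> x y]) (use bd in \<open>force simp: inner_commute abs_le_iff\<close>)+
  then show "norm (x T - y T) \<le> exp (L * T) * norm (x0 - y0)"
    by (intro le_if_sq_le) simp
  have "(x T - y T) \<bullet> (x T - y T) \<ge> exp (2 * (- L) * T) * ((x0 - y0) \<bullet> (x0 - y0))"
    by (rule bilinear_growth[OF bounded_bilinear_inner _ \<open>0 \<le> T\<close> x y])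
      (use bd in \<open>force simp: inner_commute abs_le_iff\<close>)+
  then have "exp (2 * L * T) * ((x T - y T) \<bullet> (x T - y T)) \<ge>
      exp (2 * L * T) * (exp (2 * (- L) * T) * ((x0 - y0) \<bullet> (x0 - y0)))"
    by (intro mult_left_mono) auto
  then show "norm (x0 - y0) \<le> exp (L * T) * norm (x T - y T)"
    by (intro le_if_sq_le) (simp add: mult.assoc[symmetric] exp_add[symmetric])
qed

text \<open>Picard iteration in a weighted supremum norm. The unknown is y(t) = exp(-2Lt) x(t); the
  weight makes the integral operator a contraction on the whole half-line at once. Boundedness of F
  lets x grow at most linearly, so that y is bounded.\<close>

lemma solves_exists_bounded_lipschitz:
  fixes F :: "'a::banach \<Rightarrow> 'a"
  assumes lip: "L-lipschitz_on UNIV F" and "L > 0" and bd: "\<And>x. norm (F x) \<le> K"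
  shows "\<exists>x. solves F x0 x"
proof -
  have contF: "continuous_on S F" for S
    using lipschitz_on_continuous_on[OF lip] continuous_on_subset by blast
  have "K \<ge> 0" using bd[of 0] norm_ge_zero order_trans by blast
  define G where "G = (\<lambda>(y :: real \<Rightarrow>\<^sub>C 'a) s. F (exp (2 * L * s) *\<^sub>R y s))"
  have contG: "continuous_on S (G y)" for S y
    unfolding G_def by (intro continuous_on_compose2[OF contF] continuous_intros) auto
  define I where "I = (\<lambda>y t. integral {0..t} (G y))"
  have I_deriv: "(I y has_vector_derivative G y t) (at t within {0..})" if "0 \<le> t" for y t
  proof -
    have "(I y has_vector_derivative G y t) (at t within {0..t+1})"
      unfolding I_def by (rule integral_has_vector_derivative[OF contG]) (use that in auto)
    moreover have "at t within {0..t+1} = at t within {0..}"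
      by (rule at_within_nhd[of _ "{..<t+1}"]) (auto simp: that)
    ultimately show ?thesis by simp
  qed
  have I_cont: "continuous_on {0..} (I y)" for y
    unfolding continuous_on_eq_continuous_within
    using I_deriv has_vector_derivative_continuous by fastforce
  have I_bound: "norm (I y t) \<le> K * t" if "0 \<le> t" for y t
    unfolding I_def using integral_bound[OF that contG, where B = K] bd by (auto simp: G_def)
  have I_diff: "norm (I y t - I z t) \<le> exp (2 * L * t) * (dist y z / 2)" if "0 \<le> t" for y z t
  proof -
    \<comment> \<open>The integral of L exp(2Ls) is at most exp(2Lt)/2: the origin of the
      contraction factor 1/2.\<close>
    have int: "((\<lambda>s. exp (2 * L * s) * (L * dist y z)) has_integral
        exp (2 * L * t) * (dist y z / 2) - exp (2 * L * 0) * (dist y z / 2)) {0..t}"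
      using that \<open>L > 0\<close>
      by (intro fundamental_theorem_of_calculus)
        (auto intro!: derivative_eq_intros simp: has_real_derivative_iff_has_vector_derivative[symmetric])
    have "I y t - I z t = integral {0..t} (\<lambda>s. G y s - G z s)"
      unfolding I_def by (rule integral_diff[symmetric]) (auto intro!: integrable_continuous_real contG)
    also have "norm \<dots> \<le> integral {0..t} (\<lambda>s. exp (2 * L * s) * (L * dist y z))"
    proof (rule integral_norm_bound_integral)
      fix s
      have "norm (G y s - G z s) \<le> L * norm (exp (2 * L * s) *\<^sub>R y s - exp (2 * L * s) *\<^sub>R z s)"
        using lipschitz_onD[OF lip] by (simp add: G_def dist_norm)
      also have "\<dots> = exp (2 * L * s) * (L * dist (y s) (z s))"
        by (simp add: scaleR_diff_right[symmetric] dist_norm)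
      also have "\<dots> \<le> exp (2 * L * s) * (L * dist y z)"
        using dist_bounded[of y s z] \<open>L > 0\<close> by simp
      finally show "norm (G y s - G z s) \<le> exp (2 * L * s) * (L * dist y z)" .
    qed (use int in \<open>auto intro!: integrable_continuous_real continuous_intros contG\<close>)
    also have "\<dots> \<le> exp (2 * L * t) * (dist y z / 2)"
      using integral_unique[OF int] by simp
    finally show ?thesis .
  qed
  \<comment> \<open>Bounded continuous functions live on the whole line; \<open>max 0 t\<close>
    continues the iterate to negative times by the constant \<open>x0\<close>.\<close>
  define H where "H = (\<lambda>y t. exp (- (2 * L * max 0 t)) *\<^sub>R (x0 + I y (max 0 t)))"
  have H_bcont: "H y \<in> bcontfun" for y
  proof (rule bcontfun_normI)
    show "continuous_on UNIV (H y)"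
      unfolding H_def by (intro continuous_intros continuous_on_compose2[OF I_cont]) auto
    show "norm (H y t) \<le> norm x0 + K / (2 * L)" for t
    proof -
      define s where "s = max 0 t"
      have s: "s \<ge> 0" by (simp add: s_def)
      have "2 * L * s \<le> exp (2 * L * s)"
        using exp_ge_add_one_self[of "2 * L * s"] by linarith
      then have "exp (- (2 * L * s)) * (2 * L * s) \<le> exp (- (2 * L * s)) * exp (2 * L * s)"
        by (rule mult_left_mono) simp
      then have le1: "exp (- (2 * L * s)) * (2 * L * s) \<le> 1" by (simp add: exp_minus)
      have "norm (H y t) \<le> exp (- (2 * L * s)) * (norm x0 + K * s)"
        unfolding H_def s_def[symmetric] using norm_triangle_ineq[of x0 "I y s"] I_bound[OF s, of y]
        by (simp add: mult_left_mono)
      also have "\<dots> = exp (- (2 * L * s)) * norm x0 + (exp (- (2 * L * s)) * (2 * L * s)) * (K / (2 * L))"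
        using \<open>L > 0\<close> by (simp add: field_simps)
      also have "\<dots> \<le> 1 * norm x0 + 1 * (K / (2 * L))"
        using le1 \<open>K \<ge> 0\<close> \<open>L > 0\<close> s by (intro add_mono mult_right_mono) auto
      finally show ?thesis by simp
    qed
  qed
  have contraction: "dist (Bcontfun (H y)) (Bcontfun (H z)) \<le> 1 / 2 * dist y z" for y z
  proof (rule dist_bound)
    fix t :: real
    define s where "s = max 0 t"
    have "dist (H y t) (H z t) = exp (- (2 * L * s)) * norm (I y s - I z s)"
      by (simp add: H_def dist_norm scaleR_diff_right[symmetric] s_def)
    also have "\<dots> \<le> exp (- (2 * L * s)) * (exp (2 * L * s) * (dist y z / 2))"
      using I_diff[of s y z] by (intro mult_left_mono) (auto simp: s_def)
    also have "\<dots> = dist y z / 2"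
      by (simp add: exp_minus)
    finally show "dist (Bcontfun (H y) t) (Bcontfun (H z) t) \<le> 1 / 2 * dist y z"
      by (simp add: Bcontfun_inverse H_bcont)
  qed
  have "\<exists>!y. Bcontfun (H y) = y"
    by (rule banach_fix_type[of "1 / 2"]) (use contraction in auto)
  then obtain y where "Bcontfun (H y) = y" by blast
  then have y: "y t = H y t" for t
    using Bcontfun_inverse[OF H_bcont, of y] by metis
  define x where "x = (\<lambda>t. x0 + I y t)"
  have "exp (2 * L * t) *\<^sub>R y t = x t" if "0 \<le> t" for t
    using that unfolding y x_def H_def by (simp add: exp_minus)
  then have "(x has_vector_derivative F (x t)) (at t within {0..})" if "0 \<le> t" for t
    using I_deriv[OF that, of y] that unfolding x_def G_def by (auto intro!: derivative_eq_intros)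
  moreover have "x 0 = x0" by (simp add: x_def I_def)
  ultimately show ?thesis by (auto simp: solves_def)
qed

section \<open>Lyapunov systems with an unstable equilibrium\<close>

text \<open>These assumptions make the forward flow complete. The sign of \<open>V\<close> and the
  zero set of \<open>w\<close> are left to the extension that proves convergence.\<close>

locale lyapunov_system =
  fixes f :: "'a::euclidean_space \<Rightarrow> 'a" and V :: "'a \<Rightarrow> real" and V' :: "'a \<Rightarrow> 'a \<Rightarrow> real"
    and w :: "'a \<Rightarrow> real"
  assumes lipschitz_cball: "\<And>r. \<exists>L. L-lipschitz_on (cball 0 r) f"
    and V_derivative: "\<And>x. (V has_derivative V' x) (at x)"
    and V_decay: "\<And>x. V' x (f x) \<le> - w x"
    and w_nonneg: "\<And>x. w x \<ge> 0"
    and w_continuous: "continuous_on UNIV w"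
    and V_sublevel_bounded: "\<And>c. bounded {x. V x \<le> c}"
begin

section \<open>Global existence and uniqueness\<close>

lemma lipschitz_bounded:
  assumes "bounded S"
  obtains L where "L > 0" "L-lipschitz_on S f"
proof -
  from assms obtain r where "S \<subseteq> cball 0 r"
    unfolding bounded_iff by (auto simp: subset_iff)
  with lipschitz_cball[of r] obtain L where "L-lipschitz_on S f"
    using lipschitz_on_subset by blast
  moreover from this have "L \<ge> 0" by (rule lipschitz_on_nonneg)
  ultimately have "(L + 1)-lipschitz_on S f" "L + 1 > 0"
    by (auto intro: lipschitz_on_le)
  then show ?thesis by (rule that[rotated])
qed

lemma V_continuous: "continuous_on S V"
  using V_derivative has_derivative_continuous continuous_at_imp_continuous_on by blast

text \<open>The differential equation is required on [s, t] only, because the lemma is also applied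
  to a solution of a truncated field up to its first exit from a ball. A positive m yields a
  definite loss of \<open>V\<close> over a time window.\<close>

lemma V_decrease:
  assumes "0 \<le> s" "s \<le> t"
    and x: "\<And>r. s \<le> r \<Longrightarrow> r \<le> t \<Longrightarrow> (x has_vector_derivative f (x r)) (at r within {0..})"
    and m: "\<And>r. s \<le> r \<Longrightarrow> r \<le> t \<Longrightarrow> w (x r) \<ge> m"
  shows "V (x t) \<le> V (x s) - m * (t - s)"
proof -
  let ?h = "\<lambda>r. - V (x r) - m * r"
  have "?h s \<le> ?h t"
  proof (rule DERIV_nonneg_imp_increasing_open[OF \<open>s \<le> t\<close>])
    fix r assume r: "s < r" "r < t"
    have "(x has_vector_derivative f (x r)) (at r)"
      using x[of r] r \<open>0 \<le> s\<close> at_within_interior[of r "{0..}"] by auto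
    then have "((\<lambda>r. V (x r)) has_real_derivative V' (x r) (f (x r))) (at r)"
      using vector_derivative_diff_chain_within[of x "f (x r)" r UNIV V "V' (x r)"]
        has_derivative_at_withinI[OF V_derivative]
      by (simp add: has_real_derivative_iff_has_vector_derivative o_def)
    then have "(?h has_real_derivative - V' (x r) (f (x r)) - m) (at r)"
      by (auto intro!: derivative_eq_intros)
    moreover have "- V' (x r) (f (x r)) - m \<ge> 0"
      using V_decay[of "x r"] m[of r] r by simp
    ultimately show "\<exists>y. DERIV ?h r :> y \<and> y \<ge> 0" by blast
  next
    have "continuous_on {s..t} x"
      unfolding continuous_on_eq_continuous_within
    proof
      fix r assume r: "r \<in> {s..t}"
      then have "continuous (at r within {0..}) x"
        using x[of r] has_vector_derivative_continuous by auto
      then show "continuous (at r within {s..t}) x"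
        by (rule continuous_within_subset) (use \<open>0 \<le> s\<close> in auto)
    qed
    then show "continuous_on {s..t} ?h"
      by (intro continuous_intros continuous_on_compose2[OF V_continuous[of UNIV]]) auto
  qed
  then show ?thesis by (simp add: algebra_simps)
qed

lemma V_solution_mono:
  assumes "solves f x0 x" "0 \<le> s" "s \<le> t"
  shows "V (x t) \<le> V (x s)"
  using V_decrease[of s t x 0] solves_derivative[OF assms(1)] w_nonneg assms by auto

text \<open>Precomposing f with the nearest-point projection onto a ball that contains the initial
  sublevel set in its interior makes it bounded and globally Lipschitz. Up to its first exit from
  the open ball the solution obeys the true equation, so \<open>V\<close> has not risen; but the
  exit point lies outside the sublevel set.\<close>

lemma solves_exists: "\<exists>x. solves f x0 x"
proof -
  obtain R where R: "{x. V x \<le> V x0} \<subseteq> ball 0 R" "R > 0"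
    using V_sublevel_bounded[of "V x0"] by (metis bounded_subset_ballD)
  define F where "F = (\<lambda>x. f (closest_point (cball 0 R) x))"
  have ne: "cball (0::'a) R \<noteq> {}" using R(2) by simp
  obtain L where L: "L > 0" "L-lipschitz_on (cball 0 R) f"
    by (rule lipschitz_bounded[of "cball 0 R"]) auto
  have F_lip: "L-lipschitz_on UNIV F"
  proof (rule lipschitz_onI)
    fix x y
    have "dist (F x) (F y) \<le> L * dist (closest_point (cball 0 R) x) (closest_point (cball 0 R) y)"
      unfolding F_def by (rule lipschitz_onD[OF L(2)]) (use closest_point_in_set[OF closed_cball ne] in auto)
    also have "\<dots> \<le> L * dist x y"
      using L(1) closest_point_lipschitz[OF convex_cball closed_cball ne] by (intro mult_left_mono) auto
    finally show "dist (F x) (F y) \<le> L * dist x y" .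
  qed (use L in simp)
  have "bounded (f ` cball 0 R)"
    by (intro compact_imp_bounded compact_continuous_image lipschitz_on_continuous_on[OF L(2)]) auto
  then obtain K where "\<And>x. x \<in> cball 0 R \<Longrightarrow> norm (f x) \<le> K"
    unfolding bounded_iff by blast
  then have "norm (F x) \<le> K" for x
    unfolding F_def using closest_point_in_set[OF closed_cball ne] by blast
  then obtain x where x: "solves F x0 x"
    using solves_exists_bounded_lipschitz[OF F_lip L(1)] by blast
  have Ff: "F y = f y" if "norm y \<le> R" for y
    using closest_point_self[of y "cball 0 R"] that by (simp add: F_def)
  have "norm (x t) < R" if "t \<ge> 0" for t
  proof (rule ccontr)
    assume "\<not> norm (x t) < R"
    \<comment> \<open>A is compact, so it has a least element: the first exit time.\<close>
    define A where "A = {s \<in> {0..t}. norm (x s) \<in> {R..}}"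
    have "continuous_on {0..t} (\<lambda>s. norm (x s))"
      using continuous_on_subset[OF solves_continuous[OF x], of "{0..t}"]
      by (intro continuous_intros) auto
    then have "closed A"
      unfolding A_def using continuous_closed_preimage[of "{0..t}" _ "{R..}"]
      by (simp add: vimage_def Int_def)
    then have "compact A"
      using bounded_subset[of "{0..t}" A] by (simp add: compact_eq_bounded_closed A_def subset_iff)
    moreover have "A \<noteq> {}"
      using \<open>\<not> norm (x t) < R\<close> that by (auto simp: A_def)
    ultimately obtain s where s: "s \<in> A" "\<And>r. r \<in> A \<Longrightarrow> s \<le> r"
      using compact_attains_inf by metis
    have below: "norm (x r) < R" if "0 \<le> r" "r < s" for r
      using s(2)[of r] s(1) that by (force simp: A_def)
    have "x s \<notin> {x. V x \<le> V x0}"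
      using s(1) R by (auto simp: A_def)
    then have "V x0 < V (x s)" by simp
    then have "s > 0"
      using s(1) x by (cases "s = 0") (auto simp: A_def solves_def)
    \<comment> \<open>Only times before s are known to lie inside. The left limit puts x s in the
      closed ball, where the truncated field still agrees with f.\<close>
    have "norm (x s) \<le> R"
    proof (rule tendsto_upperbound)
      have "continuous (at s within {0..}) x"
        using has_vector_derivative_continuous solves_derivative[OF x, of s] \<open>s > 0\<close> by auto
      then have "continuous (at_left s) x"
        using at_within_interior[of s "{0..}"] \<open>s > 0\<close> continuous_at_imp_continuous_at_within by fastforce
      then show "((\<lambda>r. norm (x r)) \<longlongrightarrow> norm (x s)) (at_left s)"
        by (intro tendsto_norm) (simp add: continuous_within)
      show "\<forall>\<^sub>F r in at_left s. norm (x r) \<le> R"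
        using eventually_at_left_real[OF \<open>s > 0\<close>] by eventually_elim (auto intro: less_imp_le below)
    qed simp
    then have "(x has_vector_derivative f (x r)) (at r within {0..})" if "0 \<le> r" "r \<le> s" for r
      using solves_derivative[OF x that(1)] Ff[of "x r"] below[of r] that by (cases "r = s") auto
    then have "V (x s) \<le> V (x 0)"
      using V_decrease[of 0 s x 0] w_nonneg \<open>s > 0\<close> by auto
    then show False
      using \<open>V x0 < V (x s)\<close> x by (simp add: solves_def)
  qed
  then show ?thesis
    using x Ff by (intro exI[of _ x]) (force simp: solves_def)
qed

text \<open>The sublevel set at an upper bound of \<open>V\<close> on S is bounded and forward
  invariant, so one Lipschitz constant serves all starting points in S and all times.\<close>

lemma solutions_lipschitz_bound:
  assumes "bounded S"
  obtains L where "L > 0"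
    "\<And>x y x0 y0 t. solves f x0 x \<Longrightarrow> solves f y0 y \<Longrightarrow> x0 \<in> S \<Longrightarrow> y0 \<in> S \<Longrightarrow> 0 \<le> t \<Longrightarrow>
      norm (x t - y t) \<le> exp (L * t) * norm (x0 - y0) \<and>
      norm (x0 - y0) \<le> exp (L * t) * norm (x t - y t)"
proof -
  have "compact (closure S)" using assms by (simp add: compact_closure)
  then have "bounded (V ` closure S)"
    by (intro compact_imp_bounded compact_continuous_image V_continuous)
  then obtain c where c: "\<And>x. x \<in> S \<Longrightarrow> V x \<le> c"
    unfolding bounded_iff using closure_subset by (auto simp: abs_le_iff)
  from V_sublevel_bounded[of c] obtain L where L: "L > 0" "L-lipschitz_on {x. V x \<le> c} f"
    by (rule lipschitz_bounded)
  have inV: "V (x t) \<le> c" if "solves f x0 x" "x0 \<in> S" "0 \<le> t" for x x0 t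
    using V_solution_mono[OF that(1), of 0 t] that c[of x0] by (auto simp: solves_def)
  show ?thesis
  proof (rule that[OF L(1)], goal_cases)
    case (1 x y x0 y0 t)
    then show ?case
      using solution_distance[OF L(2), of t x0 x y0 y] inV by auto
  qed
qed

lemma solves_unique:
  assumes "solves f x0 x" "solves f x0 y" "t \<ge> 0"
  shows "x t = y t"
  using solutions_lipschitz_bound[of "{x0}"] assms by (metis bounded_insert bounded_empty insertI1 mult_zero_right norm_le_zero_iff norm_zero eq_iff_diff_eq_0)

lemma well_posed: "well_posed f"
  unfolding well_posed_def using solves_exists solves_unique by blast

section \<open>The forward flow: semigroup law and continuity\<close>

lemma flow_eq:
  assumes "solves f x0 x" "t \<ge> 0"
  shows "flow f t x0 = x t"
  unfolding flow_def using assms solves_unique by (intro the_equality) blast+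

lemma solves_flow: "solves f x0 (\<lambda>t. flow f t x0)"
proof -
  obtain x where x: "solves f x0 x" using solves_exists by blast
  have "((\<lambda>t. flow f t x0) has_vector_derivative f (x t)) (at t within {0..})" if "0 \<le> t" for t
    by (rule has_vector_derivative_transform[OF _ _ solves_derivative[OF x that]])
      (use that flow_eq[OF x] in auto)
  then show ?thesis
    using flow_eq[OF x] x by (simp add: solves_def)
qed

lemma flow_0: "flow f 0 x0 = x0"
  using solves_flow by (simp add: solves_def)

lemma flow_add:
  assumes "s \<ge> 0" "t \<ge> 0"
  shows "flow f t (flow f s x0) = flow f (s + t) x0"
proof (rule flow_eq[OF _ \<open>t \<ge> 0\<close>])
  have "((\<lambda>t. flow f (s + t) x0) has_vector_derivative f (flow f (s + t) x0)) (at t within {0..})"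
    if "0 \<le> t" for t
  proof -
    have "((\<lambda>t. flow f t x0) has_vector_derivative f (flow f (s + t) x0)) (at (s + t) within (+) s ` {0..})"
      by (rule has_vector_derivative_within_subset[OF solves_derivative[OF solves_flow]])
        (use assms that in auto)
    then show ?thesis
      using vector_diff_chain_within[of "(+) s" 1 t "{0..}"]
      by (force simp: o_def intro!: derivative_eq_intros)
  qed
  then show "solves f (flow f s x0) (\<lambda>t. flow f (s + t) x0)"
    by (simp add: solves_def)
qed

lemma flow_continuous:
  assumes "t \<ge> 0"
  shows "continuous_on UNIV (flow f t)"
proof (clarsimp simp: continuous_on_eq_continuous_at)
  fix x0
  obtain L where L: "L > 0" "\<And>x y x0' y0 t. solves f x0' x \<Longrightarrow> solves f y0 y \<Longrightarrow> x0' \<in> cball x0 1 \<Longrightarrow>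
      y0 \<in> cball x0 1 \<Longrightarrow> 0 \<le> t \<Longrightarrow>
      norm (x t - y t) \<le> exp (L * t) * norm (x0' - y0) \<and>
      norm (x0' - y0) \<le> exp (L * t) * norm (x t - y t)"
    using solutions_lipschitz_bound[OF bounded_cball[of x0 1]] by metis
  have "(exp (L * t))-lipschitz_on (ball x0 1) (flow f t)"
    using L(2)[OF solves_flow solves_flow _ _ assms] by (intro lipschitz_onI) (auto simp: dist_norm)
  then have "continuous_on (ball x0 1) (flow f t)"
    by (rule lipschitz_on_continuous_on)
  then show "isCont (flow f t) x0"
    by (simp add: continuous_on_eq_continuous_at)
qed

end

text \<open>The translates of S by u/(n+1) are pairwise disjoint, have the measure of S and lie in
  one ball, so every multiple of the measure of S is bounded by the measure of that ball.\<close>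

lemma negligible_if_translates_disjoint:
  fixes S :: "'a::euclidean_space set"
  assumes "compact S" and u: "\<And>x a. x \<in> S \<Longrightarrow> x + a *\<^sub>R u \<in> S \<Longrightarrow> a = 0"
  shows "negligible S"
proof -
  have S: "S \<in> lmeasurable" using \<open>compact S\<close> by (rule lmeasurable_compact)
  define T where "T = (\<lambda>n::nat. (+) (inverse (real (Suc n)) *\<^sub>R u) ` S)"
  have T: "T n \<in> lmeasurable" "measure lebesgue (T n) = measure lebesgue S" for n
    unfolding T_def using measurable_translation[OF S] measure_translation by auto
  have disj: "disjoint_family_on T A" for A
    unfolding disjoint_family_on_def T_def
  proof (intro ballI impI)
    fix m n :: nat
    assume "m \<noteq> n"
    show "(+) (inverse (real (Suc m)) *\<^sub>R u) ` S \<inter> (+) (inverse (real (Suc n)) *\<^sub>R u) ` S = {}"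
    proof (rule ccontr)
      assume "\<not> ?thesis"
      then obtain x y where xy: "x \<in> S" "y \<in> S"
        "inverse (real (Suc m)) *\<^sub>R u + x = inverse (real (Suc n)) *\<^sub>R u + y" by blast
      then have "y = x + (inverse (real (Suc m)) - inverse (real (Suc n))) *\<^sub>R u"
        by (simp add: algebra_simps)
      with u[of x] xy have "inverse (real (Suc m)) = inverse (real (Suc n))" by fastforce
      with \<open>m \<noteq> n\<close> show False by simp
    qed
  qed
  obtain r where r: "\<And>x. x \<in> S \<Longrightarrow> norm x \<le> r"
    using \<open>compact S\<close> compact_imp_bounded bounded_iff by metis
  have "T n \<subseteq> cball 0 (norm u + r)" for n
  proof (clarsimp simp: T_def)
    fix x assume "x \<in> S"
    have "norm (inverse (1 + real n) *\<^sub>R u) \<le> 1 * norm u"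
      unfolding norm_scaleR by (intro mult_right_mono) (auto simp: inverse_le_1_iff)
    with r[OF \<open>x \<in> S\<close>] norm_triangle_ineq[of "inverse (1 + real n) *\<^sub>R u" x]
    show "norm (inverse (1 + real n) *\<^sub>R u + x) \<le> norm u + r" by linarith
  qed
  then have sub: "(\<Union>i<n. T i) \<subseteq> cball 0 (norm u + r)" for n by blast
  have "real n * measure lebesgue S \<le> measure lebesgue (cball (0::'a) (norm u + r))" for n
  proof -
    have "real n * measure lebesgue S = (\<Sum>i<n. measure lebesgue (T i))" by (simp add: T)
    also have "\<dots> = measure lebesgue (\<Union>i<n. T i)"
      using fmeasurableD[OF T(1)] fmeasurableD2[OF T(1)] disj
      by (intro measure_finite_Union[symmetric]) (simp_all add: image_subset_iff)
    also have "\<dots> \<le> measure lebesgue (cball (0::'a) (norm u + r))"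
      using T(1) by (intro measure_mono_fmeasurable sub lmeasurable_cball) (auto simp: fmeasurable_def)
    finally show ?thesis .
  qed
  then have "measure lebesgue S \<le> 0"
    by (meson not_less reals_Archimedean3)
  then show ?thesis
    using S by (simp add: negligible_iff_measure measure_le_0_iff)
qed

context lyapunov_system
begin

text \<open>Barbalat's argument. \<open>V\<close> decreases along the orbit and is bounded below; if
  \<open>w\<close> is at least e at some time, uniform continuity keeps it above e/2 for a fixed
  time \<tau>, at a cost in \<open>V\<close> that is no longer available once \<open>V\<close> is
  near its infimum.\<close>

lemma decay_rate_tendsto_0:
  assumes V_nonneg: "\<And>x. V x \<ge> 0"
  shows "((\<lambda>t. w (flow f t x0)) \<longlongrightarrow> 0) at_top"
proof (rule tendstoI)
  fix e :: real assume "e > 0"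
  define x where "x = (\<lambda>t. flow f t x0)"
  have x: "solves f x0 x" unfolding x_def by (rule solves_flow)
  define K where "K = {x. V x \<le> V x0}"
  have xK: "x t \<in> K" if "t \<ge> 0" for t
    using V_solution_mono[OF x, of 0 t] that x by (simp add: K_def solves_def)
  have "closed K"
    unfolding K_def by (intro closed_Collect_le V_continuous continuous_intros)
  then have "compact K"
    using V_sublevel_bounded[of "V x0"] by (simp add: compact_eq_bounded_closed K_def)
  obtain L where "L > 0" "L-lipschitz_on K f"
    using lipschitz_bounded[of K] V_sublevel_bounded[of "V x0"] by (auto simp: K_def)
  then have "bounded (f ` K)"
    by (intro compact_imp_bounded compact_continuous_image \<open>compact K\<close> lipschitz_on_continuous_on)
  then obtain M0 where M0: "\<And>y. y \<in> K \<Longrightarrow> norm (f y) \<le> M0"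
    unfolding bounded_iff by blast
  define M where "M = max M0 1"
  have M: "norm (f y) \<le> M" if "y \<in> K" for y using M0[OF that] by (simp add: M_def)
  have "M > 0" by (simp add: M_def)
  have x_lip: "norm (x r - x t) \<le> M * norm (r - t)" if "0 \<le> r" "0 \<le> t" for r t
  proof (rule differentiable_bound[of "{0..}" x "\<lambda>s h. h *\<^sub>R f (x s)"])
    show "(x has_derivative (\<lambda>h. h *\<^sub>R f (x s))) (at s within {0..})" if "s \<in> {0..}" for s
      using solves_derivative[OF x, of s] that by (simp add: has_vector_derivative_def)
    show "onorm (\<lambda>h. h *\<^sub>R f (x s)) \<le> M" if "s \<in> {0..}" for s
      using M[OF xK] that \<open>M > 0\<close>
      by (intro onorm_le) (auto simp: mult.commute[of M] intro!: mult_left_mono)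
  qed (use that in auto)
  have "uniformly_continuous_on K w"
    using compact_uniformly_continuous \<open>compact K\<close> w_continuous continuous_on_subset by blast
  then obtain d where "d > 0"
    and d: "\<And>y z. y \<in> K \<Longrightarrow> z \<in> K \<Longrightarrow> dist z y < d \<Longrightarrow> dist (w z) (w y) < e / 2"
    unfolding uniformly_continuous_on_def using \<open>e > 0\<close> by (metis half_gt_zero)
  \<comment> \<open>At speed at most M the orbit moves at most d/2 in this time, too little for
    \<open>w\<close> to drop by e/2.\<close>
  define \<tau> where "\<tau> = d / (2 * M)"
  have "\<tau> > 0" using \<open>d > 0\<close> \<open>M > 0\<close> by (simp add: \<tau>_def)
  define l where "l = Inf ((\<lambda>t. V (x t)) ` {0..})"
  have bdd: "bdd_below ((\<lambda>t. V (x t)) ` {0..})"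
    using V_nonneg by (auto intro!: bdd_belowI[of _ 0])
  have "e / 2 * \<tau> > 0" using \<open>e > 0\<close> \<open>\<tau> > 0\<close> by simp
  then have "Inf ((\<lambda>t. V (x t)) ` {0..}) < l + e / 2 * \<tau>" by (simp add: l_def)
  then obtain t0 where t0: "t0 \<ge> 0" "V (x t0) < l + e / 2 * \<tau>"
    using cInf_lessD[of "(\<lambda>t. V (x t)) ` {0..}"] by auto
  have "w (x t) < e" if "t \<ge> t0" for t
  proof (rule ccontr)
    assume "\<not> w (x t) < e"
    have "w (x r) \<ge> e / 2" if r: "t \<le> r" "r \<le> t + \<tau>" for r
    proof -
      have "dist (x r) (x t) \<le> M * (r - t)"
        using x_lip[of r t] r t0 \<open>t \<ge> t0\<close> by (simp add: dist_norm)
      also have "\<dots> \<le> M * \<tau>" using r \<open>M > 0\<close> by (intro mult_left_mono) auto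
      also have "\<dots> < d" using \<open>M > 0\<close> \<open>d > 0\<close> by (simp add: \<tau>_def)
      finally have "dist (w (x r)) (w (x t)) < e / 2"
        using d xK r t0 \<open>t \<ge> t0\<close> by auto
      with \<open>\<not> w (x t) < e\<close> show ?thesis by (simp add: dist_real_def abs_if split: if_splits)
    qed
    then have "V (x (t + \<tau>)) \<le> V (x t) - e / 2 * (t + \<tau> - t)"
      using t0 \<open>t \<ge> t0\<close> \<open>\<tau> > 0\<close>
      by (intro V_decrease solves_derivative[OF x]) auto
    also have "V (x t) \<le> V (x t0)"
      using V_solution_mono[OF x t0(1) \<open>t \<ge> t0\<close>] .
    also have "l \<le> V (x (t + \<tau>))"
      unfolding l_def using bdd t0 \<open>t \<ge> t0\<close> \<open>\<tau> > 0\<close> by (intro cInf_lower) auto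
    finally show False using t0(2) by (simp add: algebra_simps)
  qed
  then show "\<forall>\<^sub>F t in at_top. dist (w (flow f t x0)) 0 < e"
    unfolding eventually_at_top_linorder using w_nonneg by (auto simp: x_def)
qed

text \<open>On a ball the flow map is injective and its inverse is Lipschitz with constant exp(Lt),
  and Lipschitz images of null sets are null. Countably many balls cover the space.\<close>

lemma flow_preimage_negligible:
  assumes "negligible W" "t \<ge> 0"
  shows "negligible {x. flow f t x \<in> W}"
proof -
  have "negligible {x \<in> cball 0 (real k). flow f t x \<in> W}" (is "negligible ?S") for k :: nat
  proof -
    obtain L where L: "L > 0" "\<And>x y x0' y0 t. solves f x0' x \<Longrightarrow> solves f y0 y \<Longrightarrow>
        x0' \<in> cball 0 (real k) \<Longrightarrow> y0 \<in> cball 0 (real k) \<Longrightarrow> 0 \<le> t \<Longrightarrow>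
        norm (x t - y t) \<le> exp (L * t) * norm (x0' - y0) \<and>
        norm (x0' - y0) \<le> exp (L * t) * norm (x t - y t)"
      using solutions_lipschitz_bound[OF bounded_cball] by metis
    have expand: "norm (x - y) \<le> exp (L * t) * norm (flow f t x - flow f t y)"
      if "x \<in> ?S" "y \<in> ?S" for x y
      using L(2)[OF solves_flow solves_flow _ _ \<open>t \<ge> 0\<close>, of x y] that by auto
    have inj: "inj_on (flow f t) ?S"
      by (rule inj_onI) (use expand in force)
    let ?g = "inv_into ?S (flow f t)"
    have "negligible (?g ` (flow f t ` ?S))"
    proof (rule negligible_locally_Lipschitz_image)
      show "negligible (flow f t ` ?S)"
        by (rule negligible_subset[OF \<open>negligible W\<close>]) auto
      fix y assume y: "y \<in> flow f t ` ?S"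
      have "norm (?g z - ?g y) \<le> exp (L * t) * norm (z - y)" if "z \<in> flow f t ` ?S" for z
        using expand[OF inv_into_into[OF that] inv_into_into[OF y]] f_inv_into_f[OF that]
          f_inv_into_f[OF y] by simp
      then show "\<exists>T B. open T \<and> y \<in> T \<and>
          (\<forall>z \<in> flow f t ` ?S \<inter> T. norm (?g z - ?g y) \<le> B * norm (z - y))"
        by (intro exI[of _ UNIV] exI[of _ "exp (L * t)"]) auto
    qed simp
    then show ?thesis
      using inj by (simp add: image_inv_into_cancel inv_into_image_cancel)
  qed
  then have "negligible (\<Union>k::nat. {x \<in> cball 0 (real k). flow f t x \<in> W})"
    by (rule negligible_Union_nat)
  then show ?thesis
    by (rule negligible_subset) (auto intro: real_arch_simple)
qed

end

text \<open>One vector u with \<open>Q u u > 0\<close> is asked for, since translates in a single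
  direction already show that a set is null. Expansion is stated for differences of points because
  two orbits are compared.\<close>

locale almost_global_lyapunov_system = lyapunov_system f V V' w
  for f :: "'a::euclidean_space \<Rightarrow> 'a" and V V' w +
  fixes Q :: "'a \<Rightarrow> 'a \<Rightarrow> real" and u :: 'a and \<gamma> r :: real
  assumes V_nonneg: "\<And>x. V x \<ge> 0"
    and V_zero: "\<exists>x. V x = 0"
    and V_origin: "V 0 > 0"
    and w_zero: "\<And>x. w x = 0 \<Longrightarrow> V x = 0 \<or> x = 0"
    and Q_bilinear: "bounded_bilinear Q" and Q_sym: "\<And>x y. Q x y = Q y x"
    and Q_pos: "Q u u > 0"
    and rate_pos: "\<gamma> > 0" and r_pos: "r > 0"
    and Q_expansion: "\<And>x y. x \<in> cball 0 r \<Longrightarrow> y \<in> cball 0 r \<Longrightarrow>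
      Q (x - y) (f x - f y) \<ge> \<gamma> * Q (x - y) (x - y)"
begin

definition target where "target = {x. V x = 0}"

definition trapped where "trapped = {x. \<forall>t\<ge>0. flow f t x \<in> cball 0 r}"

lemma compact_target: "compact target"
proof -
  have "closed target"
    unfolding target_def by (intro closed_Collect_eq V_continuous continuous_intros)
  moreover have "bounded target"
    by (rule bounded_subset[OF V_sublevel_bounded[of 0]]) (auto simp: target_def)
  ultimately show ?thesis by (simp add: compact_eq_bounded_closed)
qed

lemma target_nonempty: "target \<noteq> {}"
  using V_zero by (auto simp: target_def)

lemma infdist_target_eq_0: "infdist x target = 0 \<longleftrightarrow> V x = 0"
  using in_closed_iff_infdist_zero[OF compact_imp_closed[OF compact_target] target_nonempty, of x]
  by (simp add: target_def)

text \<open>Two trapped points never differ by a multiple of \<open>u\<close>, since \<open>Q\<close> would grow exponentially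
  along the difference of their trajectories.\<close>

lemma negligible_trapped: "negligible trapped"
proof (rule negligible_if_translates_disjoint)
  have "trapped = (\<Inter>t\<in>{0..}. flow f t -` cball 0 r)"
    by (auto simp: trapped_def)
  also have "closed \<dots>"
    by (intro closed_INT ballI closed_vimage flow_continuous) auto
  finally have "closed trapped" .
  moreover have "trapped \<subseteq> cball 0 r"
    using flow_0 by (force simp: trapped_def)
  ultimately show "compact trapped"
    by (metis bounded_cball bounded_subset compact_eq_bounded_closed)
  fix x a
  assume xa: "x \<in> trapped" "x + a *\<^sub>R u \<in> trapped"
  show "a = 0"
  proof (rule ccontr)
    assume "a \<noteq> 0"
    obtain C where C: "C > 0" "\<And>x y. \<bar>Q x y\<bar> \<le> norm x * norm y * C"
      using bounded_bilinear.pos_bounded[OF Q_bilinear] by auto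
    define q where "q = a\<^sup>2 * Q u u"
    have "q > 0" using Q_pos \<open>a \<noteq> 0\<close> by (simp add: q_def)
    have qa: "Q (x + a *\<^sub>R u - x) (x + a *\<^sub>R u - x) = q"
      by (simp add: q_def power2_eq_square bounded_bilinear.scaleR_left[OF Q_bilinear]
          bounded_bilinear.scaleR_right[OF Q_bilinear])
    have "exp (2 * \<gamma> * t) * q \<le> 2 * r * (2 * r) * C" if "t \<ge> 0" for t
    proof -
      let ?d = "flow f t (x + a *\<^sub>R u) - flow f t x"
      have "exp (2 * \<gamma> * t) * q \<le> Q ?d ?d"
        using bilinear_growth[OF Q_bilinear Q_sym that solves_flow solves_flow, of \<gamma> "x + a *\<^sub>R u" x]
          Q_expansion xa unfolding qa by (auto simp: trapped_def)
      also have "\<dots> \<le> norm ?d * norm ?d * C"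
        using C(2)[of ?d ?d] by linarith
      also have "norm ?d \<le> 2 * r"
        using xa that norm_triangle_ineq4[of "flow f t (x + a *\<^sub>R u)" "flow f t x"]
        by (force simp: trapped_def)
      then have "norm ?d * norm ?d * C \<le> 2 * r * (2 * r) * C"
        using C(1) r_pos by (intro mult_right_mono mult_mono) auto
      finally show ?thesis .
    qed
    moreover have "1 + 2 * \<gamma> * t \<le> exp (2 * \<gamma> * t)" for t by (rule exp_ge_add_one_self)
    ultimately have "(1 + 2 * \<gamma> * t) * q \<le> 2 * r * (2 * r) * C" if "t \<ge> 0" for t
      using that mult_right_mono[of "1 + 2 * \<gamma> * t" "exp (2 * \<gamma> * t)" q] \<open>q > 0\<close>
      by (meson less_imp_le order_trans)
    \<comment> \<open>At this time the linear lower bound for the exponential exceeds the bound on Q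
      by exactly q.\<close>
    from this[of "2 * r * (2 * r) * C / (2 * \<gamma> * q)"]
    have "(1 + 2 * \<gamma> * (2 * r * (2 * r) * C / (2 * \<gamma> * q))) * q \<le> 2 * r * (2 * r) * C"
      using rate_pos \<open>q > 0\<close> r_pos C(1) by simp
    moreover have "(1 + 2 * \<gamma> * (2 * r * (2 * r) * C / (2 * \<gamma> * q))) * q = q + 2 * r * (2 * r) * C"
      using rate_pos \<open>q > 0\<close> by (simp add: field_simps)
    ultimately show False using \<open>q > 0\<close> by linarith
  qed
qed

text \<open>On the compact part of the sublevel set that is away from both sets \<open>w\<close> has
  a positive minimum, whereas \<open>w\<close> tends to 0 along the orbit.\<close>

lemma eventually_near_target_or_origin:
  assumes "e > 0"
  shows "\<forall>\<^sub>F t in at_top. infdist (flow f t x0) target < e \<or> norm (flow f t x0) < e"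
proof -
  define K where "K = {x. V x \<le> V x0} \<inter> {x. infdist x target \<ge> e} \<inter> {x. norm x \<ge> e}"
  have "closed K"
    unfolding K_def by (intro closed_Int closed_Collect_le V_continuous continuous_intros)
  moreover have "bounded K"
    by (rule bounded_subset[OF V_sublevel_bounded[of "V x0"]]) (auto simp: K_def)
  ultimately have "compact K" by (simp add: compact_eq_bounded_closed)
  have inK: "flow f t x0 \<in> K" if "t \<ge> 0" "\<not> (infdist (flow f t x0) target < e \<or> norm (flow f t x0) < e)" for t
    using that V_solution_mono[OF solves_flow, of 0 t x0] by (auto simp: K_def flow_0)
  obtain m where m: "m > 0" "\<And>x. x \<in> K \<Longrightarrow> m \<le> w x"
  proof (cases "K = {}")
    case False
    obtain y where y: "y \<in> K" "\<And>x. x \<in> K \<Longrightarrow> w y \<le> w x"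
      using continuous_attains_inf[OF \<open>compact K\<close> False continuous_on_subset[OF w_continuous subset_UNIV]]
      by blast
    have "w y \<noteq> 0"
      using w_zero[of y] y(1) \<open>e > 0\<close> infdist_target_eq_0[of y] by (auto simp: K_def)
    with w_nonneg[of y] y that[of "w y"] show thesis by auto
  qed (use that[of 1] in auto)
  have "\<forall>\<^sub>F t in at_top. w (flow f t x0) < m"
    using decay_rate_tendsto_0[OF V_nonneg] m(1) by (rule order_tendstoD(2))
  then show ?thesis
    using eventually_ge_at_top[of 0]
  proof eventually_elim
    case (elim t)
    then show ?case using inK[of t] m(2)[of "flow f t x0"] by linarith
  qed
qed

text \<open>From some time on the orbit is near the target or near the origin. These two regions are
  separated, and by connectedness of time the orbit cannot change from one to the other. Staying
  near the origin would make it trapped from then on.\<close>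

lemma converges_or_trapped:
  assumes "\<And>n::nat. flow f (real n) x0 \<notin> trapped"
  shows "((\<lambda>t. infdist (flow f t x0) target) \<longlongrightarrow> 0) at_top"
proof -
  define x where "x = (\<lambda>t. flow f t x0)"
  define d0 where "d0 = infdist 0 target"
  have "d0 > 0"
    using infdist_target_eq_0[of 0] V_origin infdist_nonneg[of 0 target] by (simp add: d0_def less_le)
  \<comment> \<open>Half of \<open>d0\<close> makes the two neighbourhoods exclusive; r places the
    one of the origin inside the ball that defines \<open>trapped\<close>.\<close>
  define e0 where "e0 = min (d0 / 2) r"
  have "e0 > 0" using \<open>d0 > 0\<close> r_pos by (simp add: e0_def)
  obtain t1 where t1: "t1 \<ge> 0" "\<And>t. t \<ge> t1 \<Longrightarrow> infdist (x t) target < e0 \<or> norm (x t) < e0"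
    using eventually_conj[OF eventually_near_target_or_origin[OF \<open>e0 > 0\<close>, of x0] eventually_ge_at_top[of 0]]
    unfolding eventually_at_top_linorder x_def by (metis (no_types, lifting) order_refl)
  have far: "infdist (x t) target > d0 / 2" if "norm (x t) < d0 / 2" for t
    using infdist_triangle[of 0 target "x t"] that by (simp add: d0_def)
  have neq: "infdist (x t) target \<noteq> d0 / 2" if "t \<ge> t1" for t
    using t1(2)[OF that] far[of t] by (auto simp: e0_def)
  have "infdist (x t) target < d0 / 2" if "t \<ge> t1" for t
  proof (rule ccontr)
    assume "\<not> infdist (x t) target < d0 / 2"
    have "continuous_on {t1..} (\<lambda>t. infdist (x t) target)"
      using continuous_on_subset[OF solves_continuous[OF solves_flow]] t1(1)
      unfolding x_def by (intro continuous_on_infdist) auto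
    then have conn: "connected ((\<lambda>t. infdist (x t) target) ` {t1..})"
      by (rule connected_continuous_image) (rule connected_Ici)
    have "\<not> infdist (x s) target < d0 / 2" if "s \<ge> t1" for s
    proof
      assume "infdist (x s) target < d0 / 2"
      moreover have "infdist (x s) target \<in> (\<lambda>t. infdist (x t) target) ` {t1..}"
        "infdist (x t) target \<in> (\<lambda>t. infdist (x t) target) ` {t1..}"
        using \<open>t \<ge> t1\<close> \<open>s \<ge> t1\<close> by blast+
      ultimately have "d0 / 2 \<in> (\<lambda>t. infdist (x t) target) ` {t1..}"
        using \<open>\<not> infdist (x t) target < d0 / 2\<close> connectedD_interval[OF conn]
        by (meson less_imp_le not_less)
      then obtain r where "r \<ge> t1" "infdist (x r) target = d0 / 2" by auto
      with neq show False by blast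
    qed
    then have near0: "norm (x s) < r" if "s \<ge> t1" for s
      using t1(2)[OF that] that by (auto simp: e0_def)
    \<comment> \<open>Integer times suffice here and keep the exceptional set a countable union of
      preimages.\<close>
    obtain n :: nat where "real n \<ge> t1" using real_arch_simple by blast
    then have "flow f (real n) x0 \<in> trapped"
      using near0 unfolding trapped_def x_def by (auto simp: flow_add less_imp_le)
    with assms show False by blast
  qed
  then have close: "norm (x t) \<ge> d0 / 2" if "t \<ge> t1" for t
    using far[of t] that by (meson not_less order_less_asym)
  show ?thesis
  proof (rule tendstoI)
    fix e :: real assume "e > 0"
    then have "min e (d0 / 2) > 0" using \<open>d0 > 0\<close> by simp
    from eventually_near_target_or_origin[OF this, of x0]
    show "\<forall>\<^sub>F t in at_top. dist (infdist (flow f t x0) target) 0 < e"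
      using eventually_ge_at_top[of t1]
      by eventually_elim (use close in \<open>force simp: x_def infdist_nonneg\<close>)
  qed
qed

theorem almost_globally_asymptotically_stable_target:
  "almost_globally_asymptotically_stable f target"
proof -
  define Z where "Z = (\<Union>n::nat. {x. flow f (real n) x \<in> trapped})"
  have "negligible Z"
    unfolding Z_def by (intro negligible_Union_nat flow_preimage_negligible negligible_trapped) simp
  moreover have "\<forall>x0. x0 \<notin> Z \<longrightarrow> ((\<lambda>t. infdist (flow f t x0) target) \<longlongrightarrow> 0) at_top"
    using converges_or_trapped by (auto simp: Z_def)
  moreover have "\<exists>\<delta>>0. \<forall>x0. infdist x0 target < \<delta> \<longrightarrow> (\<forall>t\<ge>0. infdist (flow f t x0) target < \<epsilon>)"
    if "\<epsilon> > 0" for \<epsilon>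
  proof -
    \<comment> \<open>Cutting at level 1 makes K compact; only starting points with \<open>V\<close>
      below \<open>min m 1\<close> are considered later, and their orbits stay below that
      level.\<close>
    define K where "K = {x. V x \<le> 1} \<inter> {x. infdist x target \<ge> \<epsilon>}"
    have "closed K"
      unfolding K_def by (intro closed_Int closed_Collect_le V_continuous continuous_intros)
    moreover have "bounded K"
      by (rule bounded_subset[OF V_sublevel_bounded[of 1]]) (auto simp: K_def)
    ultimately have "compact K" by (simp add: compact_eq_bounded_closed)
    obtain m where m: "m > 0" "\<And>x. x \<in> K \<Longrightarrow> m \<le> V x"
    proof (cases "K = {}")
      case False
      obtain y where y: "y \<in> K" "\<And>x. x \<in> K \<Longrightarrow> V y \<le> V x"
        using continuous_attains_inf[OF \<open>compact K\<close> False V_continuous] by blast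
      have "V y \<noteq> 0"
        using infdist_target_eq_0[of y] y(1) \<open>\<epsilon> > 0\<close> by (auto simp: K_def)
      with V_nonneg[of y] y that[of "V y"] show thesis by auto
    qed (use that[of 1] in auto)
    have "closed {x. min m 1 \<le> V x}"
      by (intro closed_Collect_le V_continuous continuous_intros)
    moreover have "target \<inter> {x. min m 1 \<le> V x} = {}"
      using m(1) by (auto simp: target_def)
    \<comment> \<open>The compact target has a positive distance from the closed set where
      \<open>V\<close> is at least \<open>min m 1\<close>; this distance is the required
      \<delta>.\<close>
    ultimately obtain \<delta> where \<delta>: "\<delta> > 0" "\<And>x y. x \<in> target \<Longrightarrow> min m 1 \<le> V y \<Longrightarrow> \<delta> \<le> dist x y"
      using separate_compact_closed[OF compact_target, of "{x. min m 1 \<le> V x}"] by auto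
    have "infdist (flow f t x0) target < \<epsilon>" if "infdist x0 target < \<delta>" "t \<ge> 0" for x0 t
    proof -
      obtain y where y: "y \<in> target" "infdist x0 target = dist x0 y"
        using infdist_attains_inf[OF compact_imp_closed[OF compact_target] target_nonempty] by blast
      then have "V x0 < min m 1"
        using \<delta>(2)[of y x0] that by (metis dist_commute not_le)
      moreover have "V (flow f t x0) \<le> V x0"
        using V_solution_mono[OF solves_flow, of 0 t x0] that flow_0 by simp
      ultimately have "V (flow f t x0) < m" "V (flow f t x0) \<le> 1" by auto
      with m(2)[of "flow f t x0"] show ?thesis by (force simp: K_def)
    qed
    with \<delta>(1) show ?thesis by blast
  qed
  ultimately show ?thesis
    unfolding almost_globally_asymptotically_stable_def
    using well_posed compact_target target_nonempty by (auto simp: negligible_iff_null_sets)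
qed

end

section \<open>An instability criterion for matrices\<close>

text \<open>The vector p(A) w by Horner's scheme, so that only vectors occur and no powers of the
  matrix.\<close>

definition poly_action :: "complex^'s^'s \<Rightarrow> complex poly \<Rightarrow> complex^'s \<Rightarrow> complex^'s" where
  "poly_action A p w = fold_coeffs (\<lambda>a v. a *s w + A *v v) p 0"

lemma poly_action_0 [simp]: "poly_action A 0 w = 0"
  by (simp add: poly_action_def)

lemma poly_action_pCons [simp]:
  "poly_action A (pCons a p) w = a *s w + A *v poly_action A p w"
  by (cases "p = 0 \<and> a = 0") (auto simp: poly_action_def)

lemma poly_action_add: "poly_action A (p + q) w = poly_action A p w + poly_action A q w"
  by (induction p q rule: poly_induct2)
    (simp_all add: matrix_vector_right_distrib vector_sadd_rdistrib ac_simps)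

lemma poly_action_smult: "poly_action A (smult c p) w = c *s poly_action A p w"
  by (induction p) (simp_all add: vector_smult_assoc vec.scale_right_distrib vec.scale
      matrix_vector_mult_scaleR vector_scalar_commute)

lemma poly_action_matrix: "poly_action A p (A *v w) = A *v poly_action A p w"
  by (induction p) (simp_all add: matrix_vector_right_distrib vector_scalar_commute)

lemma poly_action_diff_right:
  "poly_action A p (v - w) = poly_action A p v - poly_action A p w"
  by (induction p)
    (simp_all add: matrix_vector_mult_diff_distrib vec.scale_right_diff_distrib flip: diff_eq_eq)

lemma poly_action_scale_right: "poly_action A p (c *s w) = c *s poly_action A p w"
  by (induction p) (simp_all add: vec.scale_right_distrib vector_scalar_commute vector_smult_assoc ac_simps)

lemma poly_action_linear_factor:
  "poly_action A ([:- z, 1:] * p) w = poly_action A p (A *v w - z *s w)"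
proof -
  have "[:- z, 1:] * p = smult (- z) p + pCons 0 p" by simp
  then show ?thesis
    by (simp only: poly_action_add poly_action_smult poly_action_pCons poly_action_matrix
        poly_action_diff_right poly_action_scale_right) simp
qed

text \<open>The vectors w, A w, A^2 w, ... up to exponent \<open>CARD('s)\<close> outnumber the
  dimension; the coefficients of a linear relation between them form p.\<close>

lemma exists_annihilating_poly:
  fixes A :: "complex^'s^'s"
  obtains p where "p \<noteq> 0" "poly_action A p w = 0"
proof -
  define g where "g = (\<lambda>k. ((*v) A ^^ k) w)"
  have g_Suc: "g (Suc k) = A *v g k" for k by (simp add: g_def)
  have act: "poly_action A p w = (\<Sum>i\<le>n. coeff p i *s g i)" if "degree p \<le> n" for p n
    using that
  proof (induction p arbitrary: n)
    case (pCons a p)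
    show ?case
    proof (cases "p = 0")
      case True
      have "(\<Sum>i\<le>n. coeff [:a:] i *s g i) = (\<Sum>i\<le>n. if i = 0 then a *s g 0 else 0)"
        by (rule sum.cong) (auto simp: coeff_pCons split: nat.split)
      with True show ?thesis by (simp add: g_def)
    next
      case False
      with pCons obtain m where m: "n = Suc m" "degree p \<le> m" by (cases n) auto
      have "(\<Sum>i\<le>n. coeff (pCons a p) i *s g i) = a *s g 0 + (\<Sum>i\<le>m. coeff p i *s g (Suc i))"
        unfolding m by (subst sum.atMost_Suc_shift) simp
      also have "\<dots> = a *s w + A *v (\<Sum>i\<le>m. coeff p i *s g i)"
        by (simp add: g_Suc vec.sum vector_scalar_commute g_def)
      finally show ?thesis using pCons.IH[OF m(2)] by simp
    qed
  qed simp
  show ?thesis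
  proof (cases "inj_on g {..CARD('s)}")
    case True
    then have "card (g ` {..CARD('s)}) = Suc CARD('s)" by (simp add: card_image)
    then have "vec.dependent (g ` {..CARD('s)})"
      using vec.independent_card_le_dim[of "g ` {..CARD('s)}" UNIV] vec.dim_UNIV[where 'a=complex and 'b='s]
      by (auto simp: card_cart_basis)
    then obtain c v where c: "v \<in> g ` {..CARD('s)}" "c v \<noteq> 0"
      "(\<Sum>v\<in>g ` {..CARD('s)}. c v *s v) = 0"
      by (auto simp: vec.dependent_finite)
    define p where "p = Poly (map (\<lambda>i. c (g i)) [0..<Suc CARD('s)])"
    have coeff: "coeff p i = (if i \<le> CARD('s) then c (g i) else 0)" for i
      by (auto simp: p_def nth_default_def simp del: upt_Suc)
    then have "degree p \<le> CARD('s)" by (intro degree_le) auto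
    then have "poly_action A p w = (\<Sum>i\<le>CARD('s). c (g i) *s g i)"
      by (subst act) (auto simp: coeff)
    also have "\<dots> = 0" using c(3) by (simp add: sum.reindex[OF True])
    finally have "poly_action A p w = 0" .
    moreover from c(1,2) coeff have "p \<noteq> 0" by (metis (no_types, lifting) atMost_iff coeff_0 image_iff)
    ultimately show ?thesis by (rule that[rotated])
  next
    case False
    \<comment> \<open>Dependence of a set says nothing about repeated members of the sequence. A
      repetition is itself a relation, given by the difference of two monomials.\<close>
    then obtain i j where ij: "i \<noteq> j" "g i = g j" by (auto simp: inj_on_def)
    let ?p = "monom 1 i - monom (1::complex) j"
    have "coeff ?p i = 1" using ij by simp
    then have "?p \<noteq> 0" by (metis coeff_0 zero_neq_one)
    have "poly_action A ?p w = (\<Sum>k\<le>max i j. coeff ?p k *s g k)"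
      by (rule act) (auto intro: degree_diff_le simp: degree_monom_eq)
    also have "\<dots> = (\<Sum>k\<le>max i j. (if k = i then g i else 0)) - (\<Sum>k\<le>max i j. (if k = j then g j else 0))"
      unfolding sum_subtractf[symmetric] by (rule sum.cong) auto
    also have "\<dots> = 0" using ij by simp
    finally have "poly_action A ?p w = 0" .
    with \<open>?p \<noteq> 0\<close> show ?thesis by (rule that)
  qed
qed

lemma scaleR_complex_vec: "r *\<^sub>R (x :: complex^'s) = complex_of_real r *s x"
  unfolding vec_eq_iff by (simp add: scaleR_conv_of_real[where 'a = complex])

lemma norm_vec_scale: "norm (c *s x) = norm c * norm (x :: complex^'s)"
  by (simp add: norm_vec_def norm_mult L2_set_right_distrib)

text \<open>The Euler step \<open>w \<mapsto> w + h A w\<close> commutes with \<open>A - z\<close>, so boundedness of its orbits can be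
  lifted through one linear factor of an annihilating polynomial at a time.\<close>

lemma euler_orbit_bounded:
  fixes A :: "complex^'s^'s" and h :: complex
  defines "B \<equiv> \<lambda>w. w + h *s (A *v w)"
  assumes "p \<noteq> 0" "poly_action A p w = 0"
    and contr: "\<And>z. poly p z = 0 \<Longrightarrow> eigenvalue A z \<Longrightarrow> norm (1 + h * z) < 1"
  shows "\<exists>C. \<forall>k. norm ((B ^^ k) w) \<le> C"
  using assms(2-)
proof (induction "degree p" arbitrary: p w)
  case 0
  then obtain a where "p = [:a:]" by (metis degree_eq_zeroE)
  with 0 have "w = 0" by simp
  then have "(B ^^ k) w = 0" for k by (induction k) (simp_all add: B_def)
  then show ?case by auto
next
  case (Suc n)
  have B_add: "B (v + v') = B v + B v'" and B_scale: "B (c *s v) = c *s B v"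
    and B_A: "B (A *v v) = A *v B v" for v v' c
    by (simp_all add: B_def matrix_vector_right_distrib vec.scale_right_distrib vector_scalar_commute
        vector_smult_assoc ac_simps)
  have Bk_add: "(B ^^ k) (v + v') = (B ^^ k) v + (B ^^ k) v'" and Bk_scale: "(B ^^ k) (c *s v) = c *s (B ^^ k) v"
    and Bk_A: "(B ^^ k) (A *v v) = A *v (B ^^ k) v" for v v' c k
    by (induction k) (simp_all add: B_add B_scale B_A)
  from Suc.hyps(2) have "\<not> constant (poly p)" by (metis constant_degree nat.distinct(1))
  then obtain z where z: "poly p z = 0" using fundamental_theorem_of_algebra by blast
  then obtain q where q: "p = [:- z, 1:] * q" by (auto simp: poly_eq_0_iff_dvd)
  with Suc.prems have "q \<noteq> 0" by auto
  then have "degree p = Suc (degree q)" unfolding q by (subst degree_mult_eq) auto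
  define v where "v = A *v w - z *s w"
  have "\<exists>C. \<forall>k. norm ((B ^^ k) v) \<le> C"
  proof (rule Suc.hyps(1))
    show "n = degree q" using Suc.hyps(2) \<open>degree p = Suc (degree q)\<close> by simp
    show "poly_action A q v = 0"
      using Suc.prems(2) unfolding q poly_action_linear_factor v_def .
    show "norm (1 + h * x) < 1" if "poly q x = 0" "eigenvalue A x" for x
      using Suc.prems(3)[of x] that by (simp add: q)
  qed fact
  then obtain C where C: "\<And>k. norm ((B ^^ k) v) \<le> C" by blast
  have "C \<ge> 0" using C[of 0] norm_ge_zero order_trans by blast
  show ?case
  proof (cases "eigenvalue A z")
    case True
    define l where "l = norm (1 + h * z)"
    have "l < 1" unfolding l_def using Suc.prems(3)[OF z True] .
    \<comment> \<open>K is the fixed point of the recursion a \<mapsto> l a + |h| C for the norms;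
      adding \<open>norm w\<close> in D covers the initial value.\<close>
    define K where "K = norm h * C / (1 - l)"
    define D where "D = norm w + K"
    have "K \<ge> 0" using \<open>l < 1\<close> \<open>C \<ge> 0\<close> by (simp add: K_def)
    have "l * norm w \<le> 1 * norm w" using \<open>l < 1\<close> by (intro mult_right_mono) auto
    moreover have "norm h * C = K * (1 - l)" using \<open>l < 1\<close> by (simp add: K_def)
    ultimately have D: "l * D + norm h * C \<le> D" by (simp add: D_def algebra_simps)
    have "norm ((B ^^ k) w) \<le> D" for k
    proof (induction k)
      case 0
      show ?case using \<open>K \<ge> 0\<close> by (simp add: D_def)
    next
      case (Suc k)
      have "B w = (1 + h * z) *s w + h *s v"
        by (simp add: B_def v_def vec.scale_right_diff_distrib vec.scale_left_distrib)
      then have "(B ^^ Suc k) w = (1 + h * z) *s (B ^^ k) w + h *s (B ^^ k) v"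
        by (simp only: funpow_Suc_right o_apply Bk_add Bk_scale)
      also have "norm \<dots> \<le> l * norm ((B ^^ k) w) + norm h * norm ((B ^^ k) v)"
        using norm_triangle_ineq by (metis l_def norm_vec_scale)
      also have "\<dots> \<le> l * D + norm h * C"
        using Suc C[of k] by (intro add_mono mult_left_mono) (auto simp: l_def)
      also have "\<dots> \<le> D" by (rule D)
      finally show ?case .
    qed
    then show ?thesis by blast
  next
    case False
    \<comment> \<open>A root that is not an eigenvalue: A - z is injective, hence bounded below, and
      it maps the orbit of w to the bounded orbit of v.\<close>
    let ?f = "\<lambda>w. A *v w - z *s w"
    have lin: "linear ?f"
      by (intro linearI) (simp_all only: matrix_vector_right_distrib vec.scale_right_distrib
          scaleR_complex_vec vector_scalar_commute vec.scale_right_diff_distrib vec.scale_left_commute[of z]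
          add_diff_add)
    have "inj ?f"
    proof (rule linear_injective_0[OF lin, THEN iffD2], intro allI impI)
      fix x assume "?f x = 0"
      then show "x = 0" using False unfolding eigenvalue_def by auto
    qed
    obtain \<beta> where \<beta>: "\<beta> > 0" "\<And>x. \<beta> * norm x \<le> norm (?f x)"
      by (rule linear_inj_bounded_below_pos[OF lin \<open>inj ?f\<close>]) (rule that)
    have "norm ((B ^^ k) w) \<le> C / \<beta>" for k
    proof -
      have "v + z *s w = A *v w" by (simp add: v_def)
      then have "?f ((B ^^ k) w) = (B ^^ k) v"
        using Bk_add[of k v "z *s w"] Bk_scale Bk_A[of k w] by (metis add_diff_cancel_right')
      with \<beta>(2)[of "(B ^^ k) w"] C[of k] \<open>\<beta> > 0\<close> show ?thesis
        by (simp add: field_simps)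
    qed
    then show ?thesis by blast
  qed
qed

text \<open>Suppose no eigenvalue has positive real part. Growth of Q excludes imaginary ones, so
  all real parts are negative, and Euler steps of small size h have bounded orbits. But Q grows
  geometrically along the Euler orbit of u. Euler iteration takes the place of the matrix
  exponential.\<close>

lemma unstable_eigenvalue:
  fixes A :: "real^'s^'s" and Q :: "real^'s \<Rightarrow> real^'s \<Rightarrow> real"
  assumes bil: "bounded_bilinear Q" and sym: "\<And>x y. Q x y = Q y x"
    and "\<sigma> > 0" and growth: "\<And>x. Q x (A *v x) \<ge> \<sigma> * (norm x)\<^sup>2"
    and Qu: "Q u u > 0"
  shows "\<exists>\<mu>. eigenvalue (map_matrix complex_of_real A) \<mu> \<and> Re \<mu> > 0"
proof (rule ccontr)
  assume contra: "\<not> ?thesis"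
  define Ac where "Ac = map_matrix complex_of_real A"
  have eig_neg: "Re \<mu> < 0" if "eigenvalue Ac \<mu>" for \<mu>
  proof -
    from that obtain z where z: "z \<noteq> 0" "Ac *v z = \<mu> *s z" by (auto simp: eigenvalue_def)
    define x y where "x = (\<chi> i. Re (z $ i))" and "y = (\<chi> i. Im (z $ i))"
    have "(A *v x) $ i = Re ((Ac *v z) $ i)" "(A *v y) $ i = Im ((Ac *v z) $ i)" for i
      by (simp_all add: matrix_vector_mult_def Ac_def map_matrix_def x_def y_def)
    then have Ax: "A *v x = Re \<mu> *\<^sub>R x - Im \<mu> *\<^sub>R y" and Ay: "A *v y = Im \<mu> *\<^sub>R x + Re \<mu> *\<^sub>R y"
      by (simp_all add: vec_eq_iff z(2) x_def y_def algebra_simps)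
    \<comment> \<open>Real and imaginary part of the eigenvector are added so that the terms with
      \<open>Im \<mu>\<close> cancel by symmetry of Q.\<close>
    have "Q x (A *v x) + Q y (A *v y) = Re \<mu> * (Q x x + Q y y)"
      unfolding Ax Ay
      by (simp add: bounded_bilinear.diff_right[OF bil] bounded_bilinear.add_right[OF bil]
          bounded_bilinear.scaleR_right[OF bil] sym[of y x] algebra_simps)
    moreover have "x \<noteq> 0 \<or> y \<noteq> 0"
      using z(1) by (auto simp: vec_eq_iff x_def y_def complex_eq_iff)
    then have "\<sigma> * ((norm x)\<^sup>2 + (norm y)\<^sup>2) > 0"
      using \<open>\<sigma> > 0\<close> by (intro mult_pos_pos) (auto simp: sum_power2_gt_zero_iff)
    ultimately have "Re \<mu> \<noteq> 0"
      using growth[of x] growth[of y] by (auto simp: distrib_left)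
    with contra that show ?thesis unfolding Ac_def by (meson linorder_neqE)
  qed
  define lift :: "real^'s \<Rightarrow> complex^'s" where "lift = (\<lambda>x. \<chi> i. complex_of_real (x $ i))"
  obtain p where p: "p \<noteq> 0" "poly_action Ac p (lift u) = 0"
    by (rule exists_annihilating_poly)
  obtain a where a: "a > 0" "\<And>x. norm (A *v x) \<le> norm x * a"
    using bounded_linear.pos_bounded[OF matrix_vector_mul_bounded_linear] by metis
  obtain C where C: "C > 0" "\<And>x y. \<bar>Q x y\<bar> \<le> norm x * norm y * C"
    using bounded_bilinear.pos_bounded[OF bil] by auto
  \<comment> \<open>Upper bounds for the step size. The first keeps the second-order term of
    \<open>Q (B x) (B x)\<close> below half of the first-order gain; the others keep |1 + h z|^2 = 1
    + 2 h Re z + h^2 |z|^2 at most 1 + h Re z, hence below 1.\<close>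
  define H where "H = insert (\<sigma> / (C * a\<^sup>2)) ((\<lambda>z. - Re z / (norm z)\<^sup>2) ` {z. poly p z = 0 \<and> eigenvalue Ac z})"
  have fin: "finite {z. poly p z = 0 \<and> eigenvalue Ac z}"
    using poly_roots_finite[OF p(1)] by (rule rev_finite_subset) auto
  define h where "h = Min H"
  have "finite H" "H \<noteq> {}" using fin by (auto simp: H_def)
  have "h > 0"
  proof -
    have "- Re z / (norm z)\<^sup>2 > 0" if "eigenvalue Ac z" for z
    proof -
      have "Re z < 0" using eig_neg[OF that] .
      then have "norm z > 0" by auto
      with \<open>Re z < 0\<close> show ?thesis by (intro divide_pos_pos) auto
    qed
    then have "\<forall>x\<in>H. x > 0"
      using \<open>\<sigma> > 0\<close> C(1) a(1) by (auto simp: H_def)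
    then show ?thesis unfolding h_def using \<open>finite H\<close> \<open>H \<noteq> {}\<close> by simp
  qed
  have contr: "norm (1 + complex_of_real h * z) < 1" if "poly p z = 0" "eigenvalue Ac z" for z
  proof -
    have "Re z < 0" using eig_neg that by blast
    then have "norm z > 0" by auto
    have "h \<le> - Re z / (norm z)\<^sup>2"
      unfolding h_def using that \<open>finite H\<close> by (intro Min_le) (auto simp: H_def)
    then have "h * (norm z)\<^sup>2 \<le> - Re z" using \<open>norm z > 0\<close> by (simp add: field_simps)
    then have "h * (h * (norm z)\<^sup>2) \<le> h * - Re z" using \<open>h > 0\<close> by (intro mult_left_mono) auto
    moreover have "h * Re z < 0" using \<open>h > 0\<close> \<open>Re z < 0\<close> by (rule mult_pos_neg)
    moreover have "(norm (1 + complex_of_real h * z))\<^sup>2 = 1 + 2 * (h * Re z) + h * (h * (norm z)\<^sup>2)"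
      unfolding cmod_power2 by (simp add: power2_eq_square algebra_simps)
    ultimately have "(norm (1 + complex_of_real h * z))\<^sup>2 < 1\<^sup>2" by simp
    then show ?thesis by (rule power_less_imp_less_base) simp
  qed
  define B where "B = (\<lambda>x. x + h *\<^sub>R (A *v x))"
  define Bc where "Bc = (\<lambda>w. w + complex_of_real h *s (Ac *v w))"
  have "Bc (lift x) = lift (B x)" for x
    by (simp add: vec_eq_iff Bc_def B_def lift_def Ac_def map_matrix_def matrix_vector_mult_def)
  then have lift_B: "(Bc ^^ k) (lift u) = lift ((B ^^ k) u)" for k
    by (induction k) auto
  obtain D where D: "\<And>k. norm ((Bc ^^ k) (lift u)) \<le> D"
    using euler_orbit_bounded[OF p contr] unfolding Bc_def by blast
  have "norm (lift x) = norm x" for x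
    by (simp add: lift_def norm_vec_def)
  with D have bounded: "norm ((B ^^ k) u) \<le> D" for k by (simp add: lift_B)
  have Q_B: "Q (B x) (B x) \<ge> (1 + h * \<sigma> / C) * Q x x" for x
  proof -
    have "h \<le> \<sigma> / (C * a\<^sup>2)"
      unfolding h_def using \<open>finite H\<close> by (intro Min_le) (auto simp: H_def)
    then have ha: "h * C * a\<^sup>2 \<le> \<sigma>" using C(1) a(1) by (simp add: field_simps)
    have "\<bar>Q (A *v x) (A *v x)\<bar> \<le> (norm x * a) * (norm x * a) * C"
      using C(2)[of "A *v x" "A *v x"] a(2)[of x] C(1) a(1)
      by (meson mult_mono mult_right_mono norm_ge_zero order_trans less_imp_le mult_nonneg_nonneg)
    then have "h * (h * Q (A *v x) (A *v x)) \<ge> h * (h * - ((norm x * a) * (norm x * a) * C))"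
      using \<open>h > 0\<close> by (intro mult_left_mono) auto
    moreover have "h * ((h * C * a\<^sup>2) * (norm x)\<^sup>2) \<le> h * (\<sigma> * (norm x)\<^sup>2)"
      using ha \<open>h > 0\<close> by (intro mult_left_mono mult_right_mono) auto
    ultimately have 1: "h * (h * Q (A *v x) (A *v x)) \<ge> - (h * (\<sigma> * (norm x)\<^sup>2))"
      by (simp add: power2_eq_square algebra_simps)
    have 2: "h * Q x (A *v x) \<ge> h * (\<sigma> * (norm x)\<^sup>2)"
      using growth[of x] \<open>h > 0\<close> by (intro mult_left_mono) auto
    have "Q x x \<le> (norm x)\<^sup>2 * C"
      using C(2)[of x x] by (simp add: power2_eq_square)
    then have "h * \<sigma> / C * Q x x \<le> h * \<sigma> / C * ((norm x)\<^sup>2 * C)"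
      using \<open>h > 0\<close> \<open>\<sigma> > 0\<close> C(1) by (intro mult_left_mono) auto
    then have 3: "h * \<sigma> / C * Q x x \<le> h * (\<sigma> * (norm x)\<^sup>2)" using C(1) by simp
    have "Q (B x) (B x) = Q x x + 2 * (h * Q x (A *v x)) + h * (h * Q (A *v x) (A *v x))"
      by (simp add: B_def bounded_bilinear.add_right[OF bil] bounded_bilinear.add_left[OF bil]
          bounded_bilinear.scaleR_right[OF bil] bounded_bilinear.scaleR_left[OF bil] sym[of "A *v x" x]
          distrib_left)
    with 1 2 3 show ?thesis by (simp add: distrib_right)
  qed
  define g where "g = h * \<sigma> / C"
  have "g > 0" using \<open>h > 0\<close> \<open>\<sigma> > 0\<close> C(1) by (simp add: g_def)
  have grow: "Q ((B ^^ k) u) ((B ^^ k) u) \<ge> (1 + g) ^ k * Q u u" for k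
  proof (induction k)
    case (Suc k)
    have "(1 + g) ^ Suc k * Q u u \<le> (1 + g) * Q ((B ^^ k) u) ((B ^^ k) u)"
      using Suc \<open>g > 0\<close> by (simp add: mult.assoc mult_left_mono)
    also have "\<dots> \<le> Q ((B ^^ Suc k) u) ((B ^^ Suc k) u)"
      using Q_B[of "(B ^^ k) u"] by (simp add: g_def)
    finally show ?case .
  qed simp
  have "(1 + g) ^ k \<le> D * D * C / Q u u" for k
  proof -
    have "(1 + g) ^ k * Q u u \<le> norm ((B ^^ k) u) * norm ((B ^^ k) u) * C"
      using grow[of k] C(2)[of "(B ^^ k) u" "(B ^^ k) u"] by linarith
    also have "\<dots> \<le> D * D * C"
      using bounded[of k] C(1) order_trans[OF norm_ge_zero bounded[of k]]
      by (intro mult_right_mono mult_mono) auto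
    finally show ?thesis using Qu by (simp add: field_simps)
  qed
  moreover obtain k where "D * D * C / Q u u < (1 + g) ^ k"
    using real_arch_pow[of "1 + g"] \<open>g > 0\<close> by auto
  ultimately show False by (meson not_less)
qed

section \<open>The second smallest eigenvalue\<close>

text \<open>Eigenvectors of distinct eigenvalues are orthogonal. Finiteness matters because the sum
  in \<open>eigenvalue_list\<close> would collapse to 0 over an infinite index set.\<close>

lemma finite_eigenvalues_symmetric:
  fixes A :: "real^'n^'n"
  assumes sym: "\<And>x y. x \<bullet> (A *v y) = (A *v x) \<bullet> y"
  shows "finite {\<mu>. eigenvalue A \<mu>}"
proof -
  define e where "e = (\<lambda>\<mu>. SOME w. w \<noteq> 0 \<and> A *v w = \<mu> *s w)"
  have e: "e \<mu> \<noteq> 0" "A *v e \<mu> = \<mu> *s e \<mu>" if "eigenvalue A \<mu>" for \<mu>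
    using that someI_ex[of "\<lambda>w. w \<noteq> 0 \<and> A *v w = \<mu> *s w"] unfolding eigenvalue_def e_def by blast+
  have orth: "e \<mu> \<bullet> e \<nu> = 0" if "eigenvalue A \<mu>" "eigenvalue A \<nu>" "\<mu> \<noteq> \<nu>" for \<mu> \<nu>
  proof -
    have "\<nu> * (e \<mu> \<bullet> e \<nu>) = \<mu> * (e \<mu> \<bullet> e \<nu>)"
      using sym[of "e \<mu>" "e \<nu>"] e that by (simp add: scalar_mult_eq_scaleR)
    with \<open>\<mu> \<noteq> \<nu>\<close> show ?thesis by simp
  qed
  have "inj_on e {\<mu>. eigenvalue A \<mu>}"
    by (rule inj_onI) (metis e(1) inner_eq_zero_iff mem_Collect_eq orth)
  moreover have "pairwise orthogonal (e ` {\<mu>. eigenvalue A \<mu>})"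
    using orth by (auto simp: pairwise_def orthogonal_def)
  then have "finite (e ` {\<mu>. eigenvalue A \<mu>})"
    by (rule pairwise_orthogonal_imp_finite)
  ultimately show ?thesis by (rule finite_imageD[rotated])
qed

text \<open>Otherwise index 0 is the only one that can carry an entry at most m.\<close>

lemma sorted_nth_1_le:
  assumes "sorted xs" "2 \<le> length (filter (\<lambda>x. x \<le> m) xs)"
  shows "xs ! 1 \<le> (m :: 'a :: linorder)"
proof (rule ccontr)
  assume "\<not> xs ! 1 \<le> m"
  then have "\<not> xs ! i \<le> m" if "1 \<le> i" "i < length xs" for i
    using sorted_nth_mono[OF \<open>sorted xs\<close> that] by auto
  then have "{i. i < length xs \<and> xs ! i \<le> m} \<subseteq> {0}"
    by (auto simp: not_less_eq_eq Suc_le_eq)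
  then have "card {i. i < length xs \<and> xs ! i \<le> m} \<le> card {0 :: nat}"
    by (rule card_mono[rotated]) simp
  with assms(2) show False by (simp add: length_filter_conv_card)
qed

text \<open>The half of Courant-Fischer that is needed. A minimiser of the Rayleigh quotient on the
  complement of k is an eigenvector, with value \<mu>, and \<mu> is not negative. Together with the
  kernel vector k it supplies two entries at most \<mu> in the sorted list.\<close>

lemma lambda2_le_rayleigh:
  fixes A :: "real^'n^'n"
  assumes sym: "\<And>x y. x \<bullet> (A *v y) = (A *v x) \<bullet> y"
    and psd: "\<And>x. x \<bullet> (A *v x) \<ge> 0"
    and k: "A *v k = 0" "k \<noteq> 0" and xk: "x \<bullet> k = 0"
  shows "lambda2 A * (norm x)\<^sup>2 \<le> x \<bullet> (A *v x)"
proof (cases "x = 0")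
  case False
  define S where "S = {y. norm y = 1 \<and> y \<bullet> k = 0}"
  have "closed S"
    unfolding S_def by (intro closed_Collect_conj closed_Collect_eq continuous_intros)
  moreover have "bounded S" by (rule boundedI[of _ 1]) (simp add: S_def)
  ultimately have "compact S" by (simp add: compact_eq_bounded_closed)
  define R where "R = (\<lambda>y. y \<bullet> (A *v y))"
  have R_cont: "continuous_on S R"
    unfolding R_def by (intro continuous_intros linear_continuous_on matrix_vector_mul_bounded_linear)
  have unit: "y /\<^sub>R norm y \<in> S" if "y \<noteq> 0" "y \<bullet> k = 0" for y
    using that by (simp add: S_def)
  then have "S \<noteq> {}" using False xk by blast
  then obtain y where y: "y \<in> S" "\<And>z. z \<in> S \<Longrightarrow> R y \<le> R z"
    using continuous_attains_inf[OF \<open>compact S\<close> _ R_cont] by blast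
  define \<mu> where "\<mu> = R y"
  have R_scale: "R (a *\<^sub>R z) = a\<^sup>2 * R z" for a z
    by (simp add: R_def matrix_vector_mult_scaleR power2_eq_square)
  have ge: "\<mu> * (norm z)\<^sup>2 \<le> R z" if "z \<bullet> k = 0" for z
  proof (cases "z = 0")
    case False
    have "\<mu> \<le> R (z /\<^sub>R norm z)"
      unfolding \<mu>_def by (rule y(2)[OF unit[OF False that]])
    then show ?thesis using False by (simp add: R_scale field_simps)
  qed (simp add: R_def)
  have y_unit: "norm y = 1" and yk: "y \<bullet> k = 0" using y(1) by (auto simp: S_def)
  text \<open>First variation of \<open>R z - \<mu> \<parallel>z\<parallel>\<^sup>2 \<ge> 0\<close> at the minimiser in direction \<open>d = A y - \<mu> y\<close>.\<close>
  define d where "d = A *v y - \<mu> *\<^sub>R y"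
  have dk: "d \<bullet> k = 0"
    using sym[of k y] k(1) yk by (simp add: d_def inner_diff_left inner_diff_right inner_commute)
  have "0 \<le> (R d - \<mu> * (norm d)\<^sup>2) * t\<^sup>2 + 2 * (norm d)\<^sup>2 * t" for t
  proof -
    have "0 \<le> R (y + t *\<^sub>R d) - \<mu> * (norm (y + t *\<^sub>R d))\<^sup>2"
      using ge[of "y + t *\<^sub>R d"] yk dk by (simp add: inner_add_left)
    also have "R (y + t *\<^sub>R d) = R y + 2 * t * (d \<bullet> (A *v y)) + t\<^sup>2 * R d"
      using sym[of y d] by (simp add: R_def matrix_vector_right_distrib matrix_vector_mult_scaleR
          inner_add_left inner_add_right power2_eq_square inner_commute algebra_simps)
    also have "(norm (y + t *\<^sub>R d))\<^sup>2 = 1 + 2 * t * (d \<bullet> y) + t\<^sup>2 * (norm d)\<^sup>2"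
      using y_unit unfolding power2_norm_eq_inner norm_eq_1
      by (simp add: inner_add_left inner_add_right inner_commute power2_eq_square algebra_simps)
    also have "R y + 2 * t * (d \<bullet> (A *v y)) + t\<^sup>2 * R d - \<mu> * (1 + 2 * t * (d \<bullet> y) + t\<^sup>2 * (norm d)\<^sup>2)
        = (R d - \<mu> * (norm d)\<^sup>2) * t\<^sup>2 + 2 * (d \<bullet> (A *v y) - \<mu> * (d \<bullet> y)) * t"
      by (simp add: \<mu>_def algebra_simps)
    also have "d \<bullet> (A *v y) - \<mu> * (d \<bullet> y) = (norm d)\<^sup>2"
      by (simp add: d_def power2_norm_eq_inner inner_diff_right)
    finally show ?thesis .
  qed
  note quad = this
  have "(norm d)\<^sup>2 \<le> 0"
  proof (rule ccontr)
    assume "\<not> (norm d)\<^sup>2 \<le> 0"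
    define n where "n = (norm d)\<^sup>2"
    define a where "a = \<bar>R d - \<mu> * n\<bar> + 1"
    have "n > 0" "a > 0" using \<open>\<not> (norm d)\<^sup>2 \<le> 0\<close> by (auto simp: n_def a_def)
    \<comment> \<open>The trial value t = -n/a minimises a t^2 + 2 n t, where a exceeds the absolute
      value of the true quadratic coefficient.\<close>
    have "0 \<le> (R d - \<mu> * n) * (- n / a)\<^sup>2 + 2 * n * (- n / a)"
      using quad[of "- n / a"] by (simp add: n_def)
    also have "\<dots> \<le> a * (- n / a)\<^sup>2 + 2 * n * (- n / a)"
      by (intro add_right_mono mult_right_mono) (auto simp: a_def)
    also have "\<dots> = - (n\<^sup>2 / a)" using \<open>a > 0\<close> by (simp add: power2_eq_square field_simps)
    also have "\<dots> < 0" using \<open>n > 0\<close> \<open>a > 0\<close> by simp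
    finally show False by simp
  qed
  then have "d = 0" by simp
  then have Ay: "A *v y = \<mu> *s y" by (simp add: d_def scalar_mult_eq_scaleR)
  have "\<mu> \<ge> 0" unfolding \<mu>_def R_def by (rule psd)
  have "y \<noteq> 0" using y_unit by auto
  define E where "E = {\<mu>. eigenvalue A \<mu>}"
  define m where "m = (\<lambda>\<mu>. dim {w. A *v w = \<mu> *s w})"
  define M where "M = (\<Sum>\<mu>\<in>E. replicate_mset (m \<mu>) \<mu>)"
  have "finite E" unfolding E_def by (rule finite_eigenvalues_symmetric[OF sym])
  have count: "count M \<nu> = (if \<nu> \<in> E then m \<nu> else 0)" for \<nu>
    using \<open>finite E\<close> by (simp add: M_def count_sum sum.delta')
  have zero_E: "0 \<in> E" and \<mu>_E: "\<mu> \<in> E"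
    using k Ay \<open>y \<noteq> 0\<close> by (auto simp: E_def eigenvalue_def)
  have dim_ge: "card B \<le> m \<nu>" if "independent B" "B \<subseteq> {w. A *v w = \<nu> *s w}" for B \<nu>
    unfolding m_def using independent_card_le_dim[OF that(2,1)] .
  \<comment> \<open>If \<mu> = 0, both entries come from the multiplicity of 0, as y and k are
    orthogonal; otherwise one is 0 and one is \<mu>.\<close>
  have two: "2 \<le> size (filter_mset (\<lambda>x. x \<le> \<mu>) M)"
  proof (cases "\<mu> = 0")
    case True
    have "independent {y, k}"
      using yk \<open>y \<noteq> 0\<close> k(2)
      by (intro pairwise_orthogonal_independent) (auto simp: pairwise_def orthogonal_def inner_commute)
    moreover have "y \<noteq> k" using yk \<open>y \<noteq> 0\<close> by auto
    ultimately have "2 \<le> m 0" using dim_ge[of "{y, k}" 0] k Ay True by auto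
    also have "m 0 = count (filter_mset (\<lambda>x. x \<le> \<mu>) M) 0"
      using zero_E \<open>\<mu> \<ge> 0\<close> by (simp add: count)
    also have "\<dots> \<le> size (filter_mset (\<lambda>x. x \<le> \<mu>) M)"
      by (rule count_le_size)
    finally show ?thesis .
  next
    case False
    have "1 \<le> m 0" "1 \<le> m \<mu>"
      using dim_ge[of "{k}" 0] dim_ge[of "{y}" \<mu>] k Ay \<open>y \<noteq> 0\<close> by auto
    then have "{#0, \<mu>#} \<subseteq># filter_mset (\<lambda>x. x \<le> \<mu>) M"
      using zero_E \<mu>_E \<open>\<mu> \<ge> 0\<close> False by (auto simp: subseteq_mset_def count)
    from size_mset_mono[OF this] show ?thesis by simp
  qed
  have "lambda2 A = sorted_list_of_multiset M ! 1"
    by (simp add: lambda2_def eigenvalue_list_def M_def E_def m_def)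
  also have "\<dots> \<le> \<mu>"
  proof (rule sorted_nth_1_le)
    have "mset (filter (\<lambda>x. x \<le> \<mu>) (sorted_list_of_multiset M)) = filter_mset (\<lambda>x. x \<le> \<mu>) M"
      by simp
    then show "2 \<le> length (filter (\<lambda>x. x \<le> \<mu>) (sorted_list_of_multiset M))"
      using two by (metis size_mset)
  qed simp
  finally have "lambda2 A * (norm x)\<^sup>2 \<le> \<mu> * (norm x)\<^sup>2"
    by (intro mult_right_mono) auto
  also have "\<dots> \<le> x \<bullet> (A *v x)" using ge[OF xk] by (simp add: R_def)
  finally show ?thesis .
qed simp

section \<open>The decay estimate\<close>

text \<open>Here p, q, Y are the norms of P v, of \<alpha> times the restoring force and of b, and X
  bounds the rest of the voltage rate. The weight c/m^2 gives m p and q the same damping; the weight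
  1/(m l) makes the two cross terms in X Y equal. With \<xi> = (c/m) X all reduces to the form
  \<xi>^2/4 - 2 \<xi> Y + 5 Y^2, positive definite since 1 < 5/4. Its last coefficient is the 5 in
  the gain condition.\<close>

lemma lyapunov_quadratic_bound:
  fixes p q Y E c m :: real
  assumes c: "c > 0" "c \<le> m" and \<eta>: "\<eta> > 0" and \<rho>: "\<rho> > 0" and l: "l > 0"
    and gain: "\<eta> * (\<rho> * l * (c + 5 * m)) < c"
    and nonneg: "p \<ge> 0" "q \<ge> 0" "Y \<ge> 0"
  defines "X \<equiv> m * p + q"
  shows "\<eta> * (- c * p\<^sup>2 + p * Y) + c / m\<^sup>2 * \<eta> * (q * (m * p) - q\<^sup>2 + q * Y)
      + 1 / (m * l) * (- Y\<^sup>2 / \<rho> + Y * (l * (\<eta> * (X + Y))))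
      \<le> - (\<eta> / (25 * c) * (c / m)\<^sup>2) * (X\<^sup>2 + Y\<^sup>2)"
proof -
  have m: "m > 0" using c by linarith
  define P where "P = m * p"
  define \<xi> where "\<xi> = c / m * X"
  have P: "P \<ge> 0" "p = P / m" using m nonneg by (auto simp: P_def)
  have X: "X = P + q" by (simp add: X_def P_def)
  have 1: "\<eta> * (- c * p\<^sup>2 + p * Y) + c / m\<^sup>2 * \<eta> * (q * (m * p) - q\<^sup>2 + q * Y)
     = \<eta> * (c / m\<^sup>2) * (- P\<^sup>2 + P * q - q\<^sup>2) + \<eta> * (Y / m) * (P + c / m * q)"
    using m unfolding P(2) by (simp add: field_simps power2_eq_square)
  \<comment> \<open>The gap between the two sides is exactly 3/4 times the square of P - q.\<close>
  have "- P\<^sup>2 + P * q - q\<^sup>2 \<le> - (X\<^sup>2 / 4)"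
  proof -
    have "0 \<le> 3 / 4 * (P - q)\<^sup>2" by simp
    then show ?thesis unfolding X by (simp add: power2_eq_square field_simps)
  qed
  then have 2: "\<eta> * (c / m\<^sup>2) * (- P\<^sup>2 + P * q - q\<^sup>2) \<le> \<eta> * (c / m\<^sup>2) * - (X\<^sup>2 / 4)"
    using \<eta> c by (intro mult_left_mono) auto
  have "c / m * q \<le> 1 * q" using c m nonneg by (intro mult_right_mono) auto
  then have 3: "\<eta> * (Y / m) * (P + c / m * q) \<le> \<eta> * (Y / m) * X"
    unfolding X using \<eta> m nonneg by (intro mult_left_mono) auto
  \<comment> \<open>The gain condition, divided by \<open>c * m * l * \<rho>\<close>, leaves this
    much net damping of Y.\<close>
  have "5 * \<eta> / c \<le> 1 / (m * l) * (1 / \<rho> - l * \<eta>)"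
  proof -
    have "5 * \<eta> * (m * l * \<rho>) \<le> c * (1 - \<rho> * l * \<eta>)"
      using gain by (simp add: algebra_simps)
    then have "5 * \<eta> * (m * l * \<rho>) / (c * (m * l * \<rho>)) \<le> c * (1 - \<rho> * l * \<eta>) / (c * (m * l * \<rho>))"
      using c m l \<rho> by (intro divide_right_mono) auto
    then show ?thesis using c m l \<rho> by (simp add: field_simps)
  qed
  then have "5 * \<eta> / c * Y\<^sup>2 \<le> 1 / (m * l) * (1 / \<rho> - l * \<eta>) * Y\<^sup>2"
    by (rule mult_right_mono) simp
  moreover have "1 / (m * l) * (- Y\<^sup>2 / \<rho> + Y * (l * (\<eta> * (X + Y))))
      = - (1 / (m * l) * (1 / \<rho> - l * \<eta>) * Y\<^sup>2) + \<eta> * (Y / m) * X"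
    using m l \<rho> by (simp add: field_simps power2_eq_square)
  ultimately have 4: "1 / (m * l) * (- Y\<^sup>2 / \<rho> + Y * (l * (\<eta> * (X + Y))))
      \<le> - (5 * \<eta> / c * Y\<^sup>2) + \<eta> * (Y / m) * X" by linarith
  have 5: "\<eta> * (c / m\<^sup>2) * - (X\<^sup>2 / 4) + \<eta> * (Y / m) * X + (- (5 * \<eta> / c * Y\<^sup>2) + \<eta> * (Y / m) * X)
      = - (\<eta> / c) * (\<xi>\<^sup>2 / 4 - 2 * \<xi> * Y + 5 * Y\<^sup>2)"
    using c m by (simp add: \<xi>_def field_simps power2_eq_square)
  have "(\<xi>\<^sup>2 + Y\<^sup>2) / 25 \<le> \<xi>\<^sup>2 / 4 - 2 * \<xi> * Y + 5 * Y\<^sup>2"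
  proof -
    \<comment> \<open>Completing the square after subtracting 1/25 from both diagonal coefficients:
      21/100 = 1/4 - 1/25 and 496/100 = 5 - 1/25.\<close>
    have "0 \<le> 21 / 100 * (\<xi> - 100 / 21 * Y)\<^sup>2 + (496 / 100 - 100 / 21) * Y\<^sup>2" by simp
    then show ?thesis by (simp add: power2_eq_square field_simps)
  qed
  then have 6: "- (\<eta> / c) * (\<xi>\<^sup>2 / 4 - 2 * \<xi> * Y + 5 * Y\<^sup>2) \<le> - (\<eta> / c) * ((\<xi>\<^sup>2 + Y\<^sup>2) / 25)"
    using \<eta> c by (intro mult_left_mono_neg) auto
  have "(c / m)\<^sup>2 \<le> 1" using c m by (intro power_le_one) auto
  then have "(c / m)\<^sup>2 * Y\<^sup>2 \<le> 1 * Y\<^sup>2" by (intro mult_right_mono) auto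
  then have "(c / m)\<^sup>2 * (X\<^sup>2 + Y\<^sup>2) \<le> \<xi>\<^sup>2 + Y\<^sup>2"
    by (simp add: \<xi>_def power_mult_distrib power_divide distrib_left)
  then have "\<eta> / (25 * c) * ((c / m)\<^sup>2 * (X\<^sup>2 + Y\<^sup>2)) \<le> \<eta> / (25 * c) * (\<xi>\<^sup>2 + Y\<^sup>2)"
    using \<eta> c by (intro mult_left_mono) auto
  then have 7: "- (\<eta> / c) * ((\<xi>\<^sup>2 + Y\<^sup>2) / 25) \<le> - (\<eta> / (25 * c) * (c / m)\<^sup>2) * (X\<^sup>2 + Y\<^sup>2)"
    by (simp add: mult.assoc)
  show ?thesis
    using 1 2 3 4 5 6 7 by linarith
qed

text \<open>The vectors stand for \<open>y = P v\<close>, \<open>g = (\<K> - \<L>) v\<close>, the restoring force \<open>\<phi>\<close>, the deviation \<open>e\<close> of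
  the current from its steady state and its nodal image \<open>b\<close>; \<open>h\<close> and \<open>k\<close> are the images of \<open>v'\<close>
  that drive \<open>b\<close> and \<open>e\<close>.\<close>

lemma lyapunov_decay_rate:
  fixes c m \<eta> \<rho> l \<tau> \<alpha> :: real
  assumes c: "c > 0" "c \<le> m" and \<eta>: "\<eta> > 0" and \<rho>: "\<rho> > 0" and l: "l > 0" and \<tau>: "\<tau> \<ge> 0"
    and \<alpha>: "\<alpha> > 0"
    and gain: "\<eta> * (\<rho> * l * (c + 5 * m)) < c"
  obtains \<delta> \<sigma> where "\<delta> > 0" "\<sigma> > 0"
    "\<And>(y :: 'a::real_inner) \<phi> g b v' h b' (e :: 'b::real_inner) k e'.
      v' = \<eta> *\<^sub>R (g - b + \<alpha> *\<^sub>R \<phi>) \<Longrightarrow>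
      y \<bullet> g \<le> - (c + \<alpha>) * (norm y)\<^sup>2 \<Longrightarrow> y \<bullet> \<phi> \<le> (norm y)\<^sup>2 \<Longrightarrow> norm g \<le> m * norm y \<Longrightarrow>
      b \<bullet> b' = - (norm b)\<^sup>2 / \<rho> - b \<bullet> h \<Longrightarrow> norm h \<le> l * norm v' \<Longrightarrow>
      e \<bullet> e' = - (norm e)\<^sup>2 / \<rho> - e \<bullet> k \<Longrightarrow> norm k \<le> \<tau> * norm v' \<Longrightarrow>
      y \<bullet> v' - c / m\<^sup>2 * \<alpha> * (\<phi> \<bullet> v') + 1 / (m * l) * (b \<bullet> b') + \<delta> * (e \<bullet> e')
        \<le> - \<sigma> * ((norm y)\<^sup>2 + (norm \<phi>)\<^sup>2 + (norm e)\<^sup>2)"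
proof -
  have m: "m > 0" using c by linarith
  define \<kappa> where "\<kappa> = \<eta> / (25 * c) * (c / m)\<^sup>2"
  have \<kappa>: "\<kappa> > 0" using \<eta> c m by (simp add: \<kappa>_def)
  \<comment> \<open>Young's inequality splits the drive of e: half of its damping 1/\<rho> is kept
    and D (X^2 + Y^2) is paid. Then \<delta> is taken so small that this uses at most half of the
    rate \<kappa>, which leaves the bound on \<eta> untouched.\<close>
  define D where "D = \<rho> * (\<tau> * \<eta>)\<^sup>2"
  have D: "D \<ge> 0" using \<rho> by (simp add: D_def)
  define \<delta> where "\<delta> = \<kappa> / (2 * (D + 1))"
  have \<delta>: "\<delta> > 0" using \<kappa> D by (simp add: \<delta>_def)
  have \<delta>D: "\<delta> * D \<le> \<kappa> / 2" using \<kappa> D by (simp add: \<delta>_def field_simps)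
  define \<sigma> where "\<sigma> = min (\<kappa> * m\<^sup>2 / 2) (min (\<kappa> * \<alpha>\<^sup>2 / 2) (\<delta> / (2 * \<rho>)))"
  have \<sigma>: "\<sigma> > 0" using \<kappa> m \<alpha> \<delta> \<rho> by (simp add: \<sigma>_def)
  show ?thesis
  proof (rule that[OF \<delta> \<sigma>])
    fix y \<phi> g b v' h b' :: 'a and e k e' :: 'b
    assume v': "v' = \<eta> *\<^sub>R (g - b + \<alpha> *\<^sub>R \<phi>)"
      and yg: "y \<bullet> g \<le> - (c + \<alpha>) * (norm y)\<^sup>2" and y\<phi>: "y \<bullet> \<phi> \<le> (norm y)\<^sup>2"
      and g: "norm g \<le> m * norm y"
      and bb': "b \<bullet> b' = - (norm b)\<^sup>2 / \<rho> - b \<bullet> h" and h: "norm h \<le> l * norm v'"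
      and ee': "e \<bullet> e' = - (norm e)\<^sup>2 / \<rho> - e \<bullet> k" and k: "norm k \<le> \<tau> * norm v'"
    define p q Y E X where "p = norm y" and "q = \<alpha> * norm \<phi>" and "Y = norm b" and "E = norm e"
      and "X = m * p + q"
    have nn: "p \<ge> 0" "q \<ge> 0" "Y \<ge> 0" "E \<ge> 0" using \<alpha> by (auto simp: p_def q_def Y_def E_def)
    have v'_le: "norm v' \<le> \<eta> * (X + Y)"
    proof -
      have "norm (g - b + \<alpha> *\<^sub>R \<phi>) \<le> norm g + norm b + norm (\<alpha> *\<^sub>R \<phi>)"
        using norm_triangle_ineq[of "g - b" "\<alpha> *\<^sub>R \<phi>"] norm_triangle_ineq4[of g b] by linarith
      also have "\<dots> \<le> X + Y" using g \<alpha> by (simp add: X_def p_def q_def Y_def)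
      finally show ?thesis using \<eta> by (simp add: v')
    qed
    have cs: "- (u \<bullet> w) \<le> norm u * norm w" for u w :: "'c::real_inner"
      using Cauchy_Schwarz_ineq2[of u w] by linarith
    have "y \<bullet> g + \<alpha> * (y \<bullet> \<phi>) - y \<bullet> b \<le> - c * p\<^sup>2 + p * Y"
    proof -
      have "\<alpha> * (y \<bullet> \<phi>) \<le> \<alpha> * p\<^sup>2" using y\<phi> \<alpha> by (simp add: p_def)
      then show ?thesis using yg cs[of y b] by (simp add: p_def Y_def algebra_simps)
    qed
    then have "\<eta> * (y \<bullet> g + \<alpha> * (y \<bullet> \<phi>) - y \<bullet> b) \<le> \<eta> * (- c * p\<^sup>2 + p * Y)"
      using \<eta> by (intro mult_left_mono) auto
    then have 1: "y \<bullet> v' \<le> \<eta> * (- c * p\<^sup>2 + p * Y)"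
      by (simp add: v' inner_diff_right inner_add_right algebra_simps)
    have "- (\<phi> \<bullet> g) \<le> norm \<phi> * (m * p)"
      using cs[of \<phi> g] mult_left_mono[OF g norm_ge_zero[of \<phi>]] by (simp add: p_def)
    then have "\<alpha> * - (\<phi> \<bullet> g) \<le> \<alpha> * (norm \<phi> * (m * p))" using \<alpha> by (intro mult_left_mono) auto
    moreover have "\<alpha> * (\<phi> \<bullet> b) \<le> \<alpha> * (norm \<phi> * norm b)"
      using norm_cauchy_schwarz[of \<phi> b] \<alpha> by (intro mult_left_mono) auto
    ultimately have "- \<alpha> * (\<phi> \<bullet> g + \<alpha> * (\<phi> \<bullet> \<phi>) - \<phi> \<bullet> b) \<le> q * (m * p) - q\<^sup>2 + q * Y"
      by (simp add: q_def Y_def power2_norm_eq_inner[symmetric] power2_eq_square algebra_simps)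
    then have "c / m\<^sup>2 * \<eta> * (- \<alpha> * (\<phi> \<bullet> g + \<alpha> * (\<phi> \<bullet> \<phi>) - \<phi> \<bullet> b))
        \<le> c / m\<^sup>2 * \<eta> * (q * (m * p) - q\<^sup>2 + q * Y)"
      using c \<eta> by (intro mult_left_mono) auto
    then have 2: "- (c / m\<^sup>2 * \<alpha> * (\<phi> \<bullet> v')) \<le> c / m\<^sup>2 * \<eta> * (q * (m * p) - q\<^sup>2 + q * Y)"
      by (simp add: v' inner_diff_right inner_add_right algebra_simps)
    have "- (b \<bullet> h) \<le> Y * (l * (\<eta> * (X + Y)))"
    proof -
      have "norm h \<le> l * (\<eta> * (X + Y))"
        using h mult_left_mono[OF v'_le, of l] l by linarith
      then have "norm b * norm h \<le> Y * (l * (\<eta> * (X + Y)))"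
        unfolding Y_def by (intro mult_left_mono) auto
      with cs[of b h] show ?thesis by linarith
    qed
    then have 3: "1 / (m * l) * (b \<bullet> b') \<le> 1 / (m * l) * (- Y\<^sup>2 / \<rho> + Y * (l * (\<eta> * (X + Y))))"
      unfolding bb' using m l by (intro mult_left_mono) (auto simp: Y_def)
    have "- (e \<bullet> k) \<le> E\<^sup>2 / (2 * \<rho>) + D * (X\<^sup>2 + Y\<^sup>2)"
    proof -
      have "norm k \<le> \<tau> * (\<eta> * (X + Y))"
        using k mult_left_mono[OF v'_le \<tau>] by linarith
      then have "norm e * norm k \<le> E * (\<tau> * (\<eta> * (X + Y)))"
        unfolding E_def by (intro mult_left_mono) auto
      then have "- (e \<bullet> k) \<le> E * (\<tau> * \<eta> * (X + Y))" using cs[of e k] by (simp add: mult.assoc)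
      also have "\<dots> \<le> E\<^sup>2 / (2 * \<rho>) + \<rho> / 2 * (\<tau> * \<eta> * (X + Y))\<^sup>2"
      proof -
        have "0 \<le> (E - \<rho> * (\<tau> * \<eta> * (X + Y)))\<^sup>2 / (2 * \<rho>)" using \<rho> by simp
        then show ?thesis using \<rho> by (simp add: power2_eq_square field_simps)
      qed
      also have "\<rho> / 2 * (\<tau> * \<eta> * (X + Y))\<^sup>2 = D / 2 * (X + Y)\<^sup>2"
        by (simp add: D_def power_mult_distrib)
      also have "\<dots> \<le> D / 2 * (2 * (X\<^sup>2 + Y\<^sup>2))"
      proof (intro mult_left_mono)
        have "0 \<le> (X - Y)\<^sup>2" by simp
        then show "(X + Y)\<^sup>2 \<le> 2 * (X\<^sup>2 + Y\<^sup>2)" by (simp add: power2_eq_square algebra_simps)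
      qed (use D in auto)
      also have "\<dots> = D * (X\<^sup>2 + Y\<^sup>2)" by simp
      finally show ?thesis by simp
    qed
    note * = this
    have "e \<bullet> e' \<le> - E\<^sup>2 / (2 * \<rho>) + D * (X\<^sup>2 + Y\<^sup>2)"
    proof -
      have "- (norm e)\<^sup>2 / \<rho> = - E\<^sup>2 / (2 * \<rho>) - E\<^sup>2 / (2 * \<rho>)"
        by (simp add: E_def field_simps)
      then show ?thesis using * unfolding ee' by linarith
    qed
    then have "\<delta> * (e \<bullet> e') \<le> \<delta> * (- E\<^sup>2 / (2 * \<rho>) + D * (X\<^sup>2 + Y\<^sup>2))"
      using \<delta> by (intro mult_left_mono) auto
    moreover have "\<delta> * D * (X\<^sup>2 + Y\<^sup>2) \<le> \<kappa> / 2 * (X\<^sup>2 + Y\<^sup>2)"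
      using \<delta>D by (intro mult_right_mono) auto
    ultimately have 4: "\<delta> * (e \<bullet> e') \<le> - (\<delta> / (2 * \<rho>) * E\<^sup>2) + \<kappa> / 2 * (X\<^sup>2 + Y\<^sup>2)"
      by (simp add: algebra_simps)
    have 5: "y \<bullet> v' - c / m\<^sup>2 * \<alpha> * (\<phi> \<bullet> v') + 1 / (m * l) * (b \<bullet> b') \<le> - \<kappa> * (X\<^sup>2 + Y\<^sup>2)"
      using 1 2 3 lyapunov_quadratic_bound[OF c \<eta> \<rho> l gain nn(1-3)] unfolding \<kappa>_def X_def by linarith
    have "(m * p)\<^sup>2 + q\<^sup>2 \<le> X\<^sup>2"
      using nn m by (simp add: X_def power2_sum)
    then have "\<kappa> / 2 * ((m * p)\<^sup>2 + q\<^sup>2) \<le> \<kappa> / 2 * X\<^sup>2" using \<kappa> by (intro mult_left_mono) auto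
    also have "\<dots> \<le> \<kappa> / 2 * (X\<^sup>2 + Y\<^sup>2)" using \<kappa> by (intro mult_left_mono) auto
    finally have 6: "\<kappa> * m\<^sup>2 / 2 * p\<^sup>2 + \<kappa> * \<alpha>\<^sup>2 / 2 * (norm \<phi>)\<^sup>2 \<le> \<kappa> / 2 * (X\<^sup>2 + Y\<^sup>2)"
      by (simp add: q_def power_mult_distrib algebra_simps)
    have 7: "\<sigma> * p\<^sup>2 \<le> \<kappa> * m\<^sup>2 / 2 * p\<^sup>2" "\<sigma> * (norm \<phi>)\<^sup>2 \<le> \<kappa> * \<alpha>\<^sup>2 / 2 * (norm \<phi>)\<^sup>2"
      "\<sigma> * E\<^sup>2 \<le> \<delta> / (2 * \<rho>) * E\<^sup>2"
      by (rule mult_right_mono; simp add: \<sigma>_def)+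
    have "- \<kappa> * (X\<^sup>2 + Y\<^sup>2) = - (\<kappa> / 2 * (X\<^sup>2 + Y\<^sup>2)) - \<kappa> / 2 * (X\<^sup>2 + Y\<^sup>2)" by simp
    with 4 5 6 7 show "y \<bullet> v' - c / m\<^sup>2 * \<alpha> * (\<phi> \<bullet> v') + 1 / (m * l) * (b \<bullet> b') + \<delta> * (e \<bullet> e')
        \<le> - \<sigma> * ((norm y)\<^sup>2 + (norm \<phi>)\<^sup>2 + (norm e)\<^sup>2)"
      unfolding p_def E_def distrib_left mult_minus_left by linarith
  qed
qed

text \<open>The map a \<mapsto> |a|^2 a is the gradient of the convex function |a|^4 / 4.\<close>

lemma inner_cubic_mono:
  fixes a b :: "'a::real_inner"
  shows "0 \<le> (a - b) \<bullet> ((norm a)\<^sup>2 *\<^sub>R a - (norm b)\<^sup>2 *\<^sub>R b)"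
proof -
  define x y where "x = norm a" and "y = norm b"
  have "a \<bullet> b \<le> (x\<^sup>2 + y\<^sup>2) / 2"
  proof -
    have "0 \<le> (norm (a - b))\<^sup>2" by simp
    then show ?thesis
      by (simp add: power2_norm_eq_inner inner_diff_left inner_diff_right inner_commute x_def y_def)
  qed
  then have "(x\<^sup>2 + y\<^sup>2) * (a \<bullet> b) \<le> (x\<^sup>2 + y\<^sup>2) * ((x\<^sup>2 + y\<^sup>2) / 2)"
    by (intro mult_left_mono) auto
  moreover have "0 \<le> (x\<^sup>2 - y\<^sup>2)\<^sup>2 / 2" by simp
  moreover have "(a - b) \<bullet> (x\<^sup>2 *\<^sub>R a - y\<^sup>2 *\<^sub>R b) = x\<^sup>2 * x\<^sup>2 + y\<^sup>2 * y\<^sup>2 - (x\<^sup>2 + y\<^sup>2) * (a \<bullet> b)"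
    by (simp add: inner_diff_left inner_diff_right power2_norm_eq_inner[symmetric] inner_commute
        x_def y_def algebra_simps)
  ultimately show ?thesis
    unfolding x_def y_def by (simp add: power2_eq_square algebra_simps)
qed

lemma cubic_lipschitz:
  fixes a b :: "'a::real_normed_vector"
  assumes "norm a \<le> r" "norm b \<le> r"
  shows "norm ((norm a)\<^sup>2 *\<^sub>R a - (norm b)\<^sup>2 *\<^sub>R b) \<le> 3 * r\<^sup>2 * norm (a - b)"
proof -
  have "(norm a)\<^sup>2 *\<^sub>R a - (norm b)\<^sup>2 *\<^sub>R b = (norm a)\<^sup>2 *\<^sub>R (a - b) + ((norm a - norm b) * (norm a + norm b)) *\<^sub>R b"
    by (simp add: power2_eq_square algebra_simps)
  also have "norm \<dots> \<le> (norm a)\<^sup>2 * norm (a - b) + \<bar>norm a - norm b\<bar> * (norm a + norm b) * norm b"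
    by (rule norm_triangle_le) (simp add: abs_mult)
  also have "\<dots> \<le> r\<^sup>2 * norm (a - b) + norm (a - b) * (r + r) * r"
    using assms norm_triangle_ineq3[of a b] order_trans[OF norm_ge_zero assms(1)]
    by (intro add_mono mult_mono mult_right_mono power_mono) auto
  finally show ?thesis by (simp add: power2_eq_square algebra_simps)
qed

section \<open>Matrices acting on phasors\<close>

definition phasor :: "real^('n::finite \<times> 2) \<Rightarrow> 'n \<Rightarrow> complex" where
  "phasor v k = Complex (v $ (k, 1)) (v $ (k, 2))"

definition of_phasors :: "('n::finite \<Rightarrow> complex) \<Rightarrow> real^('n \<times> 2)" where
  "of_phasors z = (\<chi> s. if snd s = 1 then Re (z (fst s)) else Im (z (fst s)))"

lemma phasor_of_phasors [simp]: "phasor (of_phasors z) k = z k"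
  by (simp add: phasor_def of_phasors_def complex_eq_iff)

lemma phasor_eqI: "(\<And>k. phasor v k = phasor w k) \<Longrightarrow> v = w"
proof -
  assume *: "\<And>k. phasor v k = phasor w k"
  have "v $ (k, a) = w $ (k, a)" for k and a :: 2
    using *[of k] exhaust_2[of a] by (auto simp: phasor_def)
  then show ?thesis by (simp add: vec_eq_iff)
qed

lemma phasor_add [simp]: "phasor (v + w) k = phasor v k + phasor w k"
  and phasor_diff [simp]: "phasor (v - w) k = phasor v k - phasor w k"
  and phasor_minus [simp]: "phasor (- v) k = - phasor v k"
  and phasor_scaleR [simp]: "phasor (a *\<^sub>R v) k = a *\<^sub>R phasor v k"
  and phasor_0 [simp]: "phasor 0 k = 0"
  by (simp_all add: phasor_def complex_eq_iff)

lemma sum_product_2: "(\<Sum>s\<in>UNIV. f s) = (\<Sum>k\<in>UNIV. f (k, 1 :: 2) + f (k, 2))"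
  by (simp add: UNIV_Times_UNIV[symmetric] sum.cartesian_product' sum_2 del: UNIV_Times_UNIV)

lemma inner_phasor: "v \<bullet> w = (\<Sum>k\<in>UNIV. phasor v k \<bullet> phasor w k)"
  by (simp add: inner_vec_def sum_product_2 phasor_def inner_complex_def)

lemma norm_phasor: "(norm v)\<^sup>2 = (\<Sum>k\<in>UNIV. (norm (phasor v k))\<^sup>2)"
  by (simp add: power2_norm_eq_inner inner_phasor)

lemma norm_phasor_le: "norm (phasor v k) \<le> norm v"
  by (rule power2_le_imp_le) (auto simp: norm_phasor[of v] intro: member_le_sum)

lemma norm_block: "norm (block v k) = norm (phasor v k)"
  by (simp add: block_def phasor_def norm_vec_def L2_set_def sum_2 complex_norm)

lemma matrix_vector_product_2:
  "(A *v v) $ s = (\<Sum>k\<in>UNIV. A $ s $ (k, 1) * v $ (k, 1 :: 2) + A $ s $ (k, 2) * v $ (k, 2))"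
  by (simp add: matrix_vector_mult_def sum_product_2)

lemma phasor_kron_mat: "phasor (kron A (mat 1) *v v) k = (\<Sum>j\<in>UNIV. A $ k $ j *\<^sub>R phasor v j)"
  by (simp add: phasor_def kron_def matrix_vector_product_2 mat_def complex_eq_iff)

lemma phasor_kron_diag: "phasor (kron (diag d) (mat 1) *v v) k = d k *\<^sub>R phasor v k"
  by (simp add: phasor_kron_mat diag_def if_distrib[of "\<lambda>x. x *\<^sub>R _"] cong: if_cong)

lemma phasor_kron_rot: "phasor (kron (mat 1) (rot t) *v v) k = cis t * phasor v k"
  by (simp add: phasor_def kron_def matrix_vector_product_2 mat_def complex_eq_iff rot_def
      vector_2 if_distrib[of "\<lambda>x. x * _"] sum.distrib sum.delta cong: if_cong)

lemma phasor_blockdiag: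
  assumes "\<And>k. D k = vector [vector [Re (c k), - Im (c k)], vector [Im (c k), Re (c k)]]"
  shows "phasor (blockdiag D *v v) k = c k * phasor v k"
  by (simp add: phasor_def blockdiag_def matrix_vector_product_2 assms complex_eq_iff
      vector_2 if_distrib[of "\<lambda>x. x * _"] sum.distrib sum.delta cong: if_cong)

lemma transpose_kron: "transpose (kron A B) = kron (transpose A) (transpose B)"
  by (simp add: transpose_def kron_def vec_eq_iff)

text \<open>\<open>matrix_inv\<close> is a choice operator, so invertibility comes first; it follows
  from injectivity, which can be checked phasor by phasor.\<close>

lemma matrix_inv_phasor:
  assumes A: "\<And>v k. phasor (A *v v) k = c k * phasor v k" and nz: "\<And>k. c k \<noteq> 0"
  shows "phasor (matrix_inv A *v v) k = phasor v k / c k"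
proof -
  have "inj ((*v) A)"
  proof (rule injI, rule phasor_eqI)
    fix x y k assume "A *v x = A *v y"
    then show "phasor x k = phasor y k" using A[of x k] A[of y k] nz[of k] by simp
  qed
  then have "invertible A"
    by (simp add: invertible_left_inverse matrix_left_invertible_injective)
  then have inv: "matrix_inv A ** A = mat 1"
    unfolding invertible_def matrix_inv_def by (rule someI2_ex) blast
  define y where "y = of_phasors (\<lambda>k. phasor v k / c k)"
  have "A *v y = v" by (rule phasor_eqI) (simp add: A y_def nz)
  then have "matrix_inv A *v v = matrix_inv A ** A *v y"
    by (simp add: matrix_vector_mul_assoc[symmetric])
  also have "\<dots> = y" by (simp add: inv)
  finally show ?thesis by (simp add: y_def)
qed

lemma norm_matrix_vector_le: "norm (A *v x) \<le> mat_norm A * norm x"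
  unfolding mat_norm_def by (rule onorm[OF matrix_vector_mul_bounded_linear])

lemma mat_norm_nonneg: "mat_norm A \<ge> 0"
  unfolding mat_norm_def by (rule onorm_pos_le[OF matrix_vector_mul_bounded_linear])

lemma voltage_pair_state [simp]: "voltage (pair_state v i) = v"
  and current_pair_state [simp]: "current (pair_state v i) = i"
  and pair_state_voltage_current [simp]: "pair_state (voltage x) (current x) = x"
  by (simp_all add: voltage_def current_def pair_state_def vec_eq_iff split: sum.split)

lemma state_eqI: "voltage x = voltage y \<Longrightarrow> current x = current y \<Longrightarrow> x = y"
  by (metis pair_state_voltage_current)

lemma inner_state: "x \<bullet> y = voltage x \<bullet> voltage y + current x \<bullet> current y"
  by (simp add: inner_vec_def voltage_def current_def UNIV_Plus_UNIV[symmetric] sum.Plus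
      del: UNIV_Plus_UNIV)

lemma norm_state: "(norm x)\<^sup>2 = (norm (voltage x))\<^sup>2 + (norm (current x))\<^sup>2"
  by (simp add: power2_norm_eq_inner inner_state)

lemma voltage_linear_simps [simp]: "voltage (x + y) = voltage x + voltage y"
  "voltage (x - y) = voltage x - voltage y" "voltage (a *\<^sub>R x) = a *\<^sub>R voltage x" "voltage 0 = 0"
  and current_linear_simps [simp]: "current (x + y) = current x + current y"
  "current (x - y) = current x - current y" "current (a *\<^sub>R x) = a *\<^sub>R current x" "current 0 = 0"
  by (simp_all add: voltage_def current_def vec_eq_iff)

lemma bounded_linear_voltage: "bounded_linear voltage"
  by (auto simp: linear_conv_bounded_linear[symmetric] intro!: linearI)

lemma norm_voltage_le: "norm (voltage x) \<le> norm x"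
  by (rule power2_le_imp_le) (simp_all add: norm_state[of x])

lemma norm_pair_state_0: "norm (pair_state v 0) = norm v"
proof -
  have "(norm (pair_state v 0 :: real^('a \<times> 2 + 'b \<times> 2)))\<^sup>2 = (norm v)\<^sup>2"
    by (simp add: norm_state)
  then show ?thesis by simp
qed

section \<open>Networks\<close>

locale line_network =
  fixes G :: "('n::finite, 'm::finite) network" and \<rho> :: real
  assumes network: "power_network G \<rho>"
begin

definition impedance :: "'m \<Rightarrow> complex" where
  "impedance l = Complex (res G l) (freq G * ind G l)"

lemma src_neq_dst: "src G l \<noteq> dst G l"
  and inj_ends: "inj (ends G)"
  and res_pos: "res G l > 0" and ind_pos: "ind G l > 0"
  and \<rho>_pos: "\<rho> > 0"
  using network by (auto simp: power_network_def)

lemma ind_eq: "ind G l = \<rho> * res G l"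
proof -
  have "ind G l / res G l = \<rho>" using network by (simp add: power_network_def)
  then show ?thesis using res_pos[of l] by (simp add: field_simps)
qed

lemma weight_pos: "weight G l > 0"
  using res_pos[of l] by (simp add: weight_def add_pos_nonneg)

lemma impedance_nonzero: "impedance l \<noteq> 0"
  using res_pos[of l] by (simp add: impedance_def complex_eq_iff)

text \<open>The quotient of reactance and resistance is \<rho> times the frequency on every line, so
  all impedances have the same argument. This is where the uniform ratio enters the algebra.\<close>

lemma weight_impedance: "complex_of_real (weight G l) * impedance l = cis (kappa G \<rho>)"
proof -
  define x where "x = \<rho> * freq G"
  have 1: "1 + x\<^sup>2 > 0" by (simp add: add_pos_nonneg)
  have "sqrt ((res G l)\<^sup>2 + (freq G)\<^sup>2 * (ind G l)\<^sup>2) = res G l * sqrt (1 + x\<^sup>2)"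
  proof -
    have "(res G l)\<^sup>2 + (freq G)\<^sup>2 * (ind G l)\<^sup>2 = (res G l)\<^sup>2 * (1 + x\<^sup>2)"
      by (simp add: ind_eq x_def power_mult_distrib algebra_simps)
    then show ?thesis using res_pos[of l] by (simp add: real_sqrt_mult)
  qed
  then have w: "weight G l = 1 / (res G l * sqrt (1 + x\<^sup>2))" by (simp add: weight_def)
  show ?thesis
    using res_pos[of l] 1
    by (simp add: complex_eq_iff w kappa_def cos_arctan sin_arctan impedance_def x_def[symmetric] ind_eq)
      (simp add: x_def)
qed

lemma sum_incidence:
  fixes x :: "'n \<Rightarrow> 'a::real_vector"
  shows "(\<Sum>k\<in>UNIV. incidence G $ k $ l *\<^sub>R x k) = x (src G l) - x (dst G l)"
proof -
  have "(\<Sum>k\<in>UNIV. incidence G $ k $ l *\<^sub>R x k)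
      = (\<Sum>k\<in>UNIV. (if k = src G l then x k else 0) - (if k = dst G l then x k else 0))"
    using src_neq_dst[of l] by (intro sum.cong) (auto simp: incidence_def)
  then show ?thesis by (simp add: sum_subtractf)
qed

lemma phasor_calB_transpose:
  "phasor (transpose (calB G) *v v) l = phasor v (src G l) - phasor v (dst G l)"
  by (simp add: calB_def transpose_kron transpose_mat phasor_kron_mat transpose_def[of "incidence G"]
      sum_incidence)

lemma phasor_Z_T: "phasor (Z_T G *v i) l = impedance l * phasor i l"
  by (simp add: Z_T_def matrix_vector_mult_add_rdistrib scaleR_matrix_vector_assoc[symmetric] R_T_def L_T_def
      J_def phasor_kron_diag phasor_kron_rot matrix_vector_mul_assoc[symmetric] impedance_def complex_eq_iff)

lemma phasor_L_T_inv: "phasor (matrix_inv (L_T G) *v x) l = phasor x l / complex_of_real (ind G l)"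
proof (rule matrix_inv_phasor)
  show "phasor (L_T G *v v) k = complex_of_real (ind G k) * phasor v k" for v k
    by (simp add: L_T_def phasor_kron_diag scaleR_conv_of_real)
  show "complex_of_real (ind G k) \<noteq> 0" for k using ind_pos[of k] by simp
qed

lemma phasor_Z_T_inv: "phasor (matrix_inv (Z_T G) *v x) l = phasor x l / impedance l"
  by (rule matrix_inv_phasor[OF phasor_Z_T impedance_nonzero])

lemma phasor_steady_current:
  "phasor (steady_current G v) l = (phasor v (src G l) - phasor v (dst G l)) / impedance l"
  unfolding steady_current_def phasor_Z_T_inv phasor_calB_transpose ..

lemma phasor_calR_calB: "phasor ((calR G \<rho> ** calB G) *v i) k =
    (\<Sum>l\<in>UNIV. incidence G $ k $ l *\<^sub>R (cis (kappa G \<rho>) * phasor i l))"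
  by (simp add: matrix_vector_mul_assoc[symmetric] calR_def calB_def phasor_kron_rot phasor_kron_mat
      sum_distrib_left scaleR_conv_of_real ac_simps)

lemma laplacian_sum:
  fixes x :: "'n \<Rightarrow> 'a::real_vector"
  shows "(\<Sum>j\<in>UNIV. laplacian G $ k $ j *\<^sub>R x j)
    = (\<Sum>l\<in>UNIV. incidence G $ k $ l *\<^sub>R (weight G l *\<^sub>R (x (src G l) - x (dst G l))))"
proof -
  have "laplacian G $ k $ j = (\<Sum>l\<in>UNIV. incidence G $ k $ l * weight G l * incidence G $ j $ l)" for j
    by (simp add: laplacian_def matrix_matrix_mult_def diag_def transpose_def
        if_distrib[of "\<lambda>x. _ * x"] cong: if_cong)
  then have "(\<Sum>j\<in>UNIV. laplacian G $ k $ j *\<^sub>R x j)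
      = (\<Sum>j\<in>UNIV. \<Sum>l\<in>UNIV. (incidence G $ k $ l * weight G l * incidence G $ j $ l) *\<^sub>R x j)"
    by (simp add: scaleR_sum_left)
  also have "\<dots> = (\<Sum>l\<in>UNIV. \<Sum>j\<in>UNIV. (incidence G $ k $ l * weight G l * incidence G $ j $ l) *\<^sub>R x j)"
    by (rule sum.swap)
  also have "\<dots> = (\<Sum>l\<in>UNIV. (incidence G $ k $ l * weight G l) *\<^sub>R (\<Sum>j\<in>UNIV. incidence G $ j $ l *\<^sub>R x j))"
    by (simp add: scaleR_sum_right)
  finally show ?thesis by (simp add: sum_incidence)
qed

lemma phasor_calL: "phasor (calL G *v v) k =
    (\<Sum>l\<in>UNIV. incidence G $ k $ l *\<^sub>R (weight G l *\<^sub>R (phasor v (src G l) - phasor v (dst G l))))"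
  by (simp add: calL_def phasor_kron_mat laplacian_sum)

text \<open>Rotation by \<kappa> cancels the common phase of the inverse impedances and leaves the
  real edge weights.\<close>

lemma calR_calB_steady_current: "(calR G \<rho> ** calB G) *v steady_current G v = calL G *v v"
proof (rule phasor_eqI)
  fix k
  have "cis (kappa G \<rho>) * phasor (steady_current G v) l
      = weight G l *\<^sub>R (phasor v (src G l) - phasor v (dst G l))" for l
    by (simp add: phasor_steady_current scaleR_conv_of_real weight_impedance[symmetric, of l] impedance_nonzero)
  then show "phasor ((calR G \<rho> ** calB G) *v steady_current G v) k = phasor (calL G *v v) k"
    by (simp add: phasor_calR_calB phasor_calL)
qed

lemma calR_isometry: "norm (calR G \<rho> *v v) = norm v"
proof -
  have "(norm (calR G \<rho> *v v))\<^sup>2 = (norm v)\<^sup>2"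
    by (simp add: norm_phasor calR_def phasor_kron_rot norm_mult)
  then show ?thesis by simp
qed

text \<open>\<open>calL\<close> is \<open>calY\<close> followed by the isometry \<open>calR\<close>;
  thus the admittance norm in the gain condition also controls the Laplacian.\<close>

lemma norm_calL_le: "norm (calL G *v v) \<le> mat_norm (calY G) * norm v"
proof -
  have "calL G *v v = calR G \<rho> *v (calY G *v v)"
    by (simp add: calY_def steady_current_def matrix_vector_mul_assoc[symmetric]
        calR_calB_steady_current[symmetric])
  then show ?thesis using norm_matrix_vector_le[of "calY G" v] by (simp add: calR_isometry)
qed

lemma nbrs_line:
  assumes "j \<in> nbrs G k"
  shows "ends G (line G j k) = {j, k}"
  unfolding line_def
proof (rule theI')
  show "\<exists>!l. ends G l = {j, k}"
    using assms inj_ends by (auto simp: nbrs_def inj_def)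
qed

text \<open>Since \<open>ends\<close> is injective, lines at k correspond bijectively to neighbours
  of k. The sign of the incidence entry undoes the orientation of the line.\<close>

lemma sum_lines_nbrs:
  fixes x :: "'n \<Rightarrow> 'a::real_vector"
  shows "(\<Sum>l\<in>UNIV. incidence G $ k $ l *\<^sub>R (weight G l *\<^sub>R (x (src G l) - x (dst G l))))
    = (\<Sum>j\<in>nbrs G k. weight G (line G j k) *\<^sub>R (x k - x j))"
proof -
  define other where "other = (\<lambda>l. if src G l = k then dst G l else src G l)"
  have "(\<Sum>l\<in>UNIV. incidence G $ k $ l *\<^sub>R (weight G l *\<^sub>R (x (src G l) - x (dst G l))))
      = (\<Sum>l | k \<in> ends G l. incidence G $ k $ l *\<^sub>R (weight G l *\<^sub>R (x (src G l) - x (dst G l))))"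
    by (rule sum.mono_neutral_right) (auto simp: ends_def incidence_def)
  also have "\<dots> = (\<Sum>l | k \<in> ends G l. weight G l *\<^sub>R (x k - x (other l)))"
    by (rule sum.cong) (auto simp: ends_def incidence_def other_def algebra_simps)
  also have "\<dots> = (\<Sum>j\<in>nbrs G k. weight G (line G j k) *\<^sub>R (x k - x j))"
  proof (rule sum.reindex_bij_witness[of _ "\<lambda>j. line G j k" other])
    fix l assume l: "l \<in> {l. k \<in> ends G l}"
    then have ends: "ends G l = {other l, k}"
      by (auto simp: ends_def other_def)
    then show nb: "other l \<in> nbrs G k" by (auto simp: nbrs_def)
    show "line G (other l) k = l"
      using nbrs_line[OF nb] ends inj_ends by (metis injD)
    then show "weight G (line G (other l) k) *\<^sub>R (x k - x (other l)) = weight G l *\<^sub>R (x k - x (other l))"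
      by simp
  next
    fix j assume j: "j \<in> nbrs G k"
    note ends = nbrs_line[OF j]
    then show "line G j k \<in> {l. k \<in> ends G l}" by simp
    show "other (line G j k) = j"
      using ends src_neq_dst[of "line G j k"] by (auto simp: ends_def other_def doubleton_eq_iff)
  qed
  finally show ?thesis .
qed

section \<open>Spectral gap of the Laplacian\<close>

lemma laplacian_inner: "x \<bullet> (laplacian G *v y)
    = (\<Sum>l\<in>UNIV. weight G l * (x $ src G l - x $ dst G l) * (y $ src G l - y $ dst G l))"
proof -
  have "(laplacian G *v y) $ k
      = (\<Sum>l\<in>UNIV. incidence G $ k $ l *\<^sub>R (weight G l *\<^sub>R (y $ src G l - y $ dst G l)))" for k
    using laplacian_sum[of k "\<lambda>j. y $ j"] by (simp add: matrix_vector_mult_def)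
  then have "x \<bullet> (laplacian G *v y)
      = (\<Sum>k\<in>UNIV. \<Sum>l\<in>UNIV. incidence G $ k $ l * x $ k * (weight G l * (y $ src G l - y $ dst G l)))"
    by (simp add: inner_vec_def sum_distrib_left ac_simps)
  also have "\<dots> = (\<Sum>l\<in>UNIV. \<Sum>k\<in>UNIV. incidence G $ k $ l * x $ k * (weight G l * (y $ src G l - y $ dst G l)))"
    by (rule sum.swap)
  also have "\<dots> = (\<Sum>l\<in>UNIV. (\<Sum>k\<in>UNIV. incidence G $ k $ l *\<^sub>R x $ k) * (weight G l * (y $ src G l - y $ dst G l)))"
    by (simp add: sum_distrib_right)
  finally show ?thesis unfolding sum_incidence by (simp add: ac_simps)
qed

text \<open>Subtracting the mean does not change the quadratic form, makes x orthogonal to the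
  kernel vector 1 and shortens it by precisely the mean term.\<close>

lemma laplacian_spectral_gap:
  fixes x :: "real^'n"
  shows "lambda2 (laplacian G) * ((norm x)\<^sup>2 - (\<Sum>k\<in>UNIV. x $ k)\<^sup>2 / CARD('n)) \<le> x \<bullet> (laplacian G *v x)"
proof -
  define S where "S = (\<Sum>k\<in>UNIV. x $ k)"
  define z where "z = x - (\<chi> k. S / CARD('n))"
  have N: "real CARD('n) > 0" by simp
  have z1: "z \<bullet> 1 = 0" by (simp add: inner_vec_def z_def sum_subtractf S_def)
  have "(norm z)\<^sup>2 = (\<Sum>k\<in>UNIV. (x $ k)\<^sup>2 - 2 * (S / CARD('n)) * x $ k + (S / CARD('n))\<^sup>2)"
    unfolding power2_norm_eq_inner by (simp add: inner_vec_def z_def power2_eq_square algebra_simps)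
  also have "\<dots> = (norm x)\<^sup>2 - 2 * (S / CARD('n)) * S + CARD('n) * (S / CARD('n))\<^sup>2"
    unfolding sum.distrib sum_subtractf S_def power2_norm_eq_inner
    by (simp add: inner_vec_def sum_distrib_left power2_eq_square)
  also have "\<dots> = (norm x)\<^sup>2 - S\<^sup>2 / CARD('n)"
    by (simp add: power2_eq_square field_simps)
  finally have "(norm z)\<^sup>2 = (norm x)\<^sup>2 - S\<^sup>2 / CARD('n)" .
  moreover have "z \<bullet> (laplacian G *v z) = x \<bullet> (laplacian G *v x)"
    by (simp add: laplacian_inner z_def)
  moreover have "lambda2 (laplacian G) * (norm z)\<^sup>2 \<le> z \<bullet> (laplacian G *v z)"
  proof (rule lambda2_le_rayleigh[OF _ _ _ _ z1])
    show "a \<bullet> (laplacian G *v b) = (laplacian G *v a) \<bullet> b" for a b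
      unfolding inner_commute[of _ b] laplacian_inner by (simp add: ac_simps)
    show "0 \<le> a \<bullet> (laplacian G *v a)" for a
      using weight_pos unfolding laplacian_inner
      by (intro sum_nonneg) (simp add: mult.assoc less_imp_le)
    have "(laplacian G *v 1) \<bullet> (laplacian G *v 1) = 0" by (subst laplacian_inner) simp
    then show "laplacian G *v 1 = 0" by simp
  qed simp
  ultimately show ?thesis by (simp add: S_def)
qed

lemma calL_spectral_gap:
  "lambda2 (laplacian G) * ((norm v)\<^sup>2 - (norm (\<Sum>k\<in>UNIV. phasor v k))\<^sup>2 / CARD('n)) \<le> v \<bullet> (calL G *v v)"
proof -
  define a b :: "real^'n" where "a = (\<chi> k. Re (phasor v k))" and "b = (\<chi> k. Im (phasor v k))"
  have "(laplacian G *v x) $ k = (\<Sum>j\<in>UNIV. laplacian G $ k $ j * x $ j)" for k and x :: "real^'n"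
    by (simp add: matrix_vector_mult_def)
  then have "phasor (calL G *v v) k = Complex ((laplacian G *v a) $ k) ((laplacian G *v b) $ k)" for k
    by (simp add: calL_def phasor_kron_mat a_def b_def complex_eq_iff)
  then have 1: "v \<bullet> (calL G *v v) = a \<bullet> (laplacian G *v a) + b \<bullet> (laplacian G *v b)"
    by (simp add: inner_phasor inner_vec_def inner_complex_def a_def b_def sum.distrib)
  have 2: "(norm v)\<^sup>2 = (norm a)\<^sup>2 + (norm b)\<^sup>2"
    by (simp add: power2_norm_eq_inner inner_phasor inner_vec_def inner_complex_def a_def b_def sum.distrib)
  have 3: "(norm (\<Sum>k\<in>UNIV. phasor v k))\<^sup>2 = (\<Sum>k\<in>UNIV. a $ k)\<^sup>2 + (\<Sum>k\<in>UNIV. b $ k)\<^sup>2"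
    by (simp add: cmod_power2 a_def b_def)
  show ?thesis
    using laplacian_spectral_gap[of a] laplacian_spectral_gap[of b] unfolding 1 2 3
    by (simp add: add_divide_distrib algebra_simps)
qed

end

section \<open>Set-points and mismatch\<close>

locale inverter_network = line_network G \<rho>
  for G :: "('n::finite, 'm::finite) network" and \<rho> :: real +
  fixes ref :: 'n and ps qs vs \<theta> :: "'n \<Rightarrow> real" and c \<alpha> \<eta> \<theta>bar :: real
  assumes vs_pos: "\<And>k. vs k > 0"
    and ref_angle: "\<theta> ref = 0"
    and consistent: "consistent G ps qs vs \<theta>"
    and c_pos: "c > 0" and \<alpha>_pos: "\<alpha> > 0" and \<eta>_pos: "\<eta> > 0"
    and \<theta>bar: "0 \<le> \<theta>bar" "\<theta>bar \<le> pi / 2"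
    and angles: "\<And>j k. \<bar>rel_angle \<theta> j k\<bar> \<le> \<theta>bar"
    and margin: "\<And>k. (\<Sum>j\<in>nbrs G k. weight G (line G j k) * \<bar>1 - vs j / vs k * cos (rel_angle \<theta> j k)\<bar>) + \<alpha>
           < (1 + cos \<theta>bar) / 2 * ((Min (range vs))\<^sup>2 / (Max (range vs))\<^sup>2) * lambda2 (laplacian G) - c"
    and gain: "\<eta> < c / (\<rho> * mat_norm (calY G) * (c + 5 * mat_norm (calK G \<rho> ps qs vs - calL G)))"
begin

definition setpoint :: "'n \<Rightarrow> complex" where
  "setpoint k = complex_of_real (vs k) * cis (\<theta> k)"

definition power_total :: real where
  "power_total = (\<Sum>k\<in>UNIV. (vs k)\<^sup>2)"

definition sync :: "complex \<Rightarrow> real^('n \<times> 2)" where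
  "sync z = of_phasors (\<lambda>k. setpoint k * z)"

definition amplitude :: "real^('n \<times> 2) \<Rightarrow> complex" where
  "amplitude v = (\<Sum>k\<in>UNIV. cnj (setpoint k) * phasor v k) / complex_of_real power_total"

definition proj :: "real^('n \<times> 2) \<Rightarrow> real^('n \<times> 2)" where
  "proj v = v - sync (amplitude v)"

definition mismatch :: "real^('n \<times> 2)^('n \<times> 2)" where
  "mismatch = calK G \<rho> ps qs vs - calL G"

lemma norm_setpoint [simp]: "norm (setpoint k) = vs k"
  using vs_pos[of k] by (simp add: setpoint_def norm_mult)

lemma setpoint_nonzero: "setpoint k \<noteq> 0"
  using norm_setpoint[of k] vs_pos[of k] by force

lemma cnj_setpoint_mult: "cnj (setpoint k) * setpoint k = complex_of_real ((vs k)\<^sup>2)"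
  using complex_norm_square[of "setpoint k"] by (simp add: mult.commute)

lemma power_total_pos: "power_total > 0"
  unfolding power_total_def using vs_pos by (intro sum_pos zero_less_power) auto

lemma phasor_sync [simp]: "phasor (sync z) k = setpoint k * z"
  by (simp add: sync_def)

lemma sync_linear: "sync (y + z) = sync y + sync z" "sync (a *\<^sub>R z) = a *\<^sub>R sync z"
  by (rule phasor_eqI; simp add: algebra_simps)+

lemma amplitude_linear: "amplitude (v + w) = amplitude v + amplitude w"
  "amplitude (a *\<^sub>R v) = a *\<^sub>R amplitude v"
  by (simp_all add: amplitude_def distrib_left sum.distrib add_divide_distrib
      scaleR_conv_of_real[where 'a = complex] mult.left_commute[of _ "complex_of_real a"]
      flip: sum_distrib_left)

lemma linear_proj: "linear proj"
  by (rule linearI) (simp_all add: proj_def amplitude_linear sync_linear scaleR_diff_right)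

lemma amplitude_sync [simp]: "amplitude (sync z) = z"
proof -
  have "(\<Sum>k\<in>UNIV. cnj (setpoint k) * (setpoint k * z)) = complex_of_real power_total * z"
    by (simp only: mult.assoc[symmetric] cnj_setpoint_mult power_total_def of_real_sum sum_distrib_right)
  then show ?thesis using power_total_pos by (simp add: amplitude_def)
qed

lemma proj_sync [simp]: "proj (sync z) = 0"
  by (simp add: proj_def)

lemma proj_orthogonal: "(\<Sum>k\<in>UNIV. cnj (setpoint k) * phasor (proj v) k) = 0"
proof -
  have "amplitude (proj v) = 0"
    using amplitude_linear(1)[of "proj v" "sync (amplitude v)"] by (simp add: proj_def)
  then show ?thesis using power_total_pos by (simp add: amplitude_def)
qed

lemma proj_inner_sync: "proj v \<bullet> sync z = 0"
proof -
  have "proj v \<bullet> sync z = Re (z * cnj (\<Sum>k\<in>UNIV. cnj (setpoint k) * phasor (proj v) k))"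
    by (simp add: inner_phasor inner_complex_def sum_distrib_left algebra_simps del: cnj_sum)
      (simp add: sum_distrib_left sum_subtractf sum.distrib algebra_simps)
  then show ?thesis by (simp add: proj_orthogonal)
qed

lemma proj_add_sync: "proj v + sync (amplitude v) = v"
  by (simp add: proj_def)

lemma inner_proj_proj: "proj v \<bullet> proj w = proj v \<bullet> w"
  using proj_inner_sync[of v "amplitude w"] by (simp add: proj_def[of w] inner_diff_right)

text \<open>The block with rows (p, q) and (-q, p) is multiplication by p - i q, whence the minus
  sign.\<close>

definition node_gain :: "'n \<Rightarrow> complex" where
  "node_gain k = cis (kappa G \<rho>) * Complex (ps k) (- qs k) / complex_of_real ((vs k)\<^sup>2)"

lemma phasor_calK: "phasor (calK G \<rho> ps qs vs *v v) k = node_gain k * phasor v k"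
  unfolding calK_def
proof (rule phasor_blockdiag)
  fix k
  show "(1 / (vs k)\<^sup>2) *\<^sub>R (rot (kappa G \<rho>) ** vector [vector [ps k, qs k], vector [- qs k, ps k]])
      = (vector [vector [Re (node_gain k), - Im (node_gain k)], vector [Im (node_gain k), Re (node_gain k)]] :: real^2^2)"
    by (simp add: vec_eq_iff forall_2 matrix_matrix_mult_def sum_2 rot_def vector_2 node_gain_def
        Re_divide_of_real Im_divide_of_real diff_divide_distrib add_divide_distrib del: of_real_power)
qed

text \<open>Consistency enters here. The conjugate branch power is the squared weight times the
  conjugate impedance times a voltage factor; one weight and the conjugate impedance combine to the
  inverse of the rotation by \<kappa>, which cancels the one in the gain.\<close>

lemma node_gain_eq: "node_gain k = (\<Sum>j\<in>nbrs G k. complex_of_real (weight G (line G j k)) *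
    (1 - complex_of_real (vs j / vs k) * cis (rel_angle \<theta> j k)))"
proof -
  have branch: "cis (kappa G \<rho>) * Complex (branch_p G vs \<theta> j k) (- branch_q G vs \<theta> j k)
      = complex_of_real ((vs k)\<^sup>2) * (complex_of_real (weight G (line G j k)) *
        (1 - complex_of_real (vs j / vs k) * cis (rel_angle \<theta> j k)))" for j
  proof -
    define l where "l = line G j k"
    define t where "t = rel_angle \<theta> j k"
    have "Complex (branch_p G vs \<theta> j k) (- branch_q G vs \<theta> j k)
        = complex_of_real ((weight G l)\<^sup>2) * cnj (impedance l) *
          (complex_of_real ((vs k)\<^sup>2) - complex_of_real (vs k * vs j) * cis t)"
      by (simp add: branch_p_def branch_q_def Let_def impedance_def l_def[symmetric] t_def[symmetric]
          complex_eq_iff algebra_simps)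
    also have "complex_of_real ((weight G l)\<^sup>2) * cnj (impedance l)
        = complex_of_real (weight G l) * cnj (cis (kappa G \<rho>))"
      by (simp add: weight_impedance[symmetric, of l] power2_eq_square)
    finally have "cis (kappa G \<rho>) * Complex (branch_p G vs \<theta> j k) (- branch_q G vs \<theta> j k)
        = (cis (kappa G \<rho>) * cnj (cis (kappa G \<rho>))) * (complex_of_real (weight G l) *
          (complex_of_real ((vs k)\<^sup>2) - complex_of_real (vs k * vs j) * cis t))"
      by (simp only: ac_simps)
    also have "cis (kappa G \<rho>) * cnj (cis (kappa G \<rho>)) = 1" by (simp add: cis_cnj cis_mult)
    also have "complex_of_real ((vs k)\<^sup>2) - complex_of_real (vs k * vs j) * cis t
        = complex_of_real ((vs k)\<^sup>2) * (1 - complex_of_real (vs j / vs k) * cis t)"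
      using vs_pos[of k] by (simp add: field_simps power2_eq_square)
    finally show ?thesis by (simp add: l_def t_def ac_simps)
  qed
  have "Complex (ps k) (- qs k) = (\<Sum>j\<in>nbrs G k. Complex (branch_p G vs \<theta> j k) (- branch_q G vs \<theta> j k))"
    using consistent by (simp add: consistent_def complex_eq_iff sum_negf)
  then have "cis (kappa G \<rho>) * Complex (ps k) (- qs k) = complex_of_real ((vs k)\<^sup>2) *
      (\<Sum>j\<in>nbrs G k. complex_of_real (weight G (line G j k)) *
        (1 - complex_of_real (vs j / vs k) * cis (rel_angle \<theta> j k)))"
    by (simp only: sum_distrib_left branch)
  then show ?thesis using vs_pos[of k] by (simp add: node_gain_def)
qed

lemma mismatch_sync: "mismatch *v sync z = 0"
proof (rule phasor_eqI)
  fix k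
  have "cis (\<theta> j - \<theta> k) * cis (\<theta> k) = cis (\<theta> j)" for j by (simp add: cis_mult)
  then have "complex_of_real (vs j / vs k) * cis (rel_angle \<theta> j k) * setpoint k = setpoint j" for j
    using vs_pos[of k] by (simp add: rel_angle_def setpoint_def field_simps)
  then have "(1 - complex_of_real (vs j / vs k) * cis (rel_angle \<theta> j k)) * (setpoint k * z)
      = setpoint k * z - setpoint j * z" for j
    by (simp add: left_diff_distrib flip: mult.assoc)
  then have "node_gain k * (setpoint k * z)
      = (\<Sum>j\<in>nbrs G k. weight G (line G j k) *\<^sub>R (setpoint k * z - setpoint j * z))"
    by (simp add: node_gain_eq sum_distrib_right mult.assoc scaleR_conv_of_real)
  then show "phasor (mismatch *v sync z) k = phasor 0 k"
    using sum_lines_nbrs[of k "\<lambda>k. setpoint k * z"]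
    by (simp add: mismatch_def matrix_vector_mult_diff_rdistrib phasor_calK phasor_calL)
qed

lemma mismatch_proj: "mismatch *v v = mismatch *v proj v"
  using mismatch_sync[of "amplitude v"] by (simp add: proj_def matrix_vector_mult_diff_distrib)

lemma norm_mismatch_le: "norm (mismatch *v v) \<le> mat_norm mismatch * norm (proj v)"
  unfolding mismatch_proj[of v] by (rule norm_matrix_vector_le)

text \<open>The square of cos(\<theta>bar/2) times the smallest over the largest set-point; the half
  angle arises by measuring angles from the midpoint of their arc.\<close>

definition coherence :: real where
  "coherence = (1 + cos \<theta>bar) / 2 * ((Min (range vs))\<^sup>2 / (Max (range vs))\<^sup>2)"

lemma vs_bounds: "0 < Min (range vs)" "Min (range vs) \<le> vs k" "vs k \<le> Max (range vs)"
  "0 < Max (range vs)"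
proof -
  show "0 < Min (range vs)" using vs_pos by (subst Min_gr_iff) auto
  show "Min (range vs) \<le> vs k" "vs k \<le> Max (range vs)" by simp_all
  then show "0 < Max (range vs)" using vs_pos[of k] by linarith
qed

text \<open>The angles lie in an arc of length \<open>\<theta>bar\<close>; after rotating its midpoint to the real axis, the
  set-points are close enough to a multiple of the all-ones vector that a vector orthogonal to the
  set-points has a bounded mean.\<close>

lemma proj_mean_bound:
  "(norm (\<Sum>k\<in>UNIV. phasor (proj v) k))\<^sup>2 \<le> CARD('n) * (1 - coherence) * (norm (proj v))\<^sup>2"
proof -
  define vm vM where "vm = Min (range vs)" and "vM = Max (range vs)"
  have vmM: "0 < vm" "0 < vM" "\<And>k. vm \<le> vs k" "\<And>k. vs k \<le> vM"
    using vs_bounds by (auto simp: vm_def vM_def)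
  define \<phi> where "\<phi> = (Max (range \<theta>) + Min (range \<theta>)) / 2"
  define C where "C = cos (\<theta>bar / 2)"
  have arc: "\<bar>\<theta> k - \<phi>\<bar> \<le> \<theta>bar / 2" for k
  proof -
    define a b where "a = Max (range \<theta>)" and "b = Min (range \<theta>)"
    have "a \<in> range \<theta>" "b \<in> range \<theta>" unfolding a_def b_def by (auto intro: Max_in Min_in)
    then have "a - b \<le> \<theta>bar"
      using angles by (fastforce simp: rel_angle_def abs_le_iff)
    moreover have "\<theta> k \<le> a" "b \<le> \<theta> k" by (simp_all add: a_def b_def)
    moreover have "\<phi> = (a + b) / 2" by (simp add: \<phi>_def a_def b_def)
    ultimately show ?thesis by (intro abs_leI) (simp_all add: field_simps)
  qed
  have "C \<ge> 0" unfolding C_def using \<theta>bar by (intro cos_ge_zero) auto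
  have cos_ge: "C \<le> cos (\<theta> k - \<phi>)" for k
  proof -
    have "C \<le> cos \<bar>\<theta> k - \<phi>\<bar>"
      unfolding C_def using arc[of k] \<theta>bar by (intro cos_monotone_0_pi_le) auto
    then show ?thesis by simp
  qed
  have C2: "C\<^sup>2 = (1 + cos \<theta>bar) / 2"
    using cos_double_cos[of "\<theta>bar / 2"] by (simp add: C_def)
  \<comment> \<open>The minimiser of 1 - 2 t vm C + t^2 vM^2, the bound derived below for
    \<open>(norm (d k))\<^sup>2\<close>.\<close>
  define t where "t = C * vm / vM\<^sup>2"
  have "t \<ge> 0" using \<open>C \<ge> 0\<close> vmM by (simp add: t_def)
  define d where "d = (\<lambda>k. 1 - complex_of_real t * cis (- \<phi>) * setpoint k)"
  have rot: "cis (- \<phi>) * setpoint k = complex_of_real (vs k) * cis (\<theta> k - \<phi>)" for k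
    by (simp add: setpoint_def cis_mult mult.left_commute)
  have d_le: "(norm (d k))\<^sup>2 \<le> 1 - coherence" for k
  proof -
    have "(norm (d k))\<^sup>2 = (1 - t * (vs k * cos (\<theta> k - \<phi>)))\<^sup>2 + (t * (vs k * sin (\<theta> k - \<phi>)))\<^sup>2"
      by (simp add: d_def mult.assoc rot cmod_power2)
    also have "\<dots> = 1 - 2 * t * (vs k * cos (\<theta> k - \<phi>)) + t\<^sup>2 * (vs k)\<^sup>2"
    proof -
      have "(1 - t * (r * x))\<^sup>2 + (t * (r * y))\<^sup>2 = 1 - 2 * t * (r * x) + t\<^sup>2 * r\<^sup>2 * (x\<^sup>2 + y\<^sup>2)"
        for r x y :: real by (simp add: power2_eq_square algebra_simps)
      then show ?thesis by simp
    qed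
    also have "\<dots> \<le> 1 - 2 * t * (vm * C) + t\<^sup>2 * vM\<^sup>2"
    proof -
      have "vm * C \<le> vs k * cos (\<theta> k - \<phi>)"
        using vmM(1) vmM(3)[of k] cos_ge[of k] \<open>C \<ge> 0\<close> by (intro mult_mono) auto
      then have "2 * t * (vm * C) \<le> 2 * t * (vs k * cos (\<theta> k - \<phi>))"
        using \<open>t \<ge> 0\<close> by (intro mult_left_mono) auto
      moreover have "t\<^sup>2 * (vs k)\<^sup>2 \<le> t\<^sup>2 * vM\<^sup>2"
        using vmM(4)[of k] vs_pos[of k] by (intro mult_left_mono power_mono) auto
      ultimately show ?thesis by linarith
    qed
    also have "\<dots> = 1 - C\<^sup>2 * (vm\<^sup>2 / vM\<^sup>2)"
      using vmM(2) by (simp add: t_def power2_eq_square field_simps)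
    finally show ?thesis unfolding C2 coherence_def vm_def vM_def .
  qed
  \<comment> \<open>Orthogonality to the set-points allows the all-ones vector to be replaced by the
    short vector d before Cauchy-Schwarz is applied.\<close>
  have "(\<Sum>k\<in>UNIV. cnj (d k) * phasor (proj v) k) =
      (\<Sum>k\<in>UNIV. phasor (proj v) k) -
        complex_of_real t * cnj (cis (- \<phi>)) * (\<Sum>k\<in>UNIV. cnj (setpoint k) * phasor (proj v) k)"
    by (simp add: d_def left_diff_distrib sum_subtractf sum_distrib_left mult.assoc)
  then have "norm (\<Sum>k\<in>UNIV. phasor (proj v) k) = norm (\<Sum>k\<in>UNIV. cnj (d k) * phasor (proj v) k)"
    by (simp add: proj_orthogonal)
  also have "\<dots> \<le> (\<Sum>k\<in>UNIV. norm (d k) * norm (phasor (proj v) k))"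
    by (rule order_trans[OF norm_sum]) (simp add: norm_mult)
  finally have "(norm (\<Sum>k\<in>UNIV. phasor (proj v) k))\<^sup>2 \<le> (\<Sum>k\<in>UNIV. norm (d k) * norm (phasor (proj v) k))\<^sup>2"
    by (rule power_mono) simp
  also have "\<dots> \<le> (\<Sum>k\<in>UNIV. (norm (d k))\<^sup>2) * (\<Sum>k\<in>UNIV. (norm (phasor (proj v) k))\<^sup>2)"
    by (rule Cauchy_Schwarz_ineq_sum)
  also have "\<dots> \<le> (CARD('n) * (1 - coherence)) * (\<Sum>k\<in>UNIV. (norm (phasor (proj v) k))\<^sup>2)"
    using sum_mono[of UNIV "\<lambda>k. (norm (d k))\<^sup>2" "\<lambda>_. 1 - coherence"] d_le
    by (intro mult_right_mono sum_nonneg) auto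
  finally show ?thesis by (simp add: norm_phasor)
qed

lemma margin_coherence:
  "(\<Sum>j\<in>nbrs G k. weight G (line G j k) * \<bar>1 - vs j / vs k * cos (rel_angle \<theta> j k)\<bar>) + \<alpha> + c
    < coherence * lambda2 (laplacian G)"
  using margin[of k] by (simp add: coherence_def)

text \<open>The left side of the margin condition is positive, so the condition itself forces a
  positive spectral gap.\<close>

lemma lambda2_pos: "lambda2 (laplacian G) > 0"
proof -
  have "0 \<le> (\<Sum>j\<in>nbrs G k. weight G (line G j k) * \<bar>1 - vs j / vs k * cos (rel_angle \<theta> j k)\<bar>)" for k
    using weight_pos by (intro sum_nonneg mult_nonneg_nonneg) (auto intro: less_imp_le)
  from this[of ref] have "0 < coherence * lambda2 (laplacian G)"
    using margin_coherence[of ref] \<alpha>_pos c_pos by linarith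
  moreover have "0 \<le> coherence"
    unfolding coherence_def using cos_ge_zero[of \<theta>bar] \<theta>bar by (intro mult_nonneg_nonneg) auto
  ultimately show ?thesis by (simp add: zero_less_mult_iff)
qed

text \<open>The real part of each node gain is at most \<open>coherence\<close> times the gap minus
  c + \<alpha>, while \<open>calL\<close> contributes at least \<open>coherence\<close> times the
  gap on vectors orthogonal to the set-points. The share \<alpha> is reserved for the restoring
  force.\<close>

lemma mismatch_decay: "proj v \<bullet> (mismatch *v v) \<le> - (c + \<alpha>) * (norm (proj v))\<^sup>2"
proof -
  define y where "y = proj v"
  define l2 where "l2 = lambda2 (laplacian G)"
  have Re_gain: "Re (node_gain k) \<le> coherence * l2 - (c + \<alpha>)" for k
  proof -
    have "Re (node_gain k) = (\<Sum>j\<in>nbrs G k. weight G (line G j k) * (1 - vs j / vs k * cos (rel_angle \<theta> j k)))"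
      by (simp add: node_gain_eq)
    also have "\<dots> \<le> (\<Sum>j\<in>nbrs G k. weight G (line G j k) * \<bar>1 - vs j / vs k * cos (rel_angle \<theta> j k)\<bar>)"
      using weight_pos by (intro sum_mono mult_left_mono) (auto intro: less_imp_le)
    finally show ?thesis using margin_coherence[of k] by (simp add: l2_def)
  qed
  have "y \<bullet> (calK G \<rho> ps qs vs *v y) = (\<Sum>k\<in>UNIV. Re (node_gain k) * (norm (phasor y k))\<^sup>2)"
    unfolding cmod_power2
    by (simp add: inner_phasor phasor_calK inner_complex_def power2_eq_square algebra_simps)
  also have "\<dots> \<le> (\<Sum>k\<in>UNIV. (coherence * l2 - (c + \<alpha>)) * (norm (phasor y k))\<^sup>2)"
    using Re_gain by (intro sum_mono mult_right_mono) auto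
  also have "\<dots> = (coherence * l2 - (c + \<alpha>)) * (norm y)\<^sup>2"
    by (simp add: norm_phasor sum_distrib_left)
  finally have 1: "y \<bullet> (calK G \<rho> ps qs vs *v y) \<le> (coherence * l2 - (c + \<alpha>)) * (norm y)\<^sup>2" .
  have "(norm (\<Sum>k\<in>UNIV. phasor y k))\<^sup>2 / CARD('n) \<le> (1 - coherence) * (norm y)\<^sup>2"
    using proj_mean_bound[of v] by (simp add: y_def field_simps)
  then have "l2 * (coherence * (norm y)\<^sup>2) \<le> l2 * ((norm y)\<^sup>2 - (norm (\<Sum>k\<in>UNIV. phasor y k))\<^sup>2 / CARD('n))"
    using lambda2_pos by (intro mult_left_mono) (auto simp: l2_def algebra_simps)
  also have "\<dots> \<le> y \<bullet> (calL G *v y)"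
    unfolding l2_def by (rule calL_spectral_gap)
  finally have "y \<bullet> (mismatch *v y) \<le> - (c + \<alpha>) * (norm y)\<^sup>2"
    using 1 by (simp add: mismatch_def matrix_vector_mult_diff_rdistrib inner_diff_right algebra_simps)
  then show ?thesis by (simp add: y_def mismatch_proj[of v])
qed

text \<open>Decay at rate at least c cannot exceed the operator norm, provided some vector has a
  nonzero projection. The inequality is what \<open>lyapunov_quadratic_bound\<close> asks of c and
  m.\<close>

lemma c_le_mismatch: "c \<le> mat_norm mismatch"
proof -
  \<comment> \<open>Index types are nonempty: a line exists, and with it two distinct nodes, so a
    vector supported on one node is not synchronous.\<close>
  obtain l :: 'm where True by simp
  define i j where "i = src G l" and "j = dst G l"
  have "i \<noteq> j" using src_neq_dst[of l] by (simp add: i_def j_def)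
  define v where "v = of_phasors (\<lambda>k. if k = i then 1 else 0)"
  have "proj v \<noteq> 0"
  proof
    assume "proj v = 0"
    then have "v = sync (amplitude v)" by (simp add: proj_def)
    then have "phasor v k = setpoint k * amplitude v" for k
      using phasor_sync by metis
    from this[of i] this[of j] show False
      using setpoint_nonzero[of j] \<open>i \<noteq> j\<close> by (simp add: v_def)
  qed
  then have n: "norm (proj v) > 0" by simp
  have "(c + \<alpha>) * (norm (proj v))\<^sup>2 \<le> - (proj v \<bullet> (mismatch *v v))"
    using mismatch_decay[of v] unfolding mult_minus_left by linarith
  also have "\<dots> \<le> norm (proj v) * norm (mismatch *v v)"
    using Cauchy_Schwarz_ineq2[of "proj v" "mismatch *v v"] by linarith
  also have "\<dots> \<le> norm (proj v) * (mat_norm mismatch * norm (proj v))"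
    by (intro mult_left_mono norm_mismatch_le) auto
  finally have "(c + \<alpha>) * (norm (proj v))\<^sup>2 \<le> mat_norm mismatch * (norm (proj v))\<^sup>2"
    by (simp add: power2_eq_square ac_simps)
  then show ?thesis using n \<alpha>_pos by simp
qed

lemma calY_norm_pos: "mat_norm (calY G) > 0"
proof -
  \<comment> \<open>If the norm were 0, the quotient in the gain condition would be a division by
    zero with value 0, against \<eta> > 0.\<close>
  have "mat_norm (calY G) \<noteq> 0" using gain \<eta>_pos by auto
  with mat_norm_nonneg[of "calY G"] show ?thesis by simp
qed

lemma gain_bound: "\<eta> * (\<rho> * mat_norm (calY G) * (c + 5 * mat_norm mismatch)) < c"
proof -
  have "\<rho> * mat_norm (calY G) * (c + 5 * mat_norm mismatch) > 0"
    using calY_norm_pos \<rho>_pos c_pos mat_norm_nonneg[of mismatch]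
    by (intro mult_pos_pos add_pos_nonneg) auto
  with gain show ?thesis by (simp add: mismatch_def pos_less_divide_eq)
qed

section \<open>The amplitude-restoring force\<close>

lemma phasor_Phi: "phasor (Phi vs v *v w) k = (((vs k)\<^sup>2 - (norm (phasor v k))\<^sup>2) / (vs k)\<^sup>2) *\<^sub>R phasor w k"
proof -
  have "((((vs k)\<^sup>2 - (norm (block v k))\<^sup>2) / (vs k)\<^sup>2) *\<^sub>R mat 1 :: real^2^2) $ a $ b
      = vector [vector [Re (complex_of_real (((vs k)\<^sup>2 - (norm (phasor v k))\<^sup>2) / (vs k)\<^sup>2)),
          - Im (complex_of_real (((vs k)\<^sup>2 - (norm (phasor v k))\<^sup>2) / (vs k)\<^sup>2))],
        vector [Im (complex_of_real (((vs k)\<^sup>2 - (norm (phasor v k))\<^sup>2) / (vs k)\<^sup>2)),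
          Re (complex_of_real (((vs k)\<^sup>2 - (norm (phasor v k))\<^sup>2) / (vs k)\<^sup>2))]] $ a $ b" for k and a b :: 2
    using exhaust_2[of a] exhaust_2[of b] by (auto simp: mat_def vector_2 norm_block)
  then have "phasor (Phi vs v *v w) k
      = complex_of_real (((vs k)\<^sup>2 - (norm (phasor v k))\<^sup>2) / (vs k)\<^sup>2) * phasor w k"
    unfolding Phi_def by (intro phasor_blockdiag) (simp add: vec_eq_iff)
  then show ?thesis by (simp add: scaleR_conv_of_real)
qed

definition restoring :: "real^('n \<times> 2) \<Rightarrow> real^('n \<times> 2)" where
  "restoring v = Phi vs v *v v"

definition cubic :: "real^('n \<times> 2) \<Rightarrow> real^('n \<times> 2)" where
  "cubic v = of_phasors (\<lambda>k. ((norm (phasor v k))\<^sup>2 / (vs k)\<^sup>2) *\<^sub>R phasor v k)"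

lemma phasor_cubic [simp]: "phasor (cubic v) k = ((norm (phasor v k))\<^sup>2 / (vs k)\<^sup>2) *\<^sub>R phasor v k"
  by (simp add: cubic_def)

lemma restoring_eq: "restoring v = v - cubic v"
  by (rule phasor_eqI) (use vs_pos in \<open>simp add: restoring_def phasor_Phi diff_divide_distrib
      scaleR_diff_left less_imp_neq[THEN not_sym]\<close>)

text \<open>In the coordinates \<open>v = s (u + z)\<close> the cubic term is the gradient of a convex function of
  \<open>u\<close> up to a shift that is orthogonal to \<open>P v\<close>.\<close>

lemma proj_inner_cubic: "0 \<le> proj v \<bullet> cubic v"
proof -
  define z where "z = amplitude v"
  define a where "a = (\<lambda>k. phasor v k / setpoint k)"
  have v: "phasor v k = setpoint k * a k" for k
    using setpoint_nonzero[of k] by (simp add: a_def)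
  have y: "phasor (proj v) k = setpoint k * (a k - z)" for k
    by (simp add: proj_def v z_def right_diff_distrib)
  have mult_inner: "(setpoint k * x) \<bullet> (setpoint k * y) = (vs k)\<^sup>2 * (x \<bullet> y)" for k x y
  proof -
    have "(setpoint k * x) \<bullet> (setpoint k * y) = Re (cnj (setpoint k) * setpoint k * (cnj x * y))"
      by (simp add: inner_complex_def algebra_simps)
    also have "\<dots> = (vs k)\<^sup>2 * (x \<bullet> y)"
      unfolding cnj_setpoint_mult by (simp add: inner_complex_def)
    finally show ?thesis .
  qed
  have cub: "phasor (cubic v) k = setpoint k * ((norm (a k))\<^sup>2 *\<^sub>R a k)" for k
    using vs_pos[of k] by (simp add: v norm_mult power_mult_distrib)
  have "proj v \<bullet> cubic v = proj v \<bullet> cubic v - proj v \<bullet> sync ((norm z)\<^sup>2 *\<^sub>R z)"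
    by (simp add: proj_inner_sync)
  also have "\<dots> = (\<Sum>k\<in>UNIV. (vs k)\<^sup>2 * ((a k - z) \<bullet> ((norm (a k))\<^sup>2 *\<^sub>R a k - (norm z)\<^sup>2 *\<^sub>R z)))"
    unfolding inner_phasor y cub phasor_sync mult_inner
    by (simp only: sum_subtractf[symmetric] right_diff_distrib[symmetric] inner_diff_right[symmetric])
  also have "\<dots> \<ge> 0"
    by (intro sum_nonneg mult_nonneg_nonneg inner_cubic_mono) auto
  finally show ?thesis .
qed

lemma inner_proj_self: "proj v \<bullet> v = (norm (proj v))\<^sup>2"
  by (simp add: power2_norm_eq_inner inner_proj_proj)

lemma proj_inner_restoring: "proj v \<bullet> restoring v \<le> (norm (proj v))\<^sup>2"
  using proj_inner_cubic[of v] by (simp add: restoring_eq inner_diff_right inner_proj_self)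

lemma cubic_lipschitz_ball:
  assumes "norm v \<le> r" "norm w \<le> r"
  shows "norm (cubic v - cubic w) \<le> 3 * r\<^sup>2 / (Min (range vs))\<^sup>2 * norm (v - w)"
proof (rule power2_le_imp_le)
  define m where "m = Min (range vs)"
  have m: "m > 0" "\<And>k. m \<le> vs k" using vs_bounds by (auto simp: m_def)
  have comp: "norm (phasor (cubic v - cubic w) k) \<le> 3 * r\<^sup>2 / m\<^sup>2 * norm (phasor (v - w) k)" for k
  proof -
    let ?d = "(norm (phasor v k))\<^sup>2 *\<^sub>R phasor v k - (norm (phasor w k))\<^sup>2 *\<^sub>R phasor w k"
    have "norm (phasor (cubic v - cubic w) k) = norm ((1 / (vs k)\<^sup>2) *\<^sub>R ?d)"
      by (simp add: scaleR_diff_right)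
    also have "\<dots> = 1 / (vs k)\<^sup>2 * norm ?d" by (simp add: norm_scaleR)
    also have "\<dots> \<le> 1 / m\<^sup>2 * (3 * r\<^sup>2 * norm (phasor v k - phasor w k))"
      using assms norm_phasor_le[of v k] norm_phasor_le[of w k] m(1) m(2)[of k]
      by (intro mult_mono cubic_lipschitz frac_le power_mono) auto
    finally show ?thesis by simp
  qed
  have "(norm (cubic v - cubic w))\<^sup>2 \<le> (\<Sum>k\<in>UNIV. (3 * r\<^sup>2 / m\<^sup>2 * norm (phasor (v - w) k))\<^sup>2)"
    unfolding norm_phasor[of "cubic v - cubic w"] by (intro sum_mono power_mono comp) auto
  also have "\<dots> = (3 * r\<^sup>2 / m\<^sup>2 * norm (v - w))\<^sup>2"
    by (simp only: power_mult_distrib norm_phasor[of "v - w"] sum_distrib_left)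
  finally show "(norm (cubic v - cubic w))\<^sup>2 \<le> (3 * r\<^sup>2 / (Min (range vs))\<^sup>2 * norm (v - w))\<^sup>2"
    by (simp add: m_def)
qed (use assms in auto)

end

section \<open>The closed loop\<close>

context inverter_network
begin

definition node_current :: "real^('m \<times> 2) \<Rightarrow> real^('n \<times> 2)" where
  "node_current i = (calR G \<rho> ** calB G) *v i"

definition deviation :: "real^('n \<times> 2 + 'm \<times> 2) \<Rightarrow> real^('m \<times> 2)" where
  "deviation x = current x - steady_current G (voltage x)"

definition line_rate :: "real^('n \<times> 2 + 'm \<times> 2) \<Rightarrow> real^('m \<times> 2)" where
  "line_rate x = matrix_inv (L_T G) *v (- (Z_T G *v current x) + transpose (calB G) *v voltage x)"

text \<open>The force is a separate argument so that the closed loop and its linearisation at the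
  origin are two instances of one field.\<close>

definition forced_field :: "real^('n \<times> 2) \<Rightarrow> real^('n \<times> 2 + 'm \<times> 2) \<Rightarrow> real^('n \<times> 2 + 'm \<times> 2)" where
  "forced_field \<phi> x = pair_state
     (\<eta> *\<^sub>R (mismatch *v voltage x - node_current (deviation x) + \<alpha> *\<^sub>R \<phi>)) (line_rate x)"

lemma steady_current_linear [simp]: "steady_current G (v + w) = steady_current G v + steady_current G w"
  "steady_current G (v - w) = steady_current G v - steady_current G w"
  "steady_current G (a *\<^sub>R v) = a *\<^sub>R steady_current G v"
  unfolding steady_current_def
  by (simp_all only: matrix_vector_right_distrib matrix_vector_mult_diff_distrib matrix_vector_mult_scaleR)

lemma bounded_linear_steady_current: "bounded_linear (steady_current G)"
  by (auto simp: linear_conv_bounded_linear[symmetric] intro!: linearI)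

lemma node_current_linear [simp]: "node_current (i + j) = node_current i + node_current j"
  "node_current (i - j) = node_current i - node_current j" "node_current (a *\<^sub>R i) = a *\<^sub>R node_current i"
  "node_current 0 = 0"
  unfolding node_current_def
  by (simp_all only: matrix_vector_right_distrib matrix_vector_mult_diff_distrib matrix_vector_mult_scaleR
      matrix_vector_mult_0_right)

lemma deviation_linear [simp]: "deviation (x + y) = deviation x + deviation y"
  "deviation (x - y) = deviation x - deviation y" "deviation (a *\<^sub>R x) = a *\<^sub>R deviation x"
  by (simp_all add: deviation_def scaleR_diff_right)

lemma proj_linear [simp]: "proj (v + w) = proj v + proj w" "proj (v - w) = proj v - proj w"
  "proj (a *\<^sub>R v) = a *\<^sub>R proj v" "proj 0 = 0"
  using linear_proj by (simp_all add: linear_add linear_diff linear_scale linear_0)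

lemma line_rate_linear: "line_rate (x + y) = line_rate x + line_rate y"
  "line_rate (a *\<^sub>R x) = a *\<^sub>R line_rate x"
  by (simp_all only: line_rate_def voltage_linear_simps current_linear_simps matrix_vector_right_distrib
      matrix_vector_mult_scaleR scaleR_add_right[symmetric] scaleR_minus_right[symmetric] minus_add_distrib
      add_ac)

lemma node_current_steady: "node_current (steady_current G v) = calL G *v v"
  unfolding node_current_def by (rule calR_calB_steady_current)

lemma closed_loop_eq:
  "closed_loop G \<rho> ps qs vs \<alpha> \<eta> x = forced_field (restoring (voltage x)) x"
proof -
  have "mismatch *v voltage x - node_current (deviation x)
      = calK G \<rho> ps qs vs *v voltage x - node_current (current x)"
    by (simp add: mismatch_def matrix_vector_mult_diff_rdistrib deviation_def node_current_steady)
  then show ?thesis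
    by (simp add: closed_loop_def Let_def forced_field_def restoring_def line_rate_def node_current_def)
qed

text \<open>Impedance over inductance is the same complex number on every line, by the uniform
  ratio.\<close>

lemma phasor_line_rate:
  "phasor (line_rate x) l = - Complex (1 / \<rho>) (freq G) * phasor (deviation x) l"
proof -
  have "phasor (transpose (calB G) *v voltage x) l = impedance l * phasor (steady_current G (voltage x)) l"
    using impedance_nonzero[of l] by (simp only: phasor_calB_transpose phasor_steady_current) simp
  then have "phasor (line_rate x) l = - (impedance l / complex_of_real (ind G l)) * phasor (deviation x) l"
    using ind_pos[of l]
    by (simp only: line_rate_def phasor_L_T_inv phasor_add phasor_minus phasor_Z_T deviation_def phasor_diff)
      (simp add: field_simps)
  also have "impedance l / complex_of_real (ind G l) = Complex (1 / \<rho>) (freq G)"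
    using ind_pos[of l] res_pos[of l] \<rho>_pos
    by (simp add: impedance_def complex_eq_iff Re_divide_of_real Im_divide_of_real) (simp add: ind_eq)
  finally show ?thesis .
qed

lemma inner_decay_rotation: "z \<bullet> (- Complex a b * z) = - a * (norm z)\<^sup>2"
  unfolding cmod_power2 by (simp add: inner_complex_def power2_eq_square algebra_simps)

lemma deviation_inner_line_rate: "deviation x \<bullet> line_rate x = - (norm (deviation x))\<^sup>2 / \<rho>"
  unfolding inner_phasor phasor_line_rate inner_decay_rotation
  by (simp add: norm_phasor sum_divide_distrib sum_negf)

text \<open>A scalar rate common to all lines passes through the incidence sum, so the nodal image
  decays like the deviation itself.\<close>

lemma node_current_inner_line_rate:
  "node_current (deviation x) \<bullet> node_current (line_rate x) = - (norm (node_current (deviation x)))\<^sup>2 / \<rho>"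
proof -
  have "phasor (node_current (line_rate x)) k
      = - Complex (1 / \<rho>) (freq G) * phasor (node_current (deviation x)) k" for k
    unfolding node_current_def phasor_calR_calB phasor_line_rate sum_distrib_left
    by (rule sum.cong) (simp_all add: scaleR_conv_of_real[where 'a = complex] ac_simps)
  then show ?thesis
    unfolding inner_phasor
    by (simp only: inner_decay_rotation) (simp add: norm_phasor sum_divide_distrib sum_negf)
qed

section \<open>The energy, its derivative and the linearisation\<close>

definition penalty :: real where
  "penalty = c / (mat_norm mismatch)\<^sup>2 * \<alpha>"

definition node_weight :: real where
  "node_weight = 1 / (mat_norm mismatch * mat_norm (calY G))"

lemma penalty_pos: "penalty > 0" and node_weight_pos: "node_weight > 0"
  using c_pos c_le_mismatch \<alpha>_pos calY_norm_pos by (simp_all add: penalty_def node_weight_def)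

text \<open>The deviation changes by the line rate minus the steady current of the voltage rate; at
  the nodes the latter becomes \<open>calL\<close> applied to that rate, which supplies the drive
  terms of \<open>lyapunov_decay_rate\<close>.\<close>

lemma decay_rate:
  obtains \<delta> \<sigma> where "\<delta> > 0" "\<sigma> > 0"
    "\<And>x \<phi>. proj (voltage x) \<bullet> \<phi> \<le> (norm (proj (voltage x)))\<^sup>2 \<Longrightarrow>
      proj (voltage x) \<bullet> voltage (forced_field \<phi> x) - penalty * (\<phi> \<bullet> voltage (forced_field \<phi> x))
        + node_weight * (node_current (deviation x) \<bullet> node_current (deviation (forced_field \<phi> x)))
        + \<delta> * (deviation x \<bullet> deviation (forced_field \<phi> x))
      \<le> - \<sigma> * ((norm (proj (voltage x)))\<^sup>2 + (norm \<phi>)\<^sup>2 + (norm (deviation x))\<^sup>2)"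
proof -
  have \<tau>: "onorm (steady_current G) \<ge> 0"
    by (rule onorm_pos_le[OF bounded_linear_steady_current])
  obtain \<delta> \<sigma> where ds: "\<delta> > 0" "\<sigma> > 0" and decay:
    "\<And>(y :: real^('n \<times> 2)) \<phi> g b v' h b' (e :: real^('m \<times> 2)) k e'.
      v' = \<eta> *\<^sub>R (g - b + \<alpha> *\<^sub>R \<phi>) \<Longrightarrow>
      y \<bullet> g \<le> - (c + \<alpha>) * (norm y)\<^sup>2 \<Longrightarrow> y \<bullet> \<phi> \<le> (norm y)\<^sup>2 \<Longrightarrow> norm g \<le> mat_norm mismatch * norm y \<Longrightarrow>
      b \<bullet> b' = - (norm b)\<^sup>2 / \<rho> - b \<bullet> h \<Longrightarrow> norm h \<le> mat_norm (calY G) * norm v' \<Longrightarrow>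
      e \<bullet> e' = - (norm e)\<^sup>2 / \<rho> - e \<bullet> k \<Longrightarrow> norm k \<le> onorm (steady_current G) * norm v' \<Longrightarrow>
      y \<bullet> v' - c / (mat_norm mismatch)\<^sup>2 * \<alpha> * (\<phi> \<bullet> v')
          + 1 / (mat_norm mismatch * mat_norm (calY G)) * (b \<bullet> b') + \<delta> * (e \<bullet> e')
        \<le> - \<sigma> * ((norm y)\<^sup>2 + (norm \<phi>)\<^sup>2 + (norm e)\<^sup>2)"
    by (rule lyapunov_decay_rate[OF c_pos c_le_mismatch \<eta>_pos \<rho>_pos calY_norm_pos \<tau> \<alpha>_pos gain_bound])
      (rule that)
  show ?thesis
  proof (rule that[OF ds], goal_cases)
    case (1 x \<phi>)
    define v' where "v' = voltage (forced_field \<phi> x)"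
    have v': "v' = \<eta> *\<^sub>R (mismatch *v voltage x - node_current (deviation x) + \<alpha> *\<^sub>R \<phi>)"
      by (simp add: v'_def forced_field_def)
    have dev: "deviation (forced_field \<phi> x) = line_rate x - steady_current G v'"
      by (simp add: deviation_def v'_def) (simp add: forced_field_def)
    show ?case
      unfolding penalty_def node_weight_def v'_def[symmetric]
    proof (rule decay[where g = "mismatch *v voltage x" and h = "calL G *v v'" and k = "steady_current G v'"])
      show "node_current (deviation x) \<bullet> node_current (deviation (forced_field \<phi> x))
          = - (norm (node_current (deviation x)))\<^sup>2 / \<rho> - node_current (deviation x) \<bullet> (calL G *v v')"
        by (simp add: dev node_current_steady inner_diff_right node_current_inner_line_rate)
      show "deviation x \<bullet> deviation (forced_field \<phi> x)
          = - (norm (deviation x))\<^sup>2 / \<rho> - deviation x \<bullet> steady_current G v'"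
        by (simp add: dev inner_diff_right deviation_inner_line_rate)
      show "norm (steady_current G v') \<le> onorm (steady_current G) * norm v'"
        by (rule onorm[OF bounded_linear_steady_current])
    qed (use v' 1 in \<open>auto simp only: mismatch_decay norm_mismatch_le norm_calL_le\<close>)
  qed
qed

text \<open>A potential of the restoring force. Squared norms are written as inner products, which
  are differentiable also where a phasor vanishes.\<close>

definition quartic :: "real^('n \<times> 2) \<Rightarrow> real" where
  "quartic v = (\<Sum>k\<in>UNIV. ((vs k)\<^sup>2 - phasor v k \<bullet> phasor v k)\<^sup>2 / (4 * (vs k)\<^sup>2))"

definition energy :: "real \<Rightarrow> real^('n \<times> 2 + 'm \<times> 2) \<Rightarrow> real" where
  "energy \<delta> x = 1 / 2 * (proj (voltage x) \<bullet> proj (voltage x)) + penalty * quartic (voltage x)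
     + node_weight / 2 * (node_current (deviation x) \<bullet> node_current (deviation x))
     + \<delta> / 2 * (deviation x \<bullet> deviation x)"

definition energy_derivative ::
    "real \<Rightarrow> real^('n \<times> 2 + 'm \<times> 2) \<Rightarrow> real^('n \<times> 2 + 'm \<times> 2) \<Rightarrow> real" where
  "energy_derivative \<delta> x h = proj (voltage x) \<bullet> voltage h - penalty * (restoring (voltage x) \<bullet> voltage h)
     + node_weight * (node_current (deviation x) \<bullet> node_current (deviation h))
     + \<delta> * (deviation x \<bullet> deviation h)"

definition dissipation :: "real^('n \<times> 2 + 'm \<times> 2) \<Rightarrow> real" where
  "dissipation x = (norm (proj (voltage x)))\<^sup>2 + (norm (restoring (voltage x)))\<^sup>2 + (norm (deviation x))\<^sup>2"

text \<open>Minus the Hessian of the energy at the origin.\<close>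

definition instability_form ::
    "real \<Rightarrow> real^('n \<times> 2 + 'm \<times> 2) \<Rightarrow> real^('n \<times> 2 + 'm \<times> 2) \<Rightarrow> real" where
  "instability_form \<delta> x y = penalty * (voltage x \<bullet> voltage y) - proj (voltage x) \<bullet> proj (voltage y)
     - node_weight * (node_current (deviation x) \<bullet> node_current (deviation y))
     - \<delta> * (deviation x \<bullet> deviation y)"

definition linearization :: "real^('n \<times> 2 + 'm \<times> 2) \<Rightarrow> real^('n \<times> 2 + 'm \<times> 2)" where
  "linearization x = forced_field (voltage x) x"

definition cubic_field :: "real^('n \<times> 2 + 'm \<times> 2) \<Rightarrow> real^('n \<times> 2 + 'm \<times> 2)" where
  "cubic_field x = pair_state ((\<eta> * \<alpha>) *\<^sub>R cubic (voltage x)) 0"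

lemma linearization_linear: "linear linearization"
proof (rule linearI; rule state_eqI)
  fix x y a
  show "voltage (linearization (x + y)) = voltage (linearization x + linearization y)"
    and "voltage (linearization (a *\<^sub>R x)) = voltage (a *\<^sub>R linearization x)"
    by (simp_all add: linearization_def forced_field_def matrix_vector_right_distrib
        matrix_vector_mult_scaleR algebra_simps)
  show "current (linearization (x + y)) = current (linearization x + linearization y)"
    and "current (linearization (a *\<^sub>R x)) = current (a *\<^sub>R linearization x)"
    by (simp_all add: linearization_def forced_field_def line_rate_linear)
qed

lemma bounded_linear_linearization: "bounded_linear linearization"
  using linearization_linear by (simp add: linear_conv_bounded_linear)

lemma closed_loop_split:
  "closed_loop G \<rho> ps qs vs \<alpha> \<eta> x = linearization x - cubic_field x"
  by (rule state_eqI)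
    (simp_all add: closed_loop_eq linearization_def cubic_field_def forced_field_def restoring_eq algebra_simps)

text \<open>The factor r^2 serves three times: local Lipschitz continuity of the field, its
  derivative at the origin, and smallness of the remainder in a small ball.\<close>

lemma cubic_field_lipschitz:
  obtains C where "C > 0"
    "\<And>r x y. norm x \<le> r \<Longrightarrow> norm y \<le> r \<Longrightarrow> norm (cubic_field x - cubic_field y) \<le> C * r\<^sup>2 * norm (x - y)"
proof -
  define C where "C = \<eta> * \<alpha> * (3 / (Min (range vs))\<^sup>2)"
  have "C > 0" unfolding C_def using \<eta>_pos \<alpha>_pos vs_bounds(1)
    by (intro mult_pos_pos divide_pos_pos zero_less_power) auto
  moreover have "norm (cubic_field x - cubic_field y) \<le> C * r\<^sup>2 * norm (x - y)"
    if "norm x \<le> r" "norm y \<le> r" for r x y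
  proof -
    have "cubic_field x - cubic_field y = pair_state ((\<eta> * \<alpha>) *\<^sub>R (cubic (voltage x) - cubic (voltage y))) 0"
      by (rule state_eqI) (simp_all add: cubic_field_def scaleR_diff_right)
    then have "norm (cubic_field x - cubic_field y) = \<eta> * \<alpha> * norm (cubic (voltage x) - cubic (voltage y))"
      using \<eta>_pos \<alpha>_pos by (simp add: norm_pair_state_0)
    also have "\<dots> \<le> \<eta> * \<alpha> * (3 * r\<^sup>2 / (Min (range vs))\<^sup>2 * norm (voltage x - voltage y))"
      using \<eta>_pos \<alpha>_pos that norm_voltage_le[of x] norm_voltage_le[of y]
      by (intro mult_left_mono cubic_lipschitz_ball) auto
    also have "\<dots> = C * r\<^sup>2 * norm (voltage (x - y))" by (simp add: C_def)
    also have "\<dots> \<le> C * r\<^sup>2 * norm (x - y)"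
      using \<open>C > 0\<close> by (intro mult_left_mono norm_voltage_le) auto
    finally show ?thesis .
  qed
  ultimately show ?thesis by (rule that)
qed

lemma closed_loop_lipschitz: "\<exists>L. L-lipschitz_on (cball 0 r) (closed_loop G \<rho> ps qs vs \<alpha> \<eta>)"
proof -
  obtain C where C: "C > 0"
    "\<And>r x y. norm x \<le> r \<Longrightarrow> norm y \<le> r \<Longrightarrow> norm (cubic_field x - cubic_field y) \<le> C * r\<^sup>2 * norm (x - y)"
    by (rule cubic_field_lipschitz) blast
  obtain K where K: "K > 0" "\<And>x. norm (linearization x) \<le> norm x * K"
    using bounded_linear.pos_bounded[OF bounded_linear_linearization] by blast
  have "(K + C * r\<^sup>2)-lipschitz_on (cball 0 r) (closed_loop G \<rho> ps qs vs \<alpha> \<eta>)"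
  proof (rule lipschitz_onI)
    fix x y :: "real^('n \<times> 2 + 'm \<times> 2)" assume xy: "x \<in> cball 0 r" "y \<in> cball 0 r"
    have "closed_loop G \<rho> ps qs vs \<alpha> \<eta> x - closed_loop G \<rho> ps qs vs \<alpha> \<eta> y
        = linearization (x - y) - (cubic_field x - cubic_field y)"
      by (simp add: closed_loop_split linear_diff[OF linearization_linear])
    then have "norm (closed_loop G \<rho> ps qs vs \<alpha> \<eta> x - closed_loop G \<rho> ps qs vs \<alpha> \<eta> y)
        \<le> norm (linearization (x - y)) + norm (cubic_field x - cubic_field y)"
      by (metis norm_triangle_ineq4)
    also have "\<dots> \<le> norm (x - y) * K + C * r\<^sup>2 * norm (x - y)"
      using xy by (intro add_mono K(2) C(2)) auto
    finally show "dist (closed_loop G \<rho> ps qs vs \<alpha> \<eta> x) (closed_loop G \<rho> ps qs vs \<alpha> \<eta> y)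
        \<le> (K + C * r\<^sup>2) * dist x y" by (simp add: dist_norm algebra_simps)
  qed (use K(1) C(1) in auto)
  then show ?thesis by blast
qed

lemma bounded_linear_phasor: "bounded_linear (\<lambda>v. phasor v k)"
  by (auto simp: linear_conv_bounded_linear[symmetric] intro!: linearI)

lemma quartic_derivative: "(quartic has_derivative (\<lambda>h. - (restoring v \<bullet> h))) (at v)"
proof -
  have "(quartic has_derivative (\<lambda>h. \<Sum>k\<in>UNIV.
      - (((vs k)\<^sup>2 - phasor v k \<bullet> phasor v k) / (vs k)\<^sup>2 * (phasor v k \<bullet> phasor h k)))) (at v)"
    unfolding quartic_def[abs_def]
  proof (rule has_derivative_sum)
    fix k
    have p: "((\<lambda>v. phasor v k) has_derivative (\<lambda>h. phasor h k)) (at v)"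
      by (rule bounded_linear_imp_has_derivative[OF bounded_linear_phasor])
    show "((\<lambda>v. ((vs k)\<^sup>2 - phasor v k \<bullet> phasor v k)\<^sup>2 / (4 * (vs k)\<^sup>2)) has_derivative
        (\<lambda>h. - (((vs k)\<^sup>2 - phasor v k \<bullet> phasor v k) / (vs k)\<^sup>2 * (phasor v k \<bullet> phasor h k)))) (at v)"
      using vs_pos[of k]
      by (auto intro!: derivative_eq_intros p simp: fun_eq_iff inner_commute field_simps)
  qed
  also have "(\<lambda>h. \<Sum>k\<in>UNIV. - (((vs k)\<^sup>2 - phasor v k \<bullet> phasor v k) / (vs k)\<^sup>2 * (phasor v k \<bullet> phasor h k)))
      = (\<lambda>h. - (restoring v \<bullet> h))"
    by (simp add: fun_eq_iff inner_phasor restoring_def phasor_Phi sum_negf power2_norm_eq_inner)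
  finally show ?thesis .
qed

lemma bounded_linear_deviation: "bounded_linear deviation"
  and bounded_linear_node_deviation: "bounded_linear (\<lambda>x. node_current (deviation x))"
  and bounded_linear_proj_voltage: "bounded_linear (\<lambda>x. proj (voltage x))"
  by (auto simp: linear_conv_bounded_linear[symmetric] intro!: linearI)

lemma inner_self_derivative:
  assumes "bounded_linear g"
  shows "((\<lambda>x. g x \<bullet> g x) has_derivative (\<lambda>h. 2 * (g x \<bullet> g h))) (at x)"
  using has_derivative_inner[OF bounded_linear_imp_has_derivative[OF assms]
      bounded_linear_imp_has_derivative[OF assms], of x UNIV]
  by (simp add: inner_commute)

lemma energy_has_derivative: "(energy \<delta> has_derivative energy_derivative \<delta> x) (at x)"
proof -
  have "((\<lambda>x. quartic (voltage x)) has_derivative (\<lambda>h. - (restoring (voltage x) \<bullet> voltage h))) (at x)"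
    by (rule has_derivative_compose[OF bounded_linear_imp_has_derivative[OF bounded_linear_voltage]
          quartic_derivative])
  note parts = this inner_self_derivative[OF bounded_linear_proj_voltage]
    inner_self_derivative[OF bounded_linear_node_deviation] inner_self_derivative[OF bounded_linear_deviation]
  have "(energy \<delta> has_derivative (\<lambda>h. 1 / 2 * (2 * (proj (voltage x) \<bullet> proj (voltage h)))
      + penalty * - (restoring (voltage x) \<bullet> voltage h)
      + node_weight / 2 * (2 * (node_current (deviation x) \<bullet> node_current (deviation h)))
      + \<delta> / 2 * (2 * (deviation x \<bullet> deviation h)))) (at x)"
    unfolding energy_def[abs_def]
    by (intro has_derivative_add has_derivative_mult_right parts)
  then show ?thesis
    by (simp add: energy_derivative_def[abs_def] inner_proj_proj)
qed

lemma instability_form_bilinear: "bounded_bilinear (instability_form \<delta>)"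
  by (auto simp: bilinear_conv_bounded_bilinear[symmetric] bilinear_def instability_form_def
      inner_add_left inner_add_right algebra_simps intro!: linearI)

lemma instability_form_sym: "instability_form \<delta> x y = instability_form \<delta> y x"
  by (simp add: instability_form_def inner_commute)

section \<open>Sublevel sets and zeros of the energy\<close>

lemma energy_nonneg: "\<delta> > 0 \<Longrightarrow> energy \<delta> x \<ge> 0"
  unfolding energy_def quartic_def using penalty_pos node_weight_pos
  by (intro add_nonneg_nonneg mult_nonneg_nonneg sum_nonneg) (auto intro: less_imp_le)

lemma quartic_nonneg: "quartic v \<ge> 0"
  unfolding quartic_def by (intro sum_nonneg) auto

lemma energy_parts_bound:
  assumes "\<delta> > 0" "energy \<delta> x \<le> a"
  shows "(norm (proj (voltage x)))\<^sup>2 \<le> 2 * a" "penalty * quartic (voltage x) \<le> a"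
    "\<delta> * (norm (deviation x))\<^sup>2 \<le> 2 * a"
proof -
  have "0 \<le> penalty * quartic (voltage x)"
    using penalty_pos quartic_nonneg by (intro mult_nonneg_nonneg) auto
  moreover have "0 \<le> node_weight / 2 * (node_current (deviation x) \<bullet> node_current (deviation x))"
    using node_weight_pos by (intro mult_nonneg_nonneg) auto
  moreover have "0 \<le> \<delta> / 2 * (deviation x \<bullet> deviation x)"
    using assms by (intro mult_nonneg_nonneg) auto
  moreover have "0 \<le> proj (voltage x) \<bullet> proj (voltage x)" by simp
  ultimately show "(norm (proj (voltage x)))\<^sup>2 \<le> 2 * a" "penalty * quartic (voltage x) \<le> a"
    "\<delta> * (norm (deviation x))\<^sup>2 \<le> 2 * a"
    using assms(2) unfolding energy_def power2_norm_eq_inner by linarith+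
qed

lemma phasor_quartic_bound: "(norm (phasor v k))\<^sup>2 \<le> (vs k)\<^sup>2 + 4 * (vs k)\<^sup>2 * quartic v + 1"
proof -
  define d where "d = (vs k)\<^sup>2 - (norm (phasor v k))\<^sup>2"
  have "d\<^sup>2 / (4 * (vs k)\<^sup>2) \<le> quartic v"
    unfolding quartic_def d_def power2_norm_eq_inner by (rule member_le_sum) auto
  then have "d\<^sup>2 \<le> 4 * (vs k)\<^sup>2 * quartic v"
    using vs_pos[of k] by (simp add: field_simps)
  moreover have "- d \<le> d\<^sup>2 + 1"
  proof -
    have "0 \<le> (d + 1 / 2)\<^sup>2 + 3 / 4" by simp
    then show ?thesis by (simp add: power2_eq_square field_simps)
  qed
  ultimately show ?thesis by (simp add: d_def)
qed

text \<open>The quartic term bounds the whole voltage, including the synchronous directions that the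
  projection does not see; the deviation then bounds the current.\<close>

lemma energy_sublevel_bounded:
  assumes "\<delta> > 0"
  shows "bounded {x. energy \<delta> x \<le> a}"
proof -
  define V where "V = (\<Sum>k\<in>UNIV. (vs k)\<^sup>2 + 4 * (vs k)\<^sup>2 * (a / penalty) + 1)"
  define K where "K = onorm (steady_current G)"
  show ?thesis
  proof (rule boundedI)
    fix x assume "x \<in> {x. energy \<delta> x \<le> a}"
    then have x: "energy \<delta> x \<le> a" by simp
    have "quartic (voltage x) \<le> a / penalty"
      using energy_parts_bound(2)[OF assms x] penalty_pos by (simp add: field_simps)
    then have "(norm (phasor (voltage x) k))\<^sup>2 \<le> (vs k)\<^sup>2 + 4 * (vs k)\<^sup>2 * (a / penalty) + 1" for k
      using phasor_quartic_bound[of "voltage x" k]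
        mult_left_mono[of "quartic (voltage x)" "a / penalty" "4 * (vs k)\<^sup>2"] by simp
    then have "(norm (voltage x))\<^sup>2 \<le> V"
      unfolding norm_phasor V_def by (rule sum_mono)
    then have v: "norm (voltage x) \<le> sqrt V" by (rule real_le_rsqrt)
    have "(norm (deviation x))\<^sup>2 \<le> 2 * a / \<delta>"
      using energy_parts_bound(3)[OF assms x] assms by (simp add: field_simps)
    then have e: "norm (deviation x) \<le> sqrt (2 * a / \<delta>)" by (rule real_le_rsqrt)
    have K: "K \<ge> 0" "norm (steady_current G (voltage x)) \<le> K * norm (voltage x)"
      unfolding K_def using onorm[OF bounded_linear_steady_current] onorm_pos_le[OF bounded_linear_steady_current]
      by auto
    have "norm (current x) \<le> norm (deviation x) + norm (steady_current G (voltage x))"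
      using norm_triangle_ineq[of "deviation x" "steady_current G (voltage x)"] by (simp add: deviation_def)
    moreover have "K * norm (voltage x) \<le> K * sqrt V"
      using v K(1) by (intro mult_left_mono)
    moreover have "norm x \<le> norm (voltage x) + norm (current x)"
    proof (rule power2_le_imp_le)
      show "(norm x)\<^sup>2 \<le> (norm (voltage x) + norm (current x))\<^sup>2"
        by (simp add: norm_state[of x] power2_sum)
    qed simp
    ultimately show "norm x \<le> sqrt V + sqrt (2 * a / \<delta>) + K * sqrt V"
      using v e K(2) by linarith
  qed
qed

lemma proj_eq_0_iff: "proj v = 0 \<longleftrightarrow> (\<exists>z. v = sync z)"
  using proj_add_sync[of v] by (metis add_0 proj_sync)

text \<open>As the reference angle is 0, the only candidate for the synchronous amplitude is the
  reference phasor divided by its set-point. The condition at \<open>ref\<close>, omitted in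
  \<open>setS\<close>, holds trivially.\<close>

lemma proj_zero_iff_setS: "proj v = 0 \<longleftrightarrow> v \<in> setS ref vs \<theta>"
proof -
  have block_phasor: "phasor v k / complex_of_real (vs k) = cis (rel_angle \<theta> k ref) *
        (phasor v ref / complex_of_real (vs ref))
      \<longleftrightarrow> (1 / vs k) *\<^sub>R block v k = rot (rel_angle \<theta> k ref) *v ((1 / vs ref) *\<^sub>R block v ref)" for k
    by (simp add: complex_eq_iff vec_eq_iff forall_2 block_def rot_def matrix_vector_mult_def sum_2 vector_2
        phasor_def Re_divide_of_real Im_divide_of_real add_divide_distrib diff_divide_distrib add.commute)
  have eq: "phasor v k = setpoint k * (phasor v ref / complex_of_real (vs ref)) \<longleftrightarrow>
      phasor v k / complex_of_real (vs k) = cis (rel_angle \<theta> k ref) * (phasor v ref / complex_of_real (vs ref))" for k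
    using vs_pos[of k] vs_pos[of ref] by (simp add: setpoint_def rel_angle_def ref_angle field_simps)
  have "proj v = 0 \<longleftrightarrow> (\<forall>k. phasor v k = setpoint k * (phasor v ref / complex_of_real (vs ref)))"
  proof
    assume "proj v = 0"
    then obtain z where z: "v = sync z" by (auto simp: proj_eq_0_iff)
    show "\<forall>k. phasor v k = setpoint k * (phasor v ref / complex_of_real (vs ref))"
      using vs_pos[of ref] by (simp add: z setpoint_def ref_angle)
  next
    assume *: "\<forall>k. phasor v k = setpoint k * (phasor v ref / complex_of_real (vs ref))"
    have "v = sync (phasor v ref / complex_of_real (vs ref))"
      by (rule phasor_eqI, subst phasor_sync, rule *[rule_format])
    then show "proj v = 0" unfolding proj_eq_0_iff by blast
  qed
  also have "\<dots> \<longleftrightarrow> v \<in> setS ref vs \<theta>"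
  proof -
    define P where "P k \<longleftrightarrow> phasor v k / complex_of_real (vs k) =
      cis (rel_angle \<theta> k ref) * (phasor v ref / complex_of_real (vs ref))" for k
    have "P ref" by (simp add: P_def rel_angle_def)
    then have "(\<forall>k. P k) \<longleftrightarrow> (\<forall>k. k \<noteq> ref \<longrightarrow> P k)" by metis
    then show ?thesis
      unfolding setS_def mem_Collect_eq block_phasor[symmetric] eq P_def .
  qed
  finally show ?thesis .
qed

lemma quartic_eq_0_iff: "quartic v = 0 \<longleftrightarrow> v \<in> setA vs"
proof -
  have "quartic v = 0 \<longleftrightarrow> (\<forall>k. ((vs k)\<^sup>2 - (norm (phasor v k))\<^sup>2)\<^sup>2 / (4 * (vs k)\<^sup>2) = 0)"
    unfolding quartic_def power2_norm_eq_inner by (subst sum_nonneg_eq_0_iff) auto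
  also have "\<dots> \<longleftrightarrow> (\<forall>k. norm (phasor v k) = vs k)"
    using vs_pos by (auto simp: less_imp_neq[THEN not_sym] less_imp_le)
  finally show ?thesis by (simp add: setA_def norm_block)
qed

lemma energy_eq_0_iff:
  assumes "\<delta> > 0"
  shows "energy \<delta> x = 0 \<longleftrightarrow> x \<in> setT G ref vs \<theta>"
proof -
  have "energy \<delta> x = 0 \<longleftrightarrow> proj (voltage x) = 0 \<and> quartic (voltage x) = 0 \<and> deviation x = 0"
  proof
    assume "energy \<delta> x = 0"
    then have "energy \<delta> x \<le> 0" by simp
    from energy_parts_bound[OF assms this]
    show "proj (voltage x) = 0 \<and> quartic (voltage x) = 0 \<and> deviation x = 0"
      using assms penalty_pos quartic_nonneg[of "voltage x"]
      by (auto simp: mult_le_0_iff)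
  qed (simp add: energy_def)
  also have "\<dots> \<longleftrightarrow> x \<in> setT G ref vs \<theta>"
    unfolding proj_zero_iff_setS quartic_eq_0_iff setT_def mem_Collect_eq deviation_def right_minus_eq
    by (metis IntE IntI current_pair_state pair_state_voltage_current voltage_pair_state)
  finally show ?thesis .
qed

text \<open>On the synchronous vectors with amplitude z the restoring force is 1 - |z|^2 times the
  vector, so it vanishes on the target circle and at 0 only.\<close>

lemma dissipation_eq_0:
  assumes "\<delta> > 0" "dissipation x = 0"
  shows "energy \<delta> x = 0 \<or> x = 0"
proof -
  have "(norm (proj (voltage x)))\<^sup>2 = 0" "(norm (restoring (voltage x)))\<^sup>2 = 0" "(norm (deviation x))\<^sup>2 = 0"
    using assms(2) by (simp_all add: dissipation_def add_nonneg_eq_0_iff)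
  then have p: "proj (voltage x) = 0" and r: "restoring (voltage x) = 0" and e: "deviation x = 0" by auto
  then obtain z where z: "voltage x = sync z" by (auto simp: proj_eq_0_iff)
  have "(1 - (norm z)\<^sup>2) *\<^sub>R (setpoint ref * z) = phasor (restoring (voltage x)) ref"
    using vs_pos[of ref] by (simp add: z restoring_def phasor_Phi norm_mult power_mult_distrib diff_divide_distrib)
  then have "(norm z)\<^sup>2 = 1 \<or> z = 0"
    using r setpoint_nonzero[of ref] by auto
  then show ?thesis
  proof
    assume "(norm z)\<^sup>2 = 1"
    then have "norm z = 1" by (simp add: power2_eq_1_iff) (metis norm_ge_zero not_one_le_zero le_minus_one_simps(3))
    then have "quartic (voltage x) = 0"
      by (simp add: quartic_eq_0_iff setA_def norm_block z norm_mult)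
    with p e show ?thesis by (simp add: energy_def)
  next
    assume "z = 0"
    then have "voltage x = 0" by (intro phasor_eqI) (simp add: z)
    moreover from this e have "current x = 0"
      using steady_current_linear(3)[of 0 0] by (simp add: deviation_def)
    ultimately show ?thesis by (intro disjI2 state_eqI) auto
  qed
qed

lemma setT_nonempty: "setT G ref vs \<theta> \<noteq> {}"
proof -
  have "sync 1 \<in> setS ref vs \<theta>" "sync 1 \<in> setA vs"
    by (simp_all add: proj_zero_iff_setS[symmetric] setA_def norm_block)
  then show ?thesis unfolding setT_def by blast
qed

lemma energy_origin_pos: "energy \<delta> 0 > 0"
proof -
  have "quartic 0 > 0"
    unfolding quartic_def using vs_pos by (intro sum_pos) (auto intro!: divide_pos_pos zero_less_power simp: less_imp_neq[THEN not_sym])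
  moreover have "deviation 0 = 0" using deviation_linear(3)[of 0 0] by simp
  ultimately show ?thesis using penalty_pos by (simp add: energy_def)
qed

text \<open>Projection and deviation vanish on this vector; only the penalty term remains.\<close>

lemma instability_form_pos: "instability_form \<delta> (pair_state (sync 1) (steady_current G (sync 1)))
    (pair_state (sync 1) (steady_current G (sync 1))) > 0"
proof -
  have "sync 1 \<noteq> 0"
    using phasor_sync[of 1 ref] setpoint_nonzero[of ref] by (metis mult.right_neutral phasor_0)
  then show ?thesis
    using penalty_pos by (simp add: instability_form_def deviation_def)
qed

text \<open>For the restoring force, \<open>decay_rate\<close> is the dissipation inequality. For
  \<phi> equal to the voltage its left side is minus the instability form paired with the
  linearisation, and |\<phi>|^2 on the right controls the full voltage.\<close>

lemma linearization_growth:
  obtains \<delta> \<sigma> where "\<delta> > 0" "\<sigma> > 0"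
    "\<And>x. energy_derivative \<delta> x (closed_loop G \<rho> ps qs vs \<alpha> \<eta> x) \<le> - (\<sigma> * dissipation x)"
    "\<And>x. instability_form \<delta> x (linearization x) \<ge> \<sigma> * (norm x)\<^sup>2"
proof -
  obtain \<delta> \<sigma> where \<delta>: "\<delta> > 0" and \<sigma>: "\<sigma> > 0" and decay:
    "\<And>x \<phi>. proj (voltage x) \<bullet> \<phi> \<le> (norm (proj (voltage x)))\<^sup>2 \<Longrightarrow>
      proj (voltage x) \<bullet> voltage (forced_field \<phi> x) - penalty * (\<phi> \<bullet> voltage (forced_field \<phi> x))
        + node_weight * (node_current (deviation x) \<bullet> node_current (deviation (forced_field \<phi> x)))
        + \<delta> * (deviation x \<bullet> deviation (forced_field \<phi> x))
      \<le> - \<sigma> * ((norm (proj (voltage x)))\<^sup>2 + (norm \<phi>)\<^sup>2 + (norm (deviation x))\<^sup>2)"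
  proof (rule decay_rate, goal_cases)
    case (1 \<delta> \<sigma>)
    show ?case by (rule 1(1)[OF 1(2-)])
  qed
  define K where "K = onorm (steady_current G)"
  have K: "K \<ge> 0" "norm (steady_current G v) \<le> K * norm v" for v
    unfolding K_def using onorm[OF bounded_linear_steady_current] onorm_pos_le[OF bounded_linear_steady_current]
    by auto
  \<comment> \<open>Conversion from voltage and deviation to voltage and current, using that the
    current is at most the deviation plus K times the voltage.\<close>
  define B where "B = 2 + 2 * K\<^sup>2"
  have B: "B \<ge> 2" by (simp add: B_def)
  have norm_le: "(norm x)\<^sup>2 \<le> B * ((norm (voltage x))\<^sup>2 + (norm (deviation x))\<^sup>2)" for x
  proof -
    define v e where "v = norm (voltage x)" and "e = norm (deviation x)"
    have "norm (current x) \<le> e + K * v"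
      using norm_triangle_ineq[of "deviation x" "steady_current G (voltage x)"] K(2)[of "voltage x"]
      by (simp add: deviation_def v_def e_def)
    then have "(norm (current x))\<^sup>2 \<le> (e + K * v)\<^sup>2" by (rule power_mono) simp
    also have "\<dots> \<le> 2 * e\<^sup>2 + 2 * (K * v)\<^sup>2"
      using zero_le_power2[of "e - K * v"] by (simp add: power2_sum power2_diff)
    finally have "(norm x)\<^sup>2 \<le> (1 + 2 * K\<^sup>2) * v\<^sup>2 + 2 * e\<^sup>2"
      by (simp add: norm_state[of x] v_def power_mult_distrib algebra_simps)
    also have "\<dots> \<le> B * v\<^sup>2 + B * e\<^sup>2"
      by (intro add_mono mult_right_mono) (auto simp: B_def)
    finally show ?thesis by (simp add: v_def e_def distrib_left)
  qed
  show ?thesis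
  proof (rule that[OF \<delta>])
    show "\<sigma> / B > 0" using \<sigma> B by simp
    have smaller: "\<sigma> / B \<le> \<sigma>" using \<sigma> B by (simp add: divide_le_eq)
    show "energy_derivative \<delta> x (closed_loop G \<rho> ps qs vs \<alpha> \<eta> x) \<le> - (\<sigma> / B * dissipation x)" for x
    proof -
      have "energy_derivative \<delta> x (closed_loop G \<rho> ps qs vs \<alpha> \<eta> x) \<le> - \<sigma> * dissipation x"
        using decay[OF proj_inner_restoring] by (simp add: energy_derivative_def closed_loop_eq dissipation_def)
      moreover have "\<sigma> / B * dissipation x \<le> \<sigma> * dissipation x"
        using smaller by (rule mult_right_mono) (simp add: dissipation_def)
      ultimately show ?thesis by simp
    qed
    show "instability_form \<delta> x (linearization x) \<ge> \<sigma> / B * (norm x)\<^sup>2" for x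
    proof -
      have "\<sigma> / B * (norm x)\<^sup>2 \<le> \<sigma> / B * (B * ((norm (voltage x))\<^sup>2 + (norm (deviation x))\<^sup>2))"
        using \<sigma> B by (intro mult_left_mono norm_le) auto
      also have "\<dots> = \<sigma> * ((norm (voltage x))\<^sup>2 + (norm (deviation x))\<^sup>2)" using B by simp
      also have "\<dots> \<le> \<sigma> * ((norm (proj (voltage x)))\<^sup>2 + (norm (voltage x))\<^sup>2 + (norm (deviation x))\<^sup>2)"
        using \<sigma> by (intro mult_left_mono) auto
      also have "\<dots> \<le> instability_form \<delta> x (linearization x)"
        using decay[of x "voltage x"]
        by (simp add: instability_form_def linearization_def inner_proj_self inner_proj_proj)
      finally show ?thesis .
    qed
  qed
qed

lemma cubic_voltage_continuous: "continuous_on UNIV (\<lambda>x. cubic (voltage x))"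
proof -
  have "continuous_on UNIV cubic"
  proof (rule continuous_at_imp_continuous_on, rule ballI)
    fix v :: "real^('n \<times> 2)"
    have "(3 * (norm v + 1)\<^sup>2 / (Min (range vs))\<^sup>2)-lipschitz_on (ball v 1) cubic"
    proof (rule lipschitz_onI)
      fix x y assume "x \<in> ball v 1" "y \<in> ball v 1"
      then have "norm x \<le> norm v + 1" "norm y \<le> norm v + 1"
        using norm_triangle_ineq2[of x v] norm_triangle_ineq2[of y v] by (auto simp: dist_norm norm_minus_commute)
      from cubic_lipschitz_ball[OF this]
      show "dist (cubic x) (cubic y) \<le> 3 * (norm v + 1)\<^sup>2 / (Min (range vs))\<^sup>2 * dist x y"
        by (simp add: dist_norm)
    qed simp
    from lipschitz_on_continuous_on[OF this] show "isCont cubic v"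
      by (simp add: continuous_on_eq_continuous_at)
  qed
  then show ?thesis
    by (rule continuous_on_compose2) (auto intro: linear_continuous_on[OF bounded_linear_voltage])
qed

lemma closed_loop_has_derivative_origin:
  "(closed_loop G \<rho> ps qs vs \<alpha> \<eta> has_derivative linearization) (at 0)"
proof -
  obtain C where C: "C > 0"
    "\<And>r x y. norm x \<le> r \<Longrightarrow> norm y \<le> r \<Longrightarrow> norm (cubic_field x - cubic_field y) \<le> C * r\<^sup>2 * norm (x - y)"
    by (rule cubic_field_lipschitz) blast
  have "(cubic_field has_derivative (\<lambda>h. 0)) (at 0)"
    unfolding has_derivative_at
  proof
    have bound: "norm (cubic_field (0 + h) - cubic_field 0 - 0) / norm h \<le> C * (norm h)\<^sup>2" for h
      using C(2)[of h "norm h" 0] C(1) by (cases "h = 0") (simp_all add: field_simps)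
    have "((\<lambda>h :: real^('n \<times> 2 + 'm \<times> 2). C * (norm h)\<^sup>2) \<longlongrightarrow> C * (norm (0 :: real^('n \<times> 2 + 'm \<times> 2)))\<^sup>2) (at 0)"
      by (intro tendsto_intros)
    then have "((\<lambda>h :: real^('n \<times> 2 + 'm \<times> 2). C * (norm h)\<^sup>2) \<longlongrightarrow> 0) (at 0)" by simp
    then show "(\<lambda>h. norm (cubic_field (0 + h) - cubic_field 0 - 0) / norm h) \<midarrow>0\<rightarrow> 0"
      by (rule Lim_null_comparison[rotated]) (use bound in \<open>auto intro!: always_eventually\<close>)
  qed simp
  from has_derivative_diff[OF bounded_linear_imp_has_derivative[OF bounded_linear_linearization] this]
  show ?thesis by (simp add: closed_loop_split[abs_def])
qed

theorem closed_loop_stability: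
  "almost_globally_asymptotically_stable (closed_loop G \<rho> ps qs vs \<alpha> \<eta>) (setT G ref vs \<theta>)
    \<and> exponentially_unstable_equilibrium (closed_loop G \<rho> ps qs vs \<alpha> \<eta>) 0"
proof
  let ?f = "closed_loop G \<rho> ps qs vs \<alpha> \<eta>"
  let ?u = "pair_state (sync 1) (steady_current G (sync 1))"
  obtain \<delta> \<sigma> where \<delta>: "\<delta> > 0" and \<sigma>: "\<sigma> > 0" and
    decay: "\<And>x. energy_derivative \<delta> x (?f x) \<le> - (\<sigma> * dissipation x)" and
    growth: "\<And>x. instability_form \<delta> x (linearization x) \<ge> \<sigma> * (norm x)\<^sup>2"
  proof (rule linearization_growth, goal_cases)
    case (1 \<delta> \<sigma>)
    show ?case by (rule 1(1)[OF 1(2-)])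
  qed
  obtain CQ where CQ: "CQ > 0" "\<And>x y. \<bar>instability_form \<delta> x y\<bar> \<le> norm x * norm y * CQ"
    using bounded_bilinear.pos_bounded[OF instability_form_bilinear[of \<delta>]] by auto
  obtain C where C: "C > 0"
    "\<And>r x y. norm x \<le> r \<Longrightarrow> norm y \<le> r \<Longrightarrow> norm (cubic_field x - cubic_field y) \<le> C * r\<^sup>2 * norm (x - y)"
    by (rule cubic_field_lipschitz) blast
  \<comment> \<open>The growth rate \<sigma> is split in halves: r is such that the cubic remainder
    uses up at most one half, and \<gamma> is such that the other half dominates \<gamma> times the
    form.\<close>
  define \<gamma> where "\<gamma> = \<sigma> / (2 * CQ)"
  define r where "r = sqrt (\<sigma> / (2 * CQ * C))"
  have r: "r > 0" "CQ * (C * r\<^sup>2) = \<sigma> / 2"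
    using \<sigma> CQ(1) C(1) by (simp_all add: r_def)
  interpret almost_global_lyapunov_system ?f "energy \<delta>" "energy_derivative \<delta>" "\<lambda>x. \<sigma> * dissipation x"
    "instability_form \<delta>" ?u \<gamma> r
  proof (intro almost_global_lyapunov_system.intro lyapunov_system.intro almost_global_lyapunov_system_axioms.intro)
    show "\<exists>L. L-lipschitz_on (cball 0 r) ?f" for r by (rule closed_loop_lipschitz)
    show "(energy \<delta> has_derivative energy_derivative \<delta> x) (at x)" for x by (rule energy_has_derivative)
    show "energy_derivative \<delta> x (?f x) \<le> - (\<sigma> * dissipation x)" for x by (rule decay)
    show "\<sigma> * dissipation x \<ge> 0" for x using \<sigma> by (simp add: dissipation_def)
    show "continuous_on UNIV (\<lambda>x. \<sigma> * dissipation x)"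
      unfolding dissipation_def restoring_eq
      by (intro continuous_intros cubic_voltage_continuous
          linear_continuous_on[OF bounded_linear_voltage] linear_continuous_on[OF bounded_linear_proj_voltage]
          linear_continuous_on[OF bounded_linear_deviation])
    show "bounded {x. energy \<delta> x \<le> a}" for a by (rule energy_sublevel_bounded[OF \<delta>])
    show "energy \<delta> x \<ge> 0" for x by (rule energy_nonneg[OF \<delta>])
    show "\<exists>x. energy \<delta> x = 0" using setT_nonempty energy_eq_0_iff[OF \<delta>] by blast
    show "energy \<delta> 0 > 0" by (rule energy_origin_pos)
    show "energy \<delta> x = 0 \<or> x = 0" if "\<sigma> * dissipation x = 0" for x
      using that \<sigma> dissipation_eq_0[OF \<delta>] by simp
    show "bounded_bilinear (instability_form \<delta>)" by (rule instability_form_bilinear)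
    show "instability_form \<delta> x y = instability_form \<delta> y x" for x y by (rule instability_form_sym)
    show "instability_form \<delta> ?u ?u > 0" by (rule instability_form_pos)
    show "\<gamma> > 0" using \<sigma> CQ(1) by (simp add: \<gamma>_def)
    show "r > 0" by (rule r(1))
    fix x y :: "real^('n \<times> 2 + 'm \<times> 2)" assume xy: "x \<in> cball 0 r" "y \<in> cball 0 r"
    let ?w = "x - y" and ?d = "cubic_field x - cubic_field y"
    have "\<bar>instability_form \<delta> ?w ?d\<bar> \<le> norm ?w * norm ?d * CQ" by (rule CQ(2))
    also have "\<dots> \<le> norm ?w * (C * r\<^sup>2 * norm ?w) * CQ"
      using C(2)[of x r y] xy CQ(1) by (intro mult_right_mono mult_left_mono) auto
    also have "\<dots> = CQ * (C * r\<^sup>2) * (norm ?w)\<^sup>2" by (simp add: power2_eq_square)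
    finally have 1: "\<bar>instability_form \<delta> ?w ?d\<bar> \<le> \<sigma> / 2 * (norm ?w)\<^sup>2" unfolding r(2) .
    have "\<gamma> * instability_form \<delta> ?w ?w \<le> \<gamma> * (norm ?w * norm ?w * CQ)"
      using CQ(2)[of ?w ?w] \<sigma> CQ(1) by (intro mult_left_mono) (auto simp: \<gamma>_def)
    also have "\<dots> = \<sigma> / 2 * (norm ?w)\<^sup>2" using CQ(1) by (simp add: \<gamma>_def power2_eq_square)
    finally have 2: "\<gamma> * instability_form \<delta> ?w ?w \<le> \<sigma> / 2 * (norm ?w)\<^sup>2" .
    have "?f x - ?f y = linearization ?w - ?d"
      by (simp add: closed_loop_split linear_diff[OF linearization_linear])
    then have "instability_form \<delta> ?w (?f x - ?f y)
        = instability_form \<delta> ?w (linearization ?w) - instability_form \<delta> ?w ?d"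
      by (simp only: bounded_bilinear.diff_right[OF instability_form_bilinear])
    with growth[of ?w] 1 2 show "\<gamma> * instability_form \<delta> ?w ?w \<le> instability_form \<delta> ?w (?f x - ?f y)"
      by linarith
  qed
  have "target = setT G ref vs \<theta>"
    using energy_eq_0_iff[OF \<delta>] by (auto simp: target_def)
  with almost_globally_asymptotically_stable_target
  show "almost_globally_asymptotically_stable ?f (setT G ref vs \<theta>)" by simp
  note der = closed_loop_has_derivative_origin
  have lin: "matrix linearization *v x = linearization x" for x
    by (rule matrix_vector_mul(2)[OF linearization_linear, THEN fun_cong])
  have "jacobian ?f (at 0) = matrix linearization"
    using frechet_derivative_at[OF der] by (simp add: jacobian_def)
  moreover have "\<exists>\<mu>. eigenvalue (map_matrix complex_of_real (matrix linearization)) \<mu> \<and> Re \<mu> > 0"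
    by (rule unstable_eigenvalue[OF instability_form_bilinear[of \<delta>] instability_form_sym \<sigma> _ instability_form_pos])
      (simp add: lin growth)
  moreover have "?f 0 = 0"
  proof -
    have "cubic 0 = 0" by (rule phasor_eqI) simp
    then have "cubic_field 0 = 0" by (intro state_eqI) (simp_all add: cubic_field_def)
    then show ?thesis using linear_0[OF linearization_linear] by (simp add: closed_loop_split)
  qed
  ultimately show "exponentially_unstable_equilibrium ?f 0"
    using der by (auto simp: exponentially_unstable_equilibrium_def differentiable_def)
qed

end

theorem theorem2:
  fixes G :: "('n::finite, 'm::finite) network"
    and ref :: 'n
    and ps qs vs \<theta> :: "'n \<Rightarrow> real"
    and \<rho> c \<alpha> \<eta> :: real
  assumes network: "power_network G \<rho>"
    and vs_pos: "\<And>k. vs k > 0"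
    and ref_angle: "\<theta> ref = 0"
    and consistent: "consistent G ps qs vs \<theta>"
    and pos: "c > 0" "\<alpha> > 0" "\<eta> > 0"
    and stability: "\<exists>\<theta>bar\<in>{0..pi / 2}.
      (\<forall>j k. \<bar>rel_angle \<theta> j k\<bar> \<le> \<theta>bar) \<and>
      (\<forall>k. (\<Sum>j\<in>nbrs G k. weight G (line G j k) * \<bar>1 - vs j / vs k * cos (rel_angle \<theta> j k)\<bar>) + \<alpha>
           < (1 + cos \<theta>bar) / 2 * ((Min (range vs))\<^sup>2 / (Max (range vs))\<^sup>2) * lambda2 (laplacian G) - c)"
    and gain: "\<eta> < c / (\<rho> * mat_norm (calY G) * (c + 5 * mat_norm (calK G \<rho> ps qs vs - calL G)))"
  shows "almost_globally_asymptotically_stable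
           (closed_loop G \<rho> ps qs vs \<alpha> \<eta>) (setT G ref vs \<theta>)
       \<and> exponentially_unstable_equilibrium (closed_loop G \<rho> ps qs vs \<alpha> \<eta>) 0"
proof -
  from stability obtain \<theta>bar where \<theta>bar: "\<theta>bar \<in> {0..pi / 2}"
    "\<And>j k. \<bar>rel_angle \<theta> j k\<bar> \<le> \<theta>bar"
    "\<And>k. (\<Sum>j\<in>nbrs G k. weight G (line G j k) * \<bar>1 - vs j / vs k * cos (rel_angle \<theta> j k)\<bar>) + \<alpha>
       < (1 + cos \<theta>bar) / 2 * ((Min (range vs))\<^sup>2 / (Max (range vs))\<^sup>2) * lambda2 (laplacian G) - c"
    by blast
  interpret inverter_network G \<rho> ref ps qs vs \<theta> c \<alpha> \<eta> \<theta>bar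
    using network vs_pos ref_angle consistent pos \<theta>bar gain
    by unfold_locales auto
  show ?thesis by (rule closed_loop_stability)
qed

end
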